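(* Let $L\in A_{1,2}(\omega)$, where $\omega=\operatorname{diag}\{\omega_1,\dots,\omega_m\}\in\mathcal D$. Then $$\alpha_n=\frac{2}{\pi}I_m+\frac{K_n}{n},\quad n\ge1,$$ where $\{K_n\}$ is a sequence of $m\times m$ matrices whose norms form a sequence from $l_2$.
   Context: Notation. $m\ge1$ is fixed; $I_m,0_m$ are the identity and zero $m\times m$ matrices; $\|A\|=\max_j\sum_k|a_{jk}|$. $\{\kappa_n\}$ denotes various sequences from $l_2$. $\sqrt\lambda$ is chosen with $\mathrm{Re}\,\sqrt\lambda\ge0$. $\mathcal D$ is the set of complex diagonal $m\times m$ matrices. Problem $L$. For an $m\times m$ matrix function $Q$ with complex-valued entries in $L_2(0,\pi)$ and $h,H\in\mathbb C^{m\times m}$, $L=L(Q,h,H)$ is the boundary value problem $-Y''+Q(x)Y=\lambda Y$, $x\in(0,\pi)$, $U(Y):=Y'(0)-hY(0)=0$, $V(Y):=Y'(\pi)+HY(\pi)=0$. Let $\varphi(x,\lambda)$ be the $m\times m$ matrix solution with $\varphi(0,\lambda)=I_m$, $\varphi'(0,\lambda)=h$. The characteristic function is $\Delta(\lambda)=\det V(\varphi(\cdot,\lambda))$; its zeros are the eigenvalues of $L$. Let $\Phi(x,\lambda)$ be the matrix solution with $U(\Phi)=I_m$, $V(\Phi)=0_m$; $M(\lambda)=\Phi(0,\lambda)$ is the Weyl matrix, meromorphic with poles at eigenvalues of $L$. $L\in A(\omega)$ means that the potential is in $L_2(0,\pi)$ and $h+H+\frac12\int_0^\pi Q(x)\,dx=\omega$.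 For $L\in A(\omega)$, $\omega\in\mathcal D$, the eigenvalues, counted with their multiplicities as zeros of $\Delta$, are indexed as $\{\lambda_{nq}\}_{n\ge0,\,q=1,\dots,m}$ so that $\sqrt{\lambda_{nq}}=n+\frac{\omega_q}{\pi n}+\frac{\kappa_n}{n}$ for $n\ge1$ (this is possible). Put $\alpha_{nq}=\operatorname{Res}_{\lambda=\lambda_{nq}}M(\lambda)$. $L\in A_{1,2}(\omega)$ means: $L\in A(\omega)$; all poles of $M(\lambda)$ are simple; and $\|\alpha_{nq}\|\le C$ for all $n,q$. Choose for each distinct value in $\{\lambda_{nq}\}$ one representing index pair, giving $\{(n_k,q_k)\}_{k\ge0}$; put $\alpha'_{n_kq_k}=\alpha_{n_kq_k}$ and $\alpha'_{nq}=0_m$ for all other $(n,q)$. Then $\alpha_n=\sum_{q=1}^m\alpha'_{nq}$. *)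

theory Defs
  imports "HOL-Complex_Analysis.Complex_Analysis"
begin

(* Products of matrices are written with **, since * on vectors is componentwise;
   likewise mat 1 (not 1) is the identity matrix and mat c is c times the identity.
   A matrix entry a_{jk} is A $ j $ k. *)

definition row_sum_norm :: "complex^'m^'m \<Rightarrow> real" where
  "row_sum_norm A = Max (range (\<lambda>j. \<Sum>k\<in>UNIV. cmod (A $ j $ k)))"

definition diag :: "complex^'m \<Rightarrow> complex^'m^'m" where
  "diag w = (\<chi> j k. if j = k then w $ j else 0)"

definition l2_seq :: "(nat \<Rightarrow> 'a::real_normed_vector) \<Rightarrow> bool" where
  "l2_seq s \<longleftrightarrow> summable (\<lambda>n. (norm (s n))\<^sup>2)"

definition L2_potential :: "(real \<Rightarrow> complex^'m^'m) \<Rightarrow> bool" where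
  "L2_potential Q \<longleftrightarrow>
     (\<forall>j k. (\<lambda>x. Q x $ j $ k) \<in> borel_measurable (lebesgue_on {0..pi}) \<and>
            integrable (lebesgue_on {0..pi}) (\<lambda>x. (cmod (Q x $ j $ k))\<^sup>2))"

(* The derivative on [0,pi], one-sided at the end points. *)
definition deriv_Icc :: "(real \<Rightarrow> complex^'m^'m) \<Rightarrow> real \<Rightarrow> complex^'m^'m" where
  "deriv_Icc Y x = vector_derivative Y (at x within {0..pi})"

(* Solutions in the Caratheodory sense, as usual for integrable potentials: Y is differentiable,
   Y' is absolutely continuous (the indefinite integral of an integrable function Y2, which is
   then Y'' almost everywhere), and -Y'' + Q Y = z Y holds almost everywhere. *)
definition sl_solution ::
  "(real \<Rightarrow> complex^'m^'m) \<Rightarrow> complex \<Rightarrow> (real \<Rightarrow> complex^'m^'m) \<Rightarrow> bool" where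
  "sl_solution Q z Y \<longleftrightarrow>
     (\<forall>x\<in>{0..pi}. Y differentiable (at x within {0..pi})) \<and>
     (\<exists>Y2. Y2 absolutely_integrable_on {0..pi} \<and>
           (\<forall>x\<in>{0..pi}. deriv_Icc Y x = deriv_Icc Y 0 + integral {0..x} Y2) \<and>
           (AE x in lebesgue_on {0..pi}. - Y2 x + Q x ** Y x = mat z ** Y x))"

definition U_form :: "complex^'m^'m \<Rightarrow> (real \<Rightarrow> complex^'m^'m) \<Rightarrow> complex^'m^'m" where
  "U_form h Y = deriv_Icc Y 0 - h ** Y 0"

definition V_form :: "complex^'m^'m \<Rightarrow> (real \<Rightarrow> complex^'m^'m) \<Rightarrow> complex^'m^'m" where
  "V_form H Y = deriv_Icc Y pi + H ** Y pi"

(* Only the values on [0,pi] are determined; nothing below depends on the others. *)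
definition phi ::
  "(real \<Rightarrow> complex^'m^'m) \<Rightarrow> complex^'m^'m \<Rightarrow> complex \<Rightarrow> real \<Rightarrow> complex^'m^'m" where
  "phi Q h z = (SOME Y. sl_solution Q z Y \<and> Y 0 = mat 1 \<and> deriv_Icc Y 0 = h)"

definition char_fun ::
  "(real \<Rightarrow> complex^'m^'m) \<Rightarrow> complex^'m^'m \<Rightarrow> complex^'m^'m \<Rightarrow> complex \<Rightarrow> complex" where
  "char_fun Q h H z = det (V_form H (phi Q h z))"

(* Exists (and is unique on [0,pi]) exactly when z is not a zero of char_fun; at these zeros
   the value is unspecified, but only punctured neighbourhoods of them are used below. *)
definition weyl_solution ::
  "(real \<Rightarrow> complex^'m^'m) \<Rightarrow> complex^'m^'m \<Rightarrow> complex^'m^'m \<Rightarrow> complex \<Rightarrow> real \<Rightarrow> complex^'m^'m"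
  where
  "weyl_solution Q h H z =
     (SOME Y. sl_solution Q z Y \<and> U_form h Y = mat 1 \<and> V_form H Y = 0)"

definition weyl_matrix ::
  "(real \<Rightarrow> complex^'m^'m) \<Rightarrow> complex^'m^'m \<Rightarrow> complex^'m^'m \<Rightarrow> complex \<Rightarrow> complex^'m^'m" where
  "weyl_matrix Q h H z = weyl_solution Q h H z 0"

definition matrix_residue :: "(complex \<Rightarrow> complex^'m^'m) \<Rightarrow> complex \<Rightarrow> complex^'m^'m" where
  "matrix_residue F z = (\<chi> j k. residue (\<lambda>u. F u $ j $ k) z)"

(* The order of a pole of a matrix function is the largest order of a pole among its entries. *)
definition all_poles_simple :: "(complex \<Rightarrow> complex^'m^'m) \<Rightarrow> bool" where
  "all_poles_simple F \<longleftrightarrow>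
     (\<forall>z j k. is_pole (\<lambda>u. F u $ j $ k) z \<longrightarrow> zorder (\<lambda>u. F u $ j $ k) z = -1)"

definition class_A ::
  "(real \<Rightarrow> complex^'m^'m) \<Rightarrow> complex^'m^'m \<Rightarrow> complex^'m^'m \<Rightarrow> complex^'m^'m \<Rightarrow> bool" where
  "class_A Q h H \<omega> \<longleftrightarrow>
     L2_potential Q \<and> h + H + (1/2) *\<^sub>R integral {0..pi} Q = \<omega>"

(* lam enumerates the zeros of char_fun with multiplicities, with the prescribed asymptotics.
   csqrt is the root with nonnegative real part; the summable remainder may depend on q. *)
definition eigenvalue_indexing ::
  "(real \<Rightarrow> complex^'m^'m) \<Rightarrow> complex^'m^'m \<Rightarrow> complex^'m^'m \<Rightarrow> complex^'m
     \<Rightarrow> (nat \<Rightarrow> 'm \<Rightarrow> complex) \<Rightarrow> bool" where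
  "eigenvalue_indexing Q h H w lam \<longleftrightarrow>
     (\<forall>n q. char_fun Q h H (lam n q) = 0) \<and>
     (\<forall>z. char_fun Q h H z = 0 \<longrightarrow>
        finite {(n, q). lam n q = z} \<and>
        int (card {(n, q). lam n q = z}) = zorder (char_fun Q h H) z) \<and>
     (\<forall>q. \<exists>\<kappa> :: nat \<Rightarrow> complex. l2_seq \<kappa> \<and>
        (\<forall>n\<ge>1. csqrt (lam n q) = of_nat n + w $ q / (of_real pi * of_nat n) + \<kappa> n / of_nat n))"

definition alpha ::
  "(real \<Rightarrow> complex^'m^'m) \<Rightarrow> complex^'m^'m \<Rightarrow> complex^'m^'m
     \<Rightarrow> (nat \<Rightarrow> 'm \<Rightarrow> complex) \<Rightarrow> nat \<Rightarrow> 'm \<Rightarrow> complex^'m^'m" where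
  "alpha Q h H lam n q = matrix_residue (weyl_matrix Q h H) (lam n q)"

definition class_A12 ::
  "(real \<Rightarrow> complex^'m^'m) \<Rightarrow> complex^'m^'m \<Rightarrow> complex^'m^'m \<Rightarrow> complex^'m
     \<Rightarrow> (nat \<Rightarrow> 'm \<Rightarrow> complex) \<Rightarrow> bool" where
  "class_A12 Q h H w lam \<longleftrightarrow>
     class_A Q h H (diag w) \<and>
     eigenvalue_indexing Q h H w lam \<and>
     all_poles_simple (weyl_matrix Q h H) \<and>
     (\<exists>C. \<forall>n q. row_sum_norm (alpha Q h H lam n q) \<le> C)"

(* R contains exactly one index pair for each distinct value of lam. *)
definition representatives :: "(nat \<Rightarrow> 'm \<Rightarrow> complex) \<Rightarrow> (nat \<times> 'm) set \<Rightarrow> bool" where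
  "representatives lam R \<longleftrightarrow>
     bij_betw (\<lambda>(n, q). lam n q) R (range (\<lambda>(n, q). lam n q))"

definition alpha_sum ::
  "(real \<Rightarrow> complex^'m^'m) \<Rightarrow> complex^'m^'m \<Rightarrow> complex^'m^'m
     \<Rightarrow> (nat \<Rightarrow> 'm \<Rightarrow> complex) \<Rightarrow> (nat \<times> 'm) set \<Rightarrow> nat \<Rightarrow> complex^'m^'m" where
  "alpha_sum Q h H lam R n =
     (\<Sum>q\<in>UNIV. if (n, q) \<in> R then alpha Q h H lam n q else 0)"

end

theory Submission
  imports Defs
begin

text \<open>
  Write the spectral parameter as \<open>\<rho>\<^sup>2\<close>, and let \<open>S\<close> (the constant \<open>sine_solution\<close>) be the matrix
  solution with \<open>S(0) = 0\<close>, \<open>S'(0) = I\<close>. The Weyl solution is \<open>S + \<phi> M\<close>, so the boundary condition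
  at \<open>\<pi>\<close> says \<open>V(\<phi>) M = - V(S)\<close> (\<open>weyl_matrix_equation\<close>). In the strip \<open>\<bar>Im \<rho>\<bar> \<le> 1\<close>, variation of
  constants gives
  \<open>V(\<phi>) = - \<rho> sin \<rho>\<pi> I + cos \<rho>\<pi> \<omega> + a(\<rho>) + O(1/\<rho>)\<close> and
  \<open>V(S) = cos \<rho>\<pi> I + (sin \<rho>\<pi> \<omega>\<^sub>1 - b(\<rho>)) / \<rho> + O(1/\<rho>\<^sup>2)\<close>,
  where \<open>\<omega>\<^sub>1 = H + (1/2) \<integral> Q\<close> and \<open>a\<close>, \<open>b\<close> are a cosine and a sine transform of \<open>Q\<close>. Where \<open>sin \<rho>\<pi>\<close>
  is bounded away from zero, solving for \<open>M\<close> yields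
  \<open>2 \<rho> M(\<rho>\<^sup>2) = 2 cot \<rho>\<pi> I + (2/\<rho>) (\<omega>\<^sub>1 + cot\<^sup>2 \<rho>\<pi> \<omega>) + O((\<bar>a\<bar> + \<bar>b\<bar> + 1/\<bar>\<rho>\<bar>) / \<bar>\<rho>\<bar>)\<close>
  (\<open>weyl_matrix_asymptotics\<close>).

  Integrate this over the circle \<open>\<bar>\<rho> - n\<bar> = 1/4\<close>. By the asymptotics of the eigenvalues, for large \<open>n\<close>
  the zeros of the characteristic function of \<open>\<rho>\<^sup>2\<close> inside the circle are exactly the roots of
  \<open>\<lambda>(n, q)\<close>, \<open>q = 1, \<dots>, m\<close>, and the substitution \<open>\<lambda> = \<rho>\<^sup>2\<close> preserves residues; hence the left-hand
  side integrates to \<open>2\<pi>i \<alpha>\<^sub>n\<close> (\<open>has_contour_integral_alpha_sum\<close>). On the right, \<open>2 cot \<rho>\<pi>\<close> contributes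
  \<open>2\<pi>i (2/\<pi>)\<close>. The factor \<open>2/\<rho>\<close> may be replaced by \<open>2/n\<close> up to \<open>O(1/n\<^sup>2)\<close>, and then the second term
  contributes nothing, because constants and \<open>cot\<^sup>2 \<rho>\<pi>\<close> have primitives along the circle
  (\<open>cot_contour_integrals\<close>). So \<open>2\<pi>i n (\<alpha>\<^sub>n - (2/\<pi>) I)\<close> is the integral over the circle of a function that
  is \<open>O(\<bar>a(\<rho>)\<bar> + \<bar>b(\<rho>)\<bar> + 1/n)\<close>. For fixed \<open>\<zeta>\<close>, the numbers \<open>a(n + \<zeta>)\<close> and \<open>b(n + \<zeta>)\<close> are
  combinations of Fourier coefficients of the functions \<open>exp (\<plusminus> i \<zeta> (\<pi> - 2t)) Q(t)\<close>, so Bessel's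
  inequality bounds their square sums over \<open>n\<close>, uniformly for bounded \<open>\<zeta>\<close>
  (\<open>transforms_square_sum_bounded\<close>). The Cauchy-Schwarz inequality on the circle transfers the bound to
  the integrals (\<open>contour_integrals_square_sum_le\<close>).

  The facts on the differential equation come from its equivalence with
  \<open>Y(x) = A + x B + \<integral>\<^sub>0\<^sup>x \<integral>\<^sub>0\<^sup>s (Q - \<lambda>) Y\<close>. In the weighted norm \<open>sup exp (- K x) \<bar>Y(x)\<bar>\<close> with large \<open>K\<close>
  the integral operator has norm at most \<open>1/2\<close>. This gives existence, uniqueness and an a priori bound
  (\<open>volterra_solution_bound\<close>), and two applications of the bound show that the solution is complex
  differentiable in \<open>\<lambda>\<close> (\<open>ivp_expansion\<close>).
\<close>

no_notation fps_nth (infixl \<open>$\<close> 75)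

section \<open>Matrices\<close>

lemma norm_matrix_sq:
  fixes A :: "complex^'n^'m"
  shows "(norm A)\<^sup>2 = (\<Sum>i\<in>UNIV. \<Sum>j\<in>UNIV. (cmod (A $ i $ j))\<^sup>2)"
  by (simp add: norm_vec_def L2_set_def sum_nonneg)

text \<open>The norm of \<open>complex^'m^'m\<close> is the Frobenius norm, which is submultiplicative by the
  Cauchy-Schwarz inequality for the entries of a product.\<close>

lemma norm_matrix_mult_le:
  fixes A B :: "complex^'m^'m"
  shows "norm (A ** B) \<le> norm A * norm B"
proof -
  have entry: "(cmod ((A ** B) $ i $ j))\<^sup>2
      \<le> (\<Sum>k\<in>UNIV. (cmod (A $ i $ k))\<^sup>2) * (\<Sum>k\<in>UNIV. (cmod (B $ k $ j))\<^sup>2)" for i j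
  proof -
    have "cmod ((A ** B) $ i $ j) \<le> (\<Sum>k\<in>UNIV. cmod (A $ i $ k) * cmod (B $ k $ j))"
      unfolding matrix_matrix_mult_def by (simp add: norm_mult sum_norm_le)
    then have "(cmod ((A ** B) $ i $ j))\<^sup>2 \<le> (\<Sum>k\<in>UNIV. cmod (A $ i $ k) * cmod (B $ k $ j))\<^sup>2"
      by (intro power_mono) auto
    also have "\<dots> \<le> (\<Sum>k\<in>UNIV. (cmod (A $ i $ k))\<^sup>2) * (\<Sum>k\<in>UNIV. (cmod (B $ k $ j))\<^sup>2)"
      by (rule Cauchy_Schwarz_ineq_sum)
    finally show ?thesis .
  qed
  have "(norm (A ** B))\<^sup>2 \<le> (\<Sum>i\<in>UNIV. \<Sum>j\<in>UNIV.
      (\<Sum>k\<in>UNIV. (cmod (A $ i $ k))\<^sup>2) * (\<Sum>k\<in>UNIV. (cmod (B $ k $ j))\<^sup>2))"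
    unfolding norm_matrix_sq by (intro sum_mono entry)
  also have "\<dots> = (\<Sum>i\<in>UNIV. \<Sum>k\<in>UNIV. (cmod (A $ i $ k))\<^sup>2) * (\<Sum>j\<in>UNIV. \<Sum>k\<in>UNIV. (cmod (B $ k $ j))\<^sup>2)"
    by (simp add: sum_product)
  also have "\<dots> = (norm A * norm B)\<^sup>2"
    unfolding power_mult_distrib norm_matrix_sq
    using sum.swap[of "\<lambda>j k. (cmod (B $ k $ j))\<^sup>2" UNIV UNIV] by simp
  finally show ?thesis
    by (rule power2_le_imp_le) simp
qed

interpretation matmul: bounded_bilinear "(**) :: complex^'m^'m \<Rightarrow> complex^'m^'m \<Rightarrow> complex^'m^'m"
proof
  show "\<exists>K. \<forall>(A :: complex^'m^'m) B :: complex^'m^'m. norm (A ** B) \<le> norm A * norm B * K"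
    by (intro exI[of _ 1]) (simp add: norm_matrix_mult_le)
qed (simp_all add: matrix_matrix_mult_def vec_eq_iff scaleR_sum_right algebra_simps sum.distrib)

text \<open>Multiplication of a matrix by the complex number \<open>z\<close> is written \<open>mat z ** A\<close>; the next lemmas are
  the rules for calculating with it.\<close>

lemma mat_mult_nth: "(mat z ** A) $ i $ j = z * A $ i $ j"
  for A :: "complex^'n^'m"
  by (simp add: matrix_matrix_mult_def mat_def if_distrib[of "\<lambda>x. x * _"] cong: if_cong)

lemma mult_mat_nth: "(A ** mat z) $ i $ j = z * A $ i $ j"
  for A :: "complex^'n^'m"
  by (simp add: matrix_matrix_mult_def mat_def if_distrib[of "\<lambda>x. _ * x"] mult.commute cong: if_cong)

lemma mat_commute: "A ** mat z = mat z ** A" for A :: "complex^'m^'m"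
  by (simp add: vec_eq_iff mat_mult_nth mult_mat_nth)

lemma norm_mat_mult: "norm (mat z ** A) = cmod z * norm A"
  for A :: "complex^'n^'m"
proof -
  have "(norm (mat z ** A))\<^sup>2 = (cmod z * norm A)\<^sup>2"
    by (simp only: norm_matrix_sq mat_mult_nth norm_mult power_mult_distrib sum_distrib_left)
  then show ?thesis by (simp add: power2_eq_iff_nonneg)
qed

lemma mat_mult_mat: "mat a ** mat b = (mat (a * b) :: complex^'m^'m)"
  by (simp add: vec_eq_iff mat_mult_nth) (simp add: mat_def)

lemma mat_left_commute: "A ** (mat z ** B) = mat z ** (A ** B)" for A B :: "complex^'m^'m"
  by (metis mat_commute matrix_mul_assoc)

lemma mat_mult_assoc: "mat a ** (mat b ** A) = mat (a * b) ** A" for A :: "complex^'n^'m"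
  by (simp add: vec_eq_iff mat_mult_nth)

lemma mat_arith:
  shows "mat (a + b) = (mat a + mat b :: complex^'m^'m)" "mat (a - b) = (mat a - mat b :: complex^'m^'m)"
    and "mat (- a) = (- mat a :: complex^'m^'m)" "mat 0 = (0 :: complex^'m^'m)"
  by (simp_all add: vec_eq_iff mat_def)

lemma bounded_linear_mat: "bounded_linear (mat :: complex \<Rightarrow> complex^'m^'m)"
  unfolding linear_conv_bounded_linear[symmetric]
  by (rule linearI) (auto simp: vec_eq_iff mat_def)

section \<open>A Volterra integral equation\<close>

lemma absolutely_integrable_matmul:
  fixes P Y :: "real \<Rightarrow> complex^'m^'m"
  assumes "P absolutely_integrable_on {a..b}" and "continuous_on {a..b} Y"
  shows "(\<lambda>t. P t ** Y t) absolutely_integrable_on {a..b}"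
    and "(\<lambda>t. Y t ** P t) absolutely_integrable_on {a..b}"
proof -
  have meas: "Y \<in> borel_measurable (lebesgue_on {a..b})"
    using assms(2) by (intro continuous_imp_measurable_on_sets_lebesgue) auto
  have bou: "bounded (Y ` {a..b})"
    using assms(2) by (intro compact_imp_bounded compact_continuous_image) auto
  have bil: "bilinear (\<lambda>(A :: complex^'m^'m) B :: complex^'m^'m. B ** A)"
      "bilinear ((**) :: complex^'m^'m \<Rightarrow> complex^'m^'m \<Rightarrow> complex^'m^'m)"
    by (simp_all add: bilinear_conv_bounded_bilinear matmul.bounded_bilinear_axioms matmul.flip)
  show "(\<lambda>t. P t ** Y t) absolutely_integrable_on {a..b}"
    using absolutely_integrable_bounded_measurable_product[OF bil(1) meas _ bou assms(1)]
    by simp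
  show "(\<lambda>t. Y t ** P t) absolutely_integrable_on {a..b}"
    using absolutely_integrable_bounded_measurable_product[OF bil(2) meas _ bou assms(1)]
    by simp
qed

lemma integrable_matmul:
  fixes P Y :: "real \<Rightarrow> complex^'m^'m"
  assumes "P absolutely_integrable_on {0..b}" and "continuous_on {0..b} Y" and "s \<in> {0..b}"
  shows "(\<lambda>t. P t ** Y t) integrable_on {0..s}" "(\<lambda>t. Y t ** P t) integrable_on {0..s}"
  using absolutely_integrable_matmul[OF assms(1,2)] assms(3)
  by (auto simp: absolutely_integrable_on_def intro: integrable_on_subinterval)

lemma norm_integral_matmul_le:
  fixes P Y :: "real \<Rightarrow> complex^'m^'m"
  assumes P: "P absolutely_integrable_on {0..b}" and Y: "continuous_on {0..b} Y"
    and s: "s \<in> {0..b}" and N: "\<And>t. t \<in> {0..s} \<Longrightarrow> norm (Y t) \<le> N"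
  shows "norm (integral {0..s} (\<lambda>t. P t ** Y t)) \<le> integral {0..b} (\<lambda>t. norm (P t)) * N"
    and "norm (integral {0..s} (\<lambda>t. Y t ** P t)) \<le> integral {0..b} (\<lambda>t. norm (P t)) * N"
proof -
  have N0: "0 \<le> N"
    using N[of 0] s by (auto intro: order_trans[OF norm_ge_zero])
  have nP: "(\<lambda>t. norm (P t)) integrable_on {0..b}"
    using P by (simp add: absolutely_integrable_on_def)
  then have nPs: "(\<lambda>t. norm (P t)) integrable_on {0..s}"
    using s by (auto intro: integrable_on_subinterval)
  have le: "integral {0..s} (\<lambda>t. norm (P t) * N) \<le> integral {0..b} (\<lambda>t. norm (P t)) * N"
    using s N0 nPs nP by (auto intro!: mult_right_mono integral_subset_le)
  have "norm (integral {0..s} (\<lambda>t. P t ** Y t)) \<le> integral {0..s} (\<lambda>t. norm (P t) * N)"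
    using integrable_matmul[OF P Y s] nPs N N0
    by (intro integral_norm_bound_integral integrable_on_mult_left)
       (auto intro!: order_trans[OF norm_matrix_mult_le] mult_left_mono)
  with le show "norm (integral {0..s} (\<lambda>t. P t ** Y t)) \<le> integral {0..b} (\<lambda>t. norm (P t)) * N"
    by simp
  have "norm (integral {0..s} (\<lambda>t. Y t ** P t)) \<le> integral {0..s} (\<lambda>t. norm (P t) * N)"
    using integrable_matmul[OF P Y s] nPs N N0
    by (intro integral_norm_bound_integral integrable_on_mult_left)
       (auto intro!: order_trans[OF norm_matrix_mult_le] mult_right_mono simp: mult.commute[of _ N])
  with le show "norm (integral {0..s} (\<lambda>t. Y t ** P t)) \<le> integral {0..b} (\<lambda>t. norm (P t)) * N"
    by simp
qed

text \<open>The operator inverting the second derivative under zero initial conditions, applied to \<open>P Y\<close>. The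
  iterated integral is used instead of the kernel \<open>x - t\<close> because its first derivative is then immediate
  from the fundamental theorem of calculus.\<close>

definition volterra :: "(real \<Rightarrow> complex^'m^'m) \<Rightarrow> (real \<Rightarrow> complex^'m^'m) \<Rightarrow> real \<Rightarrow> complex^'m^'m" where
  "volterra P Y x = integral {0..x} (\<lambda>s. integral {0..s} (\<lambda>t. P t ** Y t))"

context
  fixes P :: "real \<Rightarrow> complex^'m^'m" and b :: real
  assumes P: "P absolutely_integrable_on {0..b}" and b: "0 \<le> b"
begin

lemma continuous_inner_integral:
  fixes Y :: "real \<Rightarrow> complex^'m^'m"
  assumes "continuous_on {0..b} Y"
  shows "continuous_on {0..b} (\<lambda>s. integral {0..s} (\<lambda>t. P t ** Y t))"
  using absolutely_integrable_matmul(1)[OF P assms]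
  by (intro indefinite_integral_continuous_1) (simp add: absolutely_integrable_on_def)

lemma volterra_has_vector_derivative:
  assumes "continuous_on {0..b} Y" "x \<in> {0..b}"
  shows "(volterra P Y has_vector_derivative integral {0..x} (\<lambda>t. P t ** Y t)) (at x within {0..b})"
  unfolding volterra_def[abs_def]
  by (rule integral_has_vector_derivative[OF continuous_inner_integral[OF assms(1)] assms(2)])

lemma continuous_volterra:
  assumes "continuous_on {0..b} Y"
  shows "continuous_on {0..b} (volterra P Y)"
  unfolding volterra_def[abs_def]
  by (intro indefinite_integral_continuous_1 integrable_continuous_real continuous_inner_integral assms)

lemma volterra_diff:
  assumes "continuous_on {0..b} Y" "continuous_on {0..b} Z" "x \<in> {0..b}"
  shows "volterra P (\<lambda>t. Y t - Z t) x = volterra P Y x - volterra P Z x"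
proof -
  have "volterra P (\<lambda>t. Y t - Z t) x
      = integral {0..x} (\<lambda>s. integral {0..s} (\<lambda>t. P t ** Y t) - integral {0..s} (\<lambda>t. P t ** Z t))"
    unfolding volterra_def
  proof (rule integral_cong)
    fix s assume "s \<in> {0..x}"
    then have "s \<in> {0..b}" using assms by auto
    then show "integral {0..s} (\<lambda>t. P t ** (Y t - Z t))
        = integral {0..s} (\<lambda>t. P t ** Y t) - integral {0..s} (\<lambda>t. P t ** Z t)"
      using assms by (simp add: matmul.diff_right integral_diff integrable_matmul[OF P])
  qed
  also have "\<dots> = volterra P Y x - volterra P Z x"
    unfolding volterra_def using assms
    by (intro integral_diff integrable_continuous_real)
       (auto intro!: continuous_on_subset[OF continuous_inner_integral])
  finally show ?thesis .
qed

text \<open>The gain \<open>1/K\<close> over the weight \<open>exp (K x)\<close> comes from the outer integration alone: the inner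
  integral costs only the \<open>L\<^sub>1\<close> norm of \<open>P\<close>.\<close>

lemma norm_volterra_le:
  assumes Y: "continuous_on {0..b} Y" and x: "x \<in> {0..b}" and K: "0 < K"
    and N: "\<And>t. t \<in> {0..b} \<Longrightarrow> norm (Y t) \<le> N * exp (K * t)"
  shows "norm (volterra P Y x) \<le> integral {0..b} (\<lambda>t. norm (P t)) * N / K * exp (K * x)"
proof -
  define L where "L = integral {0..b} (\<lambda>t. norm (P t))"
  have N0: "0 \<le> N" using N[of 0] b by (auto intro: order_trans[OF norm_ge_zero])
  have L0: "0 \<le> L" unfolding L_def by (rule integral_nonneg) (use P in \<open>auto simp: absolutely_integrable_on_def\<close>)
  have prim: "((\<lambda>s. L * N * exp (K * s)) has_integral
      L * N / K * exp (K * x) - L * N / K * exp (K * 0)) {0..x}"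
    using x K by (intro fundamental_theorem_of_calculus)
      (auto intro!: derivative_eq_intros simp: has_real_derivative_iff_has_vector_derivative[symmetric])
  have "norm (volterra P Y x) \<le> integral {0..x} (\<lambda>s. L * N * exp (K * s))"
    unfolding volterra_def
  proof (rule integral_norm_bound_integral)
    show "(\<lambda>s. integral {0..s} (\<lambda>t. P t ** Y t)) integrable_on {0..x}"
      using x by (intro integrable_continuous_real continuous_on_subset[OF continuous_inner_integral[OF Y]]) auto
    show "(\<lambda>s. L * N * exp (K * s)) integrable_on {0..x}" using prim by blast
    fix s assume s: "s \<in> {0..x}"
    have "norm (integral {0..s} (\<lambda>t. P t ** Y t)) \<le> L * (N * exp (K * s))"
      unfolding L_def
    proof (rule norm_integral_matmul_le(1)[OF P Y])
      fix t assume "t \<in> {0..s}"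
      then have "norm (Y t) \<le> N * exp (K * t)" "exp (K * t) \<le> exp (K * s)"
        using s x K N by auto
      then show "norm (Y t) \<le> N * exp (K * s)"
        using N0 by (meson mult_left_mono order_trans)
    qed (use s x in auto)
    then show "norm (integral {0..s} (\<lambda>t. P t ** Y t)) \<le> L * N * exp (K * s)" by (simp add: mult.assoc)
  qed
  also have "\<dots> = L * N / K * exp (K * x) - L * N / K"
    using integral_unique[OF prim] by simp
  also have "\<dots> \<le> L * N / K * exp (K * x)" using L0 N0 K by simp
  finally show ?thesis by (simp add: L_def)
qed

text \<open>With \<open>K = 2 L\<close> the operator halves the weighted supremum \<open>S\<close> of the solution, so that
  \<open>S \<le> N + S/2\<close>. Besides uniqueness this is the source of all estimates of solutions that must be
  locally uniform in the spectral parameter.\<close>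

lemma volterra_solution_bound:
  assumes Y: "continuous_on {0..b} Y" and eq: "\<And>x. x \<in> {0..b} \<Longrightarrow> Y x = F x + volterra P Y x"
    and F: "\<And>x. x \<in> {0..b} \<Longrightarrow> norm (F x) \<le> N" and x: "x \<in> {0..b}"
    and L: "integral {0..b} (\<lambda>t. norm (P t)) \<le> L" "0 < L"
  shows "norm (Y x) \<le> 2 * N * exp (2 * L * b)"
proof -
  have "\<exists>y\<in>{0..b}. \<forall>x\<in>{0..b}. norm (Y x) * exp (- (2 * L * x)) \<le> norm (Y y) * exp (- (2 * L * y))"
    using b Y by (intro continuous_attains_sup) (auto intro!: continuous_intros)
  then obtain y where y: "y \<in> {0..b}"
    and max: "\<And>x. x \<in> {0..b} \<Longrightarrow> norm (Y x) * exp (- (2 * L * x)) \<le> norm (Y y) * exp (- (2 * L * y))"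
    by blast
  define S where "S = norm (Y y) * exp (- (2 * L * y))"
  have S0: "0 \<le> S" by (simp add: S_def)
  have bd: "norm (Y t) \<le> S * exp (2 * L * t)" if "t \<in> {0..b}" for t
    using max[OF that] by (simp add: S_def exp_minus field_simps)
  have "norm (volterra P Y y) \<le> integral {0..b} (\<lambda>t. norm (P t)) * S / (2 * L) * exp (2 * L * y)"
    using L by (intro norm_volterra_le[OF Y y _ bd]) auto
  also have "\<dots> \<le> L * S / (2 * L) * exp (2 * L * y)"
    using L S0 by (intro mult_right_mono divide_right_mono) auto
  also have "\<dots> = S / 2 * exp (2 * L * y)" using L by simp
  finally have "norm (Y y) \<le> N + S / 2 * exp (2 * L * y)"
    using eq[OF y] F[OF y] norm_triangle_ineq[of "F y" "volterra P Y y"] by simp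
  then have "S \<le> (N + S / 2 * exp (2 * L * y)) * exp (- (2 * L * y))"
    unfolding S_def by (intro mult_right_mono) auto
  also have "\<dots> = N * exp (- (2 * L * y)) + S / 2" by (simp add: exp_minus field_simps)
  also have "\<dots> \<le> N * 1 + S / 2"
    using F[OF y] y L by (intro add_right_mono mult_left_mono) (auto intro: order_trans[OF norm_ge_zero])
  finally have S: "S \<le> 2 * N" by simp
  have "norm (Y x) \<le> S * exp (2 * L * x)" by (rule bd[OF x])
  also have "\<dots> \<le> 2 * N * exp (2 * L * b)"
    using S S0 x L by (intro mult_mono) auto
  finally show ?thesis .
qed

lemma volterra_solution_unique:
  assumes "continuous_on {0..b} Y" "continuous_on {0..b} Z"
    and "\<And>x. x \<in> {0..b} \<Longrightarrow> Y x = F x + volterra P Y x"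
    and "\<And>x. x \<in> {0..b} \<Longrightarrow> Z x = F x + volterra P Z x" and x: "x \<in> {0..b}"
  shows "Y x = Z x"
proof -
  have "norm (Y x - Z x) \<le> 2 * 0 * exp (2 * (\<bar>integral {0..b} (\<lambda>t. norm (P t))\<bar> + 1) * b)"
    using assms
    by (intro volterra_solution_bound[where F = "\<lambda>_. 0"]) (auto intro!: continuous_intros simp: volterra_diff)
  then show ?thesis by simp
qed

text \<open>Banach's fixed point theorem for the weighted unknown \<open>u(x) = exp (- K x) Y(x)\<close>. To work in the
  complete space of bounded continuous functions on the whole line, arguments are clamped to the
  interval by the function \<open>c\<close>.\<close>

lemma volterra_solution_exists:
  assumes F: "continuous_on {0..b} F"
  obtains Y where "continuous_on {0..b} Y" "\<And>x. x \<in> {0..b} \<Longrightarrow> Y x = F x + volterra P Y x"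
proof -
  define L where "L = integral {0..b} (\<lambda>t. norm (P t))"
  have L0: "0 \<le> L" unfolding L_def by (rule integral_nonneg) (use P in \<open>auto simp: absolutely_integrable_on_def\<close>)
  define K where "K = 2 * L + 1"
  have K: "0 < K" "L / K \<le> 1 / 2" using L0 by (auto simp: K_def field_simps)
  define c where "c x = max 0 (min x b)" for x
  have c: "c x \<in> {0..b}" for x using b by (auto simp: c_def)
  have c_id: "c x = x" if "x \<in> {0..b}" for x using that by (auto simp: c_def)
  define T where "T u x = exp (- (K * c x)) *\<^sub>R (F (c x) + volterra P (\<lambda>t. exp (K * t) *\<^sub>R u t) (c x))"
    for u :: "real \<Rightarrow> complex^'m^'m" and x
  have cont_w: "continuous_on {0..b} (\<lambda>t. exp (K * t) *\<^sub>R apply_bcontfun u t)"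
    for u :: "real \<Rightarrow>\<^sub>C (complex^'m^'m)"
    by (intro continuous_intros continuous_on_apply_bcontfun)
  have T_cont: "T (apply_bcontfun u) \<in> bcontfun" for u
  proof -
    define g where "g y = exp (- (K * y)) *\<^sub>R (F y + volterra P (\<lambda>t. exp (K * t) *\<^sub>R apply_bcontfun u t) y)" for y
    have g: "continuous_on {0..b} g"
      unfolding g_def by (intro continuous_intros F continuous_volterra cont_w)
    have "continuous_on UNIV (\<lambda>x. g (c x))"
      by (rule continuous_on_compose2[OF g]) (use c in \<open>auto simp: c_def intro!: continuous_intros\<close>)
    moreover have "bounded (range (\<lambda>x. g (c x)))"
      by (rule bounded_subset[OF compact_imp_bounded[OF compact_continuous_image[OF g]]]) (use c in auto)
    moreover have "T (apply_bcontfun u) = (\<lambda>x. g (c x))" by (simp add: T_def g_def fun_eq_iff)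
    ultimately show ?thesis by (simp add: bcontfun_def)
  qed
  define TT where "TT u = Bcontfun (T (apply_bcontfun u))" for u
  have TT: "apply_bcontfun (TT u) = T (apply_bcontfun u)" for u
    unfolding TT_def by (rule Bcontfun_inverse[OF T_cont])
  have "dist (TT u) (TT v) \<le> 1 / 2 * dist u v" for u v
  proof (rule dist_bound)
    fix x
    let ?d = "dist u v"
    have "norm (volterra P (\<lambda>t. exp (K * t) *\<^sub>R apply_bcontfun u t - exp (K * t) *\<^sub>R apply_bcontfun v t) (c x))
        \<le> L * ?d / K * exp (K * c x)"
      unfolding L_def
    proof (rule norm_volterra_le[OF _ c K(1)])
      show "norm (exp (K * t) *\<^sub>R apply_bcontfun u t - exp (K * t) *\<^sub>R apply_bcontfun v t) \<le> ?d * exp (K * t)" for t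
        using dist_bounded[of u t v] by (simp add: scaleR_diff_right[symmetric] dist_norm mult.commute)
    qed (intro continuous_on_diff cont_w)
    then have *: "norm (volterra P (\<lambda>t. exp (K * t) *\<^sub>R apply_bcontfun u t) (c x)
        - volterra P (\<lambda>t. exp (K * t) *\<^sub>R apply_bcontfun v t) (c x)) \<le> L * ?d / K * exp (K * c x)"
      by (simp add: volterra_diff[OF cont_w cont_w c])
    have "dist (apply_bcontfun (TT u) x) (apply_bcontfun (TT v) x) = exp (- (K * c x)) *
       norm (volterra P (\<lambda>t. exp (K * t) *\<^sub>R apply_bcontfun u t) (c x)
        - volterra P (\<lambda>t. exp (K * t) *\<^sub>R apply_bcontfun v t) (c x))"
      by (simp add: TT T_def dist_norm scaleR_diff_right[symmetric])
    also have "\<dots> \<le> exp (- (K * c x)) * (L * ?d / K * exp (K * c x))"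
      using * by (intro mult_left_mono) auto
    also have "\<dots> = L / K * ?d" by (simp add: exp_minus field_simps)
    also have "\<dots> \<le> 1 / 2 * ?d" using K by (intro mult_right_mono) auto
    finally show "dist (apply_bcontfun (TT u) x) (apply_bcontfun (TT v) x) \<le> 1 / 2 * ?d" .
  qed
  then have "\<exists>!u. TT u = u"
    by (intro banach_fix_type[where c = "1/2"]) auto
  then obtain u where u: "TT u = u" by blast
  show ?thesis
  proof (rule that)
    show "continuous_on {0..b} (\<lambda>t. exp (K * t) *\<^sub>R apply_bcontfun u t)" by (rule cont_w)
    fix x assume "x \<in> {0..b}"
    then show "exp (K * x) *\<^sub>R apply_bcontfun u x = F x + volterra P (\<lambda>t. exp (K * t) *\<^sub>R apply_bcontfun u t) x"
      using fun_cong[OF TT[of u], of x] by (simp add: u T_def c_id exp_minus)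
  qed
qed

end

section \<open>Initial value problems\<close>

lemma integral_bounded_linear:
  assumes "bounded_linear h" and "f integrable_on S"
  shows "integral S (\<lambda>t. h (f t)) = h (integral S f)"
  using integral_linear[OF assms(2,1)] by (simp add: o_def)

lemma integral_mat_mult:
  fixes f :: "real \<Rightarrow> complex^'m^'m"
  assumes "f integrable_on S"
  shows "integral S (\<lambda>t. mat c ** f t) = mat c ** integral S f"
  by (rule integral_bounded_linear[OF matmul.bounded_linear_right assms])

lemma integral_nth_nth:
  fixes f :: "real \<Rightarrow> complex^'m^'m"
  assumes "f integrable_on S"
  shows "integral S f $ j $ k = integral S (\<lambda>t. f t $ j $ k)"
  by (rule integral_bounded_linear[symmetric, OF bounded_linear_compose[OF bounded_linear_vec_nth bounded_linear_vec_nth] assms])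

text \<open>The interval has finite measure, and \<open>y \<le> 1 + y\<^sup>2\<close>.\<close>

lemma L2_potential_nth_absolutely_integrable:
  fixes Q :: "real \<Rightarrow> complex^'m^'m"
  assumes "L2_potential Q"
  shows "(\<lambda>x. Q x $ j $ k) absolutely_integrable_on {0..pi}"
proof -
  have "integrable (lebesgue_on {0..pi}) (\<lambda>x. Q x $ j $ k)"
  proof (rule Bochner_Integration.integrable_bound)
    show "integrable (lebesgue_on {0..pi}) (\<lambda>x. 1 + (cmod (Q x $ j $ k))\<^sup>2)"
      using assms by (auto simp: L2_potential_def finite_measure.integrable_const finite_measure_lebesgue_on)
    have "y \<le> 1 + y\<^sup>2" for y :: real
      using zero_le_power2[of "y - 1/2"] by (simp add: power2_eq_square algebra_simps)
    then show "AE x in lebesgue_on {0..pi}. norm (Q x $ j $ k) \<le> norm (1 + (cmod (Q x $ j $ k))\<^sup>2)"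
      by (auto intro: order_trans[OF _ abs_ge_self])
  qed (use assms in \<open>auto simp: L2_potential_def\<close>)
  then show ?thesis
    by (simp add: set_integrable_def integrable_restrict_space)
qed

lemma L2_potential_absolutely_integrable:
  fixes Q :: "real \<Rightarrow> complex^'m^'m"
  assumes "L2_potential Q"
  shows "Q absolutely_integrable_on {0..pi}"
proof -
  have eq: "Q = (\<lambda>x. \<Sum>j\<in>UNIV. \<Sum>k\<in>UNIV. axis j (axis k (Q x $ j $ k)))"
  proof -
    have "(\<Sum>k\<in>UNIV. axis j (axis k (Q x $ j $ k))) $ i $ l = (if j = i then Q x $ j $ l else 0)" for x i j l
      by (cases "j = i") (simp_all add: axis_def if_distrib[of "\<lambda>v. v $ _"] cong: if_cong)
    then show ?thesis by (simp add: vec_eq_iff fun_eq_iff)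
  qed
  have "linear (\<lambda>c. axis j (axis k c) :: complex^'m^'m)" for j k :: 'm
    by (rule linearI) (auto simp: vec_eq_iff axis_def)
  then have "bounded_linear (\<lambda>c. axis j (axis k c) :: complex^'m^'m)" for j k :: 'm
    by (simp add: linear_conv_bounded_linear)
  from absolutely_integrable_linear[OF L2_potential_nth_absolutely_integrable[OF assms] this]
  have "(\<lambda>x. axis j (axis k (Q x $ j $ k)) :: complex^'m^'m) absolutely_integrable_on {0..pi}" for j k
    by (simp add: o_def)
  then show ?thesis
    by (subst eq) (intro absolutely_integrable_sum finite)
qed

lemma shifted_absolutely_integrable:
  fixes Q :: "real \<Rightarrow> complex^'m^'m"
  assumes "Q absolutely_integrable_on {0..b}"
  shows "(\<lambda>t. Q t - mat z) absolutely_integrable_on {0..b}"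
  using assms by (intro set_integral_diff absolutely_integrable_on_const) auto

lemma volterra_mat_mult:
  fixes P Y :: "real \<Rightarrow> complex^'m^'m"
  assumes P: "P absolutely_integrable_on {0..b}" and Y: "continuous_on {0..b} Y" and x: "x \<in> {0..b}"
  shows "volterra P (\<lambda>t. mat c ** Y t) x = mat c ** volterra P Y x"
proof -
  have "volterra P (\<lambda>t. mat c ** Y t) x = integral {0..x} (\<lambda>s. mat c ** integral {0..s} (\<lambda>t. P t ** Y t))"
    unfolding volterra_def
  proof (rule integral_cong)
    fix s assume "s \<in> {0..x}"
    then have s: "s \<in> {0..b}" using x by auto
    show "integral {0..s} (\<lambda>t. P t ** (mat c ** Y t)) = mat c ** integral {0..s} (\<lambda>t. P t ** Y t)"
      by (simp only: integral_mat_mult[OF integrable_matmul(1)[OF P Y s], symmetric]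
            matrix_mul_assoc mat_commute)
  qed
  also have "\<dots> = mat c ** volterra P Y x"
    unfolding volterra_def using x
    by (intro integral_mat_mult integrable_continuous_real continuous_on_subset[OF continuous_inner_integral[OF P _ Y]]) auto
  finally show ?thesis .
qed

lemma volterra_shift:
  fixes P Y :: "real \<Rightarrow> complex^'m^'m"
  assumes P: "P absolutely_integrable_on {0..b}" and Y: "continuous_on {0..b} Y" and x: "x \<in> {0..b}"
  shows "volterra (\<lambda>t. P t - mat c) Y x = volterra P Y x - mat c ** volterra (\<lambda>_. mat 1) Y x"
proof -
  have b: "0 \<le> b" using x by auto
  have P1: "(\<lambda>_. mat 1 :: complex^'m^'m) absolutely_integrable_on {0..b}" by (rule absolutely_integrable_on_const) auto
  have "volterra (\<lambda>t. P t - mat c) Y x = integral {0..x} (\<lambda>s. integral {0..s} (\<lambda>t. P t ** Y t) - mat c ** integral {0..s} (\<lambda>t. mat 1 ** Y t))"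
    unfolding volterra_def
  proof (rule integral_cong)
    fix s assume "s \<in> {0..x}"
    then have s: "s \<in> {0..b}" using x by auto
    have "integral {0..s} (\<lambda>t. (P t - mat c) ** Y t) = integral {0..s} (\<lambda>t. P t ** Y t - mat c ** (mat 1 ** Y t))"
      by (simp add: matmul.diff_left)
    also have "\<dots> = integral {0..s} (\<lambda>t. P t ** Y t) - integral {0..s} (\<lambda>t. mat c ** (mat 1 ** Y t))"
      using integrable_matmul(1)[OF P Y s] integrable_linear[OF integrable_matmul(1)[OF P1 Y s] matmul.bounded_linear_right[of "mat c"]]
      by (intro integral_diff) (simp_all add: o_def)
    also have "\<dots> = integral {0..s} (\<lambda>t. P t ** Y t) - mat c ** integral {0..s} (\<lambda>t. mat 1 ** Y t)"
      by (simp only: integral_mat_mult[OF integrable_matmul(1)[OF P1 Y s]])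
    finally show "integral {0..s} (\<lambda>t. (P t - mat c) ** Y t) = integral {0..s} (\<lambda>t. P t ** Y t) - mat c ** integral {0..s} (\<lambda>t. mat 1 ** Y t)" .
  qed
  also have "\<dots> = volterra P Y x - integral {0..x} (\<lambda>s. mat c ** integral {0..s} (\<lambda>t. mat 1 ** Y t))"
    unfolding volterra_def using x
    by (intro integral_diff integrable_continuous_real matmul.continuous_on continuous_on_const
       continuous_on_subset[OF continuous_inner_integral[OF P b Y]]
       continuous_on_subset[OF continuous_inner_integral[OF P1 b Y]]) auto
  also have "integral {0..x} (\<lambda>s. mat c ** integral {0..s} (\<lambda>t. mat 1 ** Y t)) = mat c ** volterra (\<lambda>_. mat 1) Y x"
    unfolding volterra_def using x
    by (intro integral_mat_mult integrable_continuous_real continuous_on_subset[OF continuous_inner_integral[OF P1 b Y]]) auto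
  finally show ?thesis .
qed

definition ivp ::
  "(real \<Rightarrow> complex^'m^'m) \<Rightarrow> complex \<Rightarrow> complex^'m^'m \<Rightarrow> complex^'m^'m \<Rightarrow> (real \<Rightarrow> complex^'m^'m) \<Rightarrow> bool" where
  "ivp Q z A B Y \<longleftrightarrow> sl_solution Q z Y \<and> Y 0 = A \<and> deriv_Icc Y 0 = B"

lemma deriv_Icc_eq:
  assumes "(Y has_vector_derivative D) (at x within {0..pi})" "x \<in> {0..pi}"
  shows "deriv_Icc Y x = D"
  unfolding deriv_Icc_def using assms pi_gt_zero
  by (intro vector_derivative_within_closed_interval) auto

context
  fixes Q :: "real \<Rightarrow> complex^'m^'m"
  assumes L2: "L2_potential Q"
begin

lemmas potential_integrable = L2_potential_absolutely_integrable[OF L2]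
lemmas shifted_potential_integrable = shifted_absolutely_integrable[OF potential_integrable]

text \<open>Integrating the equation twice turns it into the Volterra equation for \<open>Q - z\<close> with free term
  \<open>A + x B\<close>. The equation holds only almost everywhere, which the integrals do not see.\<close>

lemma ivp_imp_volterra:
  assumes "ivp Q z A B Y"
  shows "continuous_on {0..pi} Y"
    and "\<And>x. x \<in> {0..pi} \<Longrightarrow> (Y has_vector_derivative deriv_Icc Y x) (at x within {0..pi})"
    and "\<And>x. x \<in> {0..pi} \<Longrightarrow> deriv_Icc Y x = B + integral {0..x} (\<lambda>t. (Q t - mat z) ** Y t)"
    and "\<And>x. x \<in> {0..pi} \<Longrightarrow> Y x = A + x *\<^sub>R B + volterra (\<lambda>t. Q t - mat z) Y x"
proof -
  from assms obtain Y2 where diff: "\<And>x. x \<in> {0..pi} \<Longrightarrow> Y differentiable (at x within {0..pi})"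
    and Y2: "Y2 absolutely_integrable_on {0..pi}"
    and dY': "\<And>x. x \<in> {0..pi} \<Longrightarrow> deriv_Icc Y x = deriv_Icc Y 0 + integral {0..x} Y2"
    and ae: "AE x in lebesgue_on {0..pi}. - Y2 x + Q x ** Y x = mat z ** Y x"
    unfolding ivp_def sl_solution_def by blast
  have Y0: "Y 0 = A" and B: "deriv_Icc Y 0 = B" using assms by (simp_all add: ivp_def)
  have dY: "deriv_Icc Y x = B + integral {0..x} Y2" if "x \<in> {0..pi}" for x
    using dY'[OF that] unfolding B .
  show cont: "continuous_on {0..pi} Y"
    by (rule differentiable_imp_continuous_on) (use diff in \<open>auto simp: differentiable_on_def\<close>)
  show vd: "(Y has_vector_derivative deriv_Icc Y x) (at x within {0..pi})" if "x \<in> {0..pi}" for x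
    using diff[OF that] by (simp add: deriv_Icc_def vector_derivative_works)
  from ae have "AE x in lebesgue. x \<in> {0..pi} \<longrightarrow> - Y2 x + Q x ** Y x = mat z ** Y x"
    by (simp add: AE_restrict_space_iff)
  then obtain N where N: "N \<in> null_sets lebesgue"
      "\<And>x. x \<in> {0..pi} - N \<Longrightarrow> - Y2 x + Q x ** Y x = mat z ** Y x"
    by (elim AE_E3) auto
  have int_Y2: "integral {0..x} Y2 = integral {0..x} (\<lambda>t. (Q t - mat z) ** Y t)" if "x \<in> {0..pi}" for x
  proof (rule integral_spike[of N])
    show "negligible N" using N by (simp add: negligible_iff_null_sets)
    fix t assume "t \<in> {0..x} - N"
    then show "(Q t - mat z) ** Y t = Y2 t" using N(2)[of t] that by (auto simp: matmul.diff_left algebra_simps)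
  qed
  show dY': "deriv_Icc Y x = B + integral {0..x} (\<lambda>t. (Q t - mat z) ** Y t)" if "x \<in> {0..pi}" for x
    using dY[OF that] int_Y2[OF that] by simp
  show "Y x = A + x *\<^sub>R B + volterra (\<lambda>t. Q t - mat z) Y x" if x: "x \<in> {0..pi}" for x
  proof -
    have "(deriv_Icc Y has_integral Y x - Y 0) {0..x}"
      using x by (intro fundamental_theorem_of_calculus has_vector_derivative_within_subset[OF vd]) auto
    then have "Y x - A = integral {0..x} (deriv_Icc Y)" by (simp add: Y0 integral_unique)
    also have "\<dots> = integral {0..x} (\<lambda>s. B + integral {0..s} (\<lambda>t. (Q t - mat z) ** Y t))"
      using x by (intro integral_cong dY') auto
    also have "\<dots> = x *\<^sub>R B + volterra (\<lambda>t. Q t - mat z) Y x"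
      unfolding volterra_def using x
      by (subst integral_add)
         (auto intro!: integrable_continuous_real continuous_on_subset[OF continuous_inner_integral[OF shifted_potential_integrable _ cont]])
    finally show ?thesis by (simp add: algebra_simps)
  qed
qed

lemma volterra_imp_ivp:
  assumes cont: "continuous_on {0..pi} Y"
    and eq: "\<And>x. x \<in> {0..pi} \<Longrightarrow> Y x = A + x *\<^sub>R B + volterra (\<lambda>t. Q t - mat z) Y x"
  shows "ivp Q z A B Y"
proof -
  have vd: "(Y has_vector_derivative B + integral {0..x} (\<lambda>t. (Q t - mat z) ** Y t)) (at x within {0..pi})"
    if "x \<in> {0..pi}" for x
  proof (rule has_vector_derivative_transform[OF that])
    show "((\<lambda>x. A + x *\<^sub>R B + volterra (\<lambda>t. Q t - mat z) Y x) has_vector_derivative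
        B + integral {0..x} (\<lambda>t. (Q t - mat z) ** Y t)) (at x within {0..pi})"
      by (auto intro!: derivative_eq_intros volterra_has_vector_derivative[OF shifted_potential_integrable _ cont that])
  qed (use eq in auto)
  have d: "deriv_Icc Y x = B + integral {0..x} (\<lambda>t. (Q t - mat z) ** Y t)" if "x \<in> {0..pi}" for x
    by (rule deriv_Icc_eq[OF vd[OF that] that])
  have d0: "deriv_Icc Y 0 = B" using d[of 0] by simp
  show ?thesis
    unfolding ivp_def sl_solution_def
  proof (intro conjI ballI exI[of _ "\<lambda>t. (Q t - mat z) ** Y t"])
    show "Y differentiable (at x within {0..pi})" if "x \<in> {0..pi}" for x
      using vd[OF that] by (rule differentiableI_vector)
    show "(\<lambda>t. (Q t - mat z) ** Y t) absolutely_integrable_on {0..pi}"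
      by (rule absolutely_integrable_matmul(1)[OF shifted_potential_integrable cont])
    show "Y 0 = A" using eq[of 0] by (simp add: volterra_def)
  qed (use d d0 in \<open>auto simp: matmul.diff_left\<close>)
qed

lemma ivp_exists: obtains Y where "ivp Q z A B Y"
proof -
  have "continuous_on {0..pi} (\<lambda>x. A + x *\<^sub>R B)" by (intro continuous_intros)
  from volterra_solution_exists[OF shifted_potential_integrable _ this] obtain Y where "continuous_on {0..pi} Y"
    "\<And>x. x \<in> {0..pi} \<Longrightarrow> Y x = A + x *\<^sub>R B + volterra (\<lambda>t. Q t - mat z) Y x"
    by auto
  from volterra_imp_ivp[OF this] show ?thesis by (rule that)
qed

lemma ivp_unique:
  assumes "ivp Q z A B Y" "ivp Q z A B Z" "x \<in> {0..pi}"
  shows "Y x = Z x" "deriv_Icc Y x = deriv_Icc Z x"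
proof -
  have eq: "Y x = Z x" if x: "x \<in> {0..pi}" for x
    by (rule volterra_solution_unique[OF shifted_potential_integrable, where F = "\<lambda>x. A + x *\<^sub>R B"])
       (use ivp_imp_volterra[OF assms(1)] ivp_imp_volterra[OF assms(2)] x in auto)
  have "integral {0..x} (\<lambda>t. (Q t - mat z) ** Y t) = integral {0..x} (\<lambda>t. (Q t - mat z) ** Z t)"
    using assms(3) by (intro integral_cong) (auto simp: eq)
  then show "deriv_Icc Y x = deriv_Icc Z x"
    using ivp_imp_volterra(3)[OF assms(1,3)] ivp_imp_volterra(3)[OF assms(2,3)] by simp
  show "Y x = Z x" by (rule eq[OF assms(3)])
qed

text \<open>The coefficients of the equation act from the left, so solutions may be multiplied by constant
  matrices from the right.\<close>

lemma ivp_add_matmul: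
  assumes Y: "ivp Q z A B Y" and Z: "ivp Q z A' B' Z"
  shows "ivp Q z (A ** C + A') (B ** C + B') (\<lambda>x. Y x ** C + Z x)"
    and "\<And>x. x \<in> {0..pi} \<Longrightarrow> deriv_Icc (\<lambda>x. Y x ** C + Z x) x = deriv_Icc Y x ** C + deriv_Icc Z x"
proof -
  have vd: "((\<lambda>x. Y x ** C + Z x) has_vector_derivative deriv_Icc Y x ** C + deriv_Icc Z x) (at x within {0..pi})"
    if "x \<in> {0..pi}" for x
    using bounded_linear.has_vector_derivative[OF matmul.bounded_linear_left ivp_imp_volterra(2)[OF Y that], of C]
      ivp_imp_volterra(2)[OF Z that]
    by (rule has_vector_derivative_add)
  show d: "deriv_Icc (\<lambda>x. Y x ** C + Z x) x = deriv_Icc Y x ** C + deriv_Icc Z x" if "x \<in> {0..pi}" for x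
    by (rule deriv_Icc_eq[OF vd[OF that] that])
  have contY: "continuous_on {0..pi} Y" and contZ: "continuous_on {0..pi} Z"
    using ivp_imp_volterra(1)[OF Y] ivp_imp_volterra(1)[OF Z] by auto
  have cont: "continuous_on {0..pi} (\<lambda>x. Y x ** C + Z x)"
    by (intro continuous_on_add matmul.continuous_on continuous_on_const contY contZ)
  let ?P = "\<lambda>t. Q t - mat z"
  show "ivp Q z (A ** C + A') (B ** C + B') (\<lambda>x. Y x ** C + Z x)"
    unfolding ivp_def sl_solution_def
  proof (intro conjI ballI exI[of _ "\<lambda>t. ?P t ** (Y t ** C + Z t)"])
    show "(\<lambda>t. ?P t ** (Y t ** C + Z t)) absolutely_integrable_on {0..pi}"
      by (rule absolutely_integrable_matmul(1)[OF shifted_potential_integrable cont])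
    show "(\<lambda>x. Y x ** C + Z x) differentiable (at x within {0..pi})" if "x \<in> {0..pi}" for x
      using vd[OF that] by (rule differentiableI_vector)
    show "deriv_Icc (\<lambda>x. Y x ** C + Z x) x
        = deriv_Icc (\<lambda>x. Y x ** C + Z x) 0 + integral {0..x} (\<lambda>t. ?P t ** (Y t ** C + Z t))"
      if x: "x \<in> {0..pi}" for x
    proof -
      have iY: "(\<lambda>t. ?P t ** Y t) integrable_on {0..x}" and iZ: "(\<lambda>t. ?P t ** Z t) integrable_on {0..x}"
        by (rule integrable_matmul(1)[OF shifted_potential_integrable contY x], rule integrable_matmul(1)[OF shifted_potential_integrable contZ x])
      have "integral {0..x} (\<lambda>t. ?P t ** (Y t ** C + Z t)) = integral {0..x} (\<lambda>t. (?P t ** Y t) ** C + ?P t ** Z t)"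
        by (simp add: matmul.add_right matrix_mul_assoc)
      also have "\<dots> = integral {0..x} (\<lambda>t. (?P t ** Y t) ** C) + integral {0..x} (\<lambda>t. ?P t ** Z t)"
        using integrable_linear[OF iY matmul.bounded_linear_left[of C]] iZ by (intro integral_add) (simp_all add: o_def)
      also have "integral {0..x} (\<lambda>t. (?P t ** Y t) ** C) = integral {0..x} (\<lambda>t. ?P t ** Y t) ** C"
        by (rule integral_bounded_linear[OF matmul.bounded_linear_left iY])
      finally show ?thesis
        using x ivp_imp_volterra(3)[OF Y x] ivp_imp_volterra(3)[OF Z x] Y Z
        by (simp add: d matmul.add_left ivp_def)
    qed
    show "deriv_Icc (\<lambda>x. Y x ** C + Z x) 0 = B ** C + B'" using d[of 0] Y Z by (simp add: ivp_def)
  qed (use Y Z in \<open>auto simp: ivp_def matmul.diff_left\<close>)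
qed

end

section \<open>Analytic dependence on the spectral parameter\<close>

lemma holomorphic_on_if_DERIV:
  assumes "\<And>z. \<exists>d. (f has_field_derivative d) (at z)"
  shows "f holomorphic_on S"
  unfolding holomorphic_on_def field_differentiable_def
proof
  fix z
  from assms[of z] obtain d where "(f has_field_derivative d) (at z)" by blast
  then have "(f has_field_derivative d) (at z within S)" by (rule has_field_derivative_at_within)
  then show "\<exists>d. (f has_field_derivative d) (at z within S)" by blast
qed

lemma has_field_derivative_quadratic:
  assumes "\<And>w. cmod (w - z) \<le> 1 \<Longrightarrow> cmod (f w - f z - (w - z) * d) \<le> C * (cmod (w - z))\<^sup>2"
  shows "(f has_field_derivative d) (at z)"
proof -
  have "((\<lambda>w. (f w - f z) / (w - z) - d) \<longlongrightarrow> 0) (at z)"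
  proof (rule Lim_null_comparison)
    have "eventually (\<lambda>w. w \<noteq> z) (at z)" by (simp add: eventually_at_filter)
    moreover have "eventually (\<lambda>w. w \<in> ball z 1) (at z)"
      by (rule eventually_at_in_open') auto
    ultimately show "eventually (\<lambda>w. norm ((f w - f z) / (w - z) - d) \<le> C * cmod (w - z)) (at z)"
    proof eventually_elim
      case (elim w)
      have "((f w - f z) / (w - z) - d) * (w - z) = f w - f z - (w - z) * d"
        using elim by (simp add: field_simps)
      then have "cmod ((f w - f z) / (w - z) - d) * cmod (w - z) = cmod (f w - f z - (w - z) * d)"
        by (metis norm_mult)
      also have "\<dots> \<le> C * cmod (w - z) * cmod (w - z)"
        using assms[of w] elim by (simp add: dist_norm norm_minus_commute power2_eq_square mult.assoc)
      finally show ?case using elim by simp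
    qed
    show "((\<lambda>w. C * cmod (w - z)) \<longlongrightarrow> 0) (at z)"
      by (auto intro!: tendsto_eq_intros)
  qed
  then show ?thesis
    by (simp add: has_field_derivative_iff LIM_zero_iff)
qed

lemma integral_norm_shift_le:
  fixes P :: "real \<Rightarrow> complex^'m^'m"
  assumes P: "P absolutely_integrable_on {0..b}" and b: "0 \<le> b" and z: "cmod z \<le> r"
  shows "integral {0..b} (\<lambda>t. norm (P t - mat z))
      \<le> integral {0..b} (\<lambda>t. norm (P t)) + b * (r * norm (mat 1 :: complex^'m^'m))"
proof -
  have mz: "norm (mat z :: complex^'m^'m) \<le> r * norm (mat 1 :: complex^'m^'m)"
    using norm_mat_mult[of z "mat 1 :: complex^'m^'m"] z by (simp add: mult_right_mono)
  have 1: "(\<lambda>t. norm (P t)) integrable_on {0..b}" "(\<lambda>t. norm (P t - mat z)) integrable_on {0..b}"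
    using P shifted_absolutely_integrable[OF P, of z] by (auto simp: absolutely_integrable_on_def)
  have "integral {0..b} (\<lambda>t. norm (P t - mat z))
      \<le> integral {0..b} (\<lambda>t. norm (P t) + r * norm (mat 1 :: complex^'m^'m))"
  proof (rule integral_le)
    show "norm (P t - mat z) \<le> norm (P t) + r * norm (mat 1 :: complex^'m^'m)" for t
      using norm_triangle_ineq4[of "P t" "mat z"] mz by simp
  qed (use 1 in \<open>auto intro!: integrable_add\<close>)
  also have "\<dots> = integral {0..b} (\<lambda>t. norm (P t)) + b * (r * norm (mat 1 :: complex^'m^'m))"
    using 1 b by (subst integral_add) auto
  finally show ?thesis .
qed

lemma double_integral_bound:
  fixes Y :: "real \<Rightarrow> complex^'m^'m"
  assumes "continuous_on {0..b} Y" "\<And>t. t \<in> {0..b} \<Longrightarrow> norm (Y t) \<le> N" "x \<in> {0..b}"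
  shows "norm (volterra (\<lambda>_. mat 1) Y x) \<le> b * norm (mat 1 :: complex^'m^'m) * exp b * N"
proof -
  have b: "0 \<le> b" and N: "0 \<le> N" using assms(3) assms(2)[of x] by (auto intro: order_trans[OF norm_ge_zero])
  have "norm (volterra (\<lambda>_. mat 1) Y x) \<le> integral {0..b} (\<lambda>t. norm (mat 1 :: complex^'m^'m)) * N / 1 * exp (1 * x)"
  proof (rule norm_volterra_le[OF _ b assms(1,3)])
    show "norm (Y t) \<le> N * exp (1 * t)" if "t \<in> {0..b}" for t
      using assms(2)[OF that] that N mult_left_mono[of 1 "exp t" N] by auto
  qed (auto intro: absolutely_integrable_on_const)
  also have "\<dots> \<le> b * norm (mat 1 :: complex^'m^'m) * N * exp b"
    using assms(3) N b by (auto intro!: mult_mono)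
  finally show ?thesis by (simp add: mult_ac)
qed

context
  fixes Q :: "real \<Rightarrow> complex^'m^'m"
  assumes L2: "L2_potential Q"
begin

text \<open>The candidate \<open>W\<close> for the derivative in the spectral parameter solves the differentiated problem
  \<open>- W'' + Q W = z W + Y\<^sub>z\<close> with zero data. The difference \<open>D = Y\<^sub>w - Y\<^sub>z\<close> and the remainder
  \<open>R = D - (w - z) W\<close> satisfy Volterra equations with the same coefficient \<open>Q - z\<close> and with free terms of
  size \<open>\<bar>w - z\<bar>\<close> and \<open>\<bar>w - z\<bar> \<bar>D\<bar>\<close>, so the a priori bound applies to both.\<close>

lemma ivp_expansion:
  assumes Y: "\<And>w. ivp Q w A B (Y w)"
  shows "\<exists>W C. continuous_on {0..pi} W \<and> (\<forall>w x. cmod (w - z) \<le> 1 \<longrightarrow> x \<in> {0..pi} \<longrightarrow>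
           norm (Y w x - Y z x) \<le> C * cmod (w - z) \<and>
           norm (Y w x - Y z x - mat (w - z) ** W x) \<le> C * (cmod (w - z))\<^sup>2)"
proof -
  note Q = potential_integrable[OF L2] and P = shifted_potential_integrable[OF L2]
  define I where "I = (mat 1 :: complex^'m^'m)"
  have pi0: "(0::real) \<le> pi" by simp
  have one: "(\<lambda>_. I) absolutely_integrable_on {0..pi}" by (rule absolutely_integrable_on_const) auto
  define L where "L = \<bar>integral {0..pi} (\<lambda>t. norm (Q t))\<bar> + pi * ((cmod z + 1) * norm I) + 1"
  have L0: "0 < L" by (auto simp: L_def intro!: add_nonneg_pos)
  have L: "integral {0..pi} (\<lambda>t. norm (Q t - mat w)) \<le> L" if "cmod (w - z) \<le> 1" for w
  proof -
    have "cmod w \<le> cmod z + 1" using that norm_triangle_ineq2[of w z] by simp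
    from integral_norm_shift_le[OF Q pi0 this] show ?thesis by (simp add: L_def I_def)
  qed
  define E where "E = 2 * exp (2 * L * pi)"
  have E0: "0 \<le> E" by (simp add: E_def)
  note cont = ivp_imp_volterra(1)[OF L2 Y] and veq = ivp_imp_volterra(4)[OF L2 Y]
  have Yb: "norm (Y w x) \<le> E * (norm A + pi * norm B)" if "cmod (w - z) \<le> 1" "x \<in> {0..pi}" for w x
  proof -
    have "norm (Y w x) \<le> 2 * (norm A + pi * norm B) * exp (2 * L * pi)"
    proof (rule volterra_solution_bound[OF P _ cont veq])
      show "norm (A + t *\<^sub>R B) \<le> norm A + pi * norm B" if "t \<in> {0..pi}" for t
        using that by (intro norm_triangle_le add_mono) (auto intro!: mult_right_mono)
    qed (use that L L0 in auto)
    then show ?thesis by (simp add: E_def algebra_simps)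
  qed
  define J where "J u x = volterra (\<lambda>_. I) u x" for u :: "real \<Rightarrow> complex^'m^'m" and x
  define c where "c = pi * norm I * exp pi"
  have c0: "0 \<le> c" by (simp add: c_def)
  have J: "norm (J u x) \<le> c * N"
    if "continuous_on {0..pi} u" "\<And>t. t \<in> {0..pi} \<Longrightarrow> norm (u t) \<le> N" "x \<in> {0..pi}" for u N x
    using double_integral_bound[OF that] by (simp add: J_def c_def I_def)
  have contJ: "continuous_on {0..pi} (J u)" if "continuous_on {0..pi} u" for u
    using continuous_volterra[OF one _ that] by (simp add: J_def[abs_def])
  define D where "D w x = Y w x - Y z x" for w x
  have contD: "continuous_on {0..pi} (D w)" for w
    unfolding D_def by (intro continuous_intros cont)
  have Deq: "D w x = - (mat (w - z) ** J (Y w) x) + volterra (\<lambda>t. Q t - mat z) (D w) x"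
    if x: "x \<in> {0..pi}" for w x
  proof -
    have "mat (w - z) = mat w - (mat z :: complex^'m^'m)" by (simp add: vec_eq_iff mat_def)
    then have "(\<lambda>t. Q t - mat w) = (\<lambda>t. (Q t - mat z) - mat (w - z))" by simp
    then have "volterra (\<lambda>t. Q t - mat w) (Y w) x
        = volterra (\<lambda>t. Q t - mat z) (Y w) x - mat (w - z) ** J (Y w) x"
      using volterra_shift[OF P cont x, of z "w - z" w] by (simp add: J_def I_def)
    moreover have "volterra (\<lambda>t. Q t - mat z) (D w) x
        = volterra (\<lambda>t. Q t - mat z) (Y w) x - volterra (\<lambda>t. Q t - mat z) (Y z) x"
      unfolding D_def by (rule volterra_diff[OF P pi0 cont cont x])
    ultimately show ?thesis
      using veq[OF x, of w] veq[OF x, of z] by (simp add: D_def)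
  qed
  define C1 where "C1 = E * (c * (E * (norm A + pi * norm B)))"
  have Db: "norm (D w x) \<le> C1 * cmod (w - z)" if w: "cmod (w - z) \<le> 1" and x: "x \<in> {0..pi}" for w x
  proof -
    have "norm (D w x) \<le> 2 * (cmod (w - z) * (c * (E * (norm A + pi * norm B)))) * exp (2 * L * pi)"
    proof (rule volterra_solution_bound[OF P _ contD Deq])
      show "norm (- (mat (w - z) ** J (Y w) t)) \<le> cmod (w - z) * (c * (E * (norm A + pi * norm B)))"
        if "t \<in> {0..pi}" for t
        using J[OF cont Yb[OF w] that] by (simp add: norm_mat_mult mult_left_mono)
    qed (use x L[of z] L0 in auto)
    then show ?thesis by (simp add: C1_def E_def mult_ac)
  qed
  obtain W where W: "continuous_on {0..pi} W"
      "\<And>x. x \<in> {0..pi} \<Longrightarrow> W x = - J (Y z) x + volterra (\<lambda>t. Q t - mat z) W x"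
    by (rule volterra_solution_exists[OF P pi0, where F = "\<lambda>x. - J (Y z) x" and z1 = z])
       (auto intro!: continuous_intros contJ cont)
  define R where "R w x = D w x - mat (w - z) ** W x" for w x
  have contR: "continuous_on {0..pi} (R w)" for w
    unfolding R_def by (intro continuous_on_diff contD matmul.continuous_on continuous_on_const W)
  have Req: "R w x = - (mat (w - z) ** J (D w) x) + volterra (\<lambda>t. Q t - mat z) (R w) x"
    if x: "x \<in> {0..pi}" for w x
  proof -
    have "volterra (\<lambda>t. Q t - mat z) (R w) x
        = volterra (\<lambda>t. Q t - mat z) (D w) x - mat (w - z) ** volterra (\<lambda>t. Q t - mat z) W x"
      unfolding R_def
      by (subst volterra_diff[OF P pi0 contD _ x])
         (auto intro!: matmul.continuous_on continuous_on_const W simp: volterra_mat_mult[OF P W(1) x])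
    moreover have "J (D w) x = J (Y w) x - J (Y z) x"
      unfolding D_def J_def by (rule volterra_diff[OF one pi0 cont cont x])
    ultimately show ?thesis
      using Deq[OF x, of w] arg_cong[OF W(2)[OF x], of "\<lambda>M. mat (w - z) ** M"]
      by (simp add: R_def matmul.diff_right matmul.add_right matmul.minus_right)
  qed
  have Rb: "norm (R w x) \<le> E * c * C1 * (cmod (w - z))\<^sup>2" if w: "cmod (w - z) \<le> 1" and x: "x \<in> {0..pi}" for w x
  proof -
    have "norm (R w x) \<le> 2 * (cmod (w - z) * (c * (C1 * cmod (w - z)))) * exp (2 * L * pi)"
    proof (rule volterra_solution_bound[OF P _ contR Req])
      show "norm (- (mat (w - z) ** J (D w) t)) \<le> cmod (w - z) * (c * (C1 * cmod (w - z)))"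
        if "t \<in> {0..pi}" for t
        using J[OF contD Db[OF w] that] by (simp add: norm_mat_mult mult_left_mono)
    qed (use x L[of z] L0 in auto)
    then show ?thesis by (simp add: E_def mult_ac power2_eq_square)
  qed
  show ?thesis
  proof (intro exI[of _ W] exI[of _ "max C1 (E * c * C1)"] conjI allI impI)
    fix w x assume w: "cmod (w - z) \<le> 1" and x: "x \<in> {0..pi}"
    show "norm (Y w x - Y z x) \<le> max C1 (E * c * C1) * cmod (w - z)"
      by (auto intro!: order_trans[OF Db[OF w x, unfolded D_def]] mult_right_mono)
    show "norm (Y w x - Y z x - mat (w - z) ** W x) \<le> max C1 (E * c * C1) * (cmod (w - z))\<^sup>2"
      by (auto intro!: order_trans[OF Rb[OF w x, unfolded D_def R_def]] mult_right_mono)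
  qed (rule W)
qed


text \<open>For the values of \<open>Y\<close> this is the quadratic expansion of the previous lemma; for \<open>Y'(\<pi>)\<close> the
  expansion is inserted into \<open>Y'(\<pi>) = B + \<integral> (Q - z) Y\<close>.\<close>

lemma ivp_holomorphic:
  assumes Y: "\<And>w. ivp Q w A B (Y w)"
  shows "x \<in> {0..pi} \<Longrightarrow> (\<lambda>w. Y w x $ j $ k) holomorphic_on S"
    and "(\<lambda>w. deriv_Icc (Y w) pi $ j $ k) holomorphic_on S"
proof -
  note Q = potential_integrable[OF L2] and P = shifted_potential_integrable[OF L2] and cont = ivp_imp_volterra(1)[OF L2 Y]
  define I where "I = (mat 1 :: complex^'m^'m)"
  have one: "(\<lambda>_. I) absolutely_integrable_on {0..pi}" by (rule absolutely_integrable_on_const) auto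
  have pi: "pi \<in> {0..pi}" by simp
  have nth_le: "cmod (M $ j $ k) \<le> norm M" for M :: "complex^'m^'m"
    by (rule order_trans[OF Finite_Cartesian_Product.norm_nth_le Finite_Cartesian_Product.norm_nth_le])
  have *: "\<exists>d. ((\<lambda>w. Y w x $ j $ k) has_field_derivative d) (at z)" if x: "x \<in> {0..pi}" for z x
  proof -
    obtain W C where est: "\<And>w x. cmod (w - z) \<le> 1 \<Longrightarrow> x \<in> {0..pi} \<Longrightarrow>
           norm (Y w x - Y z x - mat (w - z) ** W x) \<le> C * (cmod (w - z))\<^sup>2"
      using ivp_expansion[OF Y, of z] by blast
    have "((\<lambda>w. Y w x $ j $ k) has_field_derivative (W x $ j $ k)) (at z)"
    proof (rule has_field_derivative_quadratic)
      fix w assume "cmod (w - z) \<le> 1"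
      from order_trans[OF nth_le est[OF this x]]
      show "cmod (Y w x $ j $ k - Y z x $ j $ k - (w - z) * W x $ j $ k) \<le> C * (cmod (w - z))\<^sup>2"
        by (simp add: mat_mult_nth)
    qed
    then show ?thesis by blast
  qed
  show "(\<lambda>w. Y w x $ j $ k) holomorphic_on S" if "x \<in> {0..pi}"
    by (rule holomorphic_on_if_DERIV) (rule *[OF that])
  have "\<exists>d. ((\<lambda>w. deriv_Icc (Y w) pi $ j $ k) has_field_derivative d) (at z)" for z
  proof -
    let ?P = "\<lambda>t. Q t - mat z"
    obtain W C where W: "continuous_on {0..pi} W"
      and Db: "\<And>w x. cmod (w - z) \<le> 1 \<Longrightarrow> x \<in> {0..pi} \<Longrightarrow> norm (Y w x - Y z x) \<le> C * cmod (w - z)"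
      and Rb: "\<And>w x. cmod (w - z) \<le> 1 \<Longrightarrow> x \<in> {0..pi} \<Longrightarrow>
           norm (Y w x - Y z x - mat (w - z) ** W x) \<le> C * (cmod (w - z))\<^sup>2"
      using ivp_expansion[OF Y, of z] by blast
    define R where "R w x = Y w x - Y z x - mat (w - z) ** W x" for w x
    have contR: "continuous_on {0..pi} (R w)" for w
      unfolding R_def by (intro continuous_on_diff cont matmul.continuous_on continuous_on_const W)
    have contD: "continuous_on {0..pi} (\<lambda>t. Y w t - Y z t)" for w
      by (intro continuous_on_diff cont)
    define d where "d = integral {0..pi} (\<lambda>t. ?P t ** W t) - integral {0..pi} (\<lambda>t. I ** Y z t)"
    define L where "L = integral {0..pi} (\<lambda>t. norm (?P t))"
    define K where "K = L * C + pi * norm I * C"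
    have expand: "deriv_Icc (Y w) pi - deriv_Icc (Y z) pi - mat (w - z) ** d
        = integral {0..pi} (\<lambda>t. ?P t ** R w t) - mat (w - z) ** integral {0..pi} (\<lambda>t. I ** (Y w t - Y z t))" for w
    proof -
      have m: "mat w = mat z + (mat (w - z) :: complex^'m^'m)" by (simp add: vec_eq_iff mat_def)
      have i: "(\<lambda>t. ?P t ** Y w t) integrable_on {0..pi}" "(\<lambda>t. ?P t ** W t) integrable_on {0..pi}"
          "(\<lambda>t. I ** Y w t) integrable_on {0..pi}" for w
        by (rule integrable_matmul(1)[OF P cont pi] integrable_matmul(1)[OF P W pi] integrable_matmul(1)[OF one cont pi])+
      have i': "(\<lambda>t. mat c ** f t) integrable_on {0..pi}" if "f integrable_on {0..pi}" for c and f :: "real \<Rightarrow> complex^'m^'m"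
        using integrable_linear[OF that matmul.bounded_linear_right[of "mat c"]] by (simp add: o_def)
      have "integral {0..pi} (\<lambda>t. (Q t - mat w) ** Y w t)
          = integral {0..pi} (\<lambda>t. ?P t ** Y w t - mat (w - z) ** (I ** Y w t))"
        by (simp add: m I_def matmul.diff_left matmul.add_left diff_diff_eq)
      also have "\<dots> = integral {0..pi} (\<lambda>t. ?P t ** Y w t) - mat (w - z) ** integral {0..pi} (\<lambda>t. I ** Y w t)"
        using i i' by (simp add: integral_diff integral_mat_mult)
      finally have 1: "integral {0..pi} (\<lambda>t. (Q t - mat w) ** Y w t) = \<dots>" .
      have "integral {0..pi} (\<lambda>t. ?P t ** R w t)
          = integral {0..pi} (\<lambda>t. ?P t ** Y w t - ?P t ** Y z t - mat (w - z) ** (?P t ** W t))"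
        by (simp add: R_def matmul.diff_right mat_left_commute)
      also have "\<dots> = integral {0..pi} (\<lambda>t. ?P t ** Y w t) - integral {0..pi} (\<lambda>t. ?P t ** Y z t)
           - mat (w - z) ** integral {0..pi} (\<lambda>t. ?P t ** W t)"
        using i i' by (simp add: integral_diff integrable_diff integral_mat_mult)
      finally have 2: "integral {0..pi} (\<lambda>t. ?P t ** R w t) = \<dots>" .
      have 3: "integral {0..pi} (\<lambda>t. I ** (Y w t - Y z t))
          = integral {0..pi} (\<lambda>t. I ** Y w t) - integral {0..pi} (\<lambda>t. I ** Y z t)"
        using i by (simp add: integral_diff matmul.diff_right)
      show ?thesis
        unfolding ivp_imp_volterra(3)[OF L2 Y pi] 1 2 3 d_def by (simp add: matmul.diff_right)
    qed
    have est: "norm (deriv_Icc (Y w) pi - deriv_Icc (Y z) pi - mat (w - z) ** d) \<le> K * (cmod (w - z))\<^sup>2"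
      if w: "cmod (w - z) \<le> 1" for w
    proof -
      have "norm (integral {0..pi} (\<lambda>t. ?P t ** R w t)) \<le> L * (C * (cmod (w - z))\<^sup>2)"
        unfolding L_def by (rule norm_integral_matmul_le(1)[OF P contR pi]) (use Rb w in \<open>auto simp: R_def\<close>)
      moreover have "norm (integral {0..pi} (\<lambda>t. I ** (Y w t - Y z t)))
          \<le> integral {0..pi} (\<lambda>t. norm I) * (C * cmod (w - z))"
        by (rule norm_integral_matmul_le(1)[OF one contD pi]) (use Db w in auto)
      then have "norm (mat (w - z) ** integral {0..pi} (\<lambda>t. I ** (Y w t - Y z t)))
          \<le> cmod (w - z) * (pi * norm I * (C * cmod (w - z)))"
        unfolding norm_mat_mult by (intro mult_left_mono) auto
      ultimately show ?thesis
        unfolding expand K_def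
        by (intro order_trans[OF norm_triangle_ineq4]) (simp add: algebra_simps power2_eq_square)
    qed
    have "((\<lambda>w. deriv_Icc (Y w) pi $ j $ k) has_field_derivative (d $ j $ k)) (at z)"
    proof (rule has_field_derivative_quadratic)
      fix w assume "cmod (w - z) \<le> 1"
      from order_trans[OF nth_le est[OF this]]
      show "cmod (deriv_Icc (Y w) pi $ j $ k - deriv_Icc (Y z) pi $ j $ k - (w - z) * d $ j $ k) \<le> K * (cmod (w - z))\<^sup>2"
        by (simp add: mat_mult_nth)
    qed
    then show ?thesis by blast
  qed
  then show "(\<lambda>w. deriv_Icc (Y w) pi $ j $ k) holomorphic_on S"
    by (rule holomorphic_on_if_DERIV)
qed

lemma V_form_holomorphic:
  assumes Y: "\<And>w. ivp Q w A B (Y w)"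
  shows "(\<lambda>w. V_form H (Y w) $ j $ k) holomorphic_on S"
  unfolding V_form_def matrix_matrix_mult_def
  by (auto intro!: holomorphic_intros ivp_holomorphic[OF Y])

end

section \<open>Variation of constants\<close>

text \<open>Integration by parts with one factor that is only absolutely continuous: \<open>G\<close> need not be the
  derivative of \<open>g\<close> at any given point. The difference \<open>\<Psi>\<close> of the two sides has an increment over
  \<open>[y, z]\<close> of size at most a constant times \<open>(z - y) (m z - m y)\<close>, where \<open>m\<close> is the continuous indefinite
  integral of the norm of \<open>G\<close>. Hence \<open>\<Psi>\<close> has derivative zero everywhere and is constant.\<close>

lemma integral_by_parts:
  fixes G :: "real \<Rightarrow> complex^'m^'m" and s s' :: "real \<Rightarrow> complex"
  assumes G: "G absolutely_integrable_on {0..b}" and x: "x \<in> {0..b}"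
    and s: "\<And>t. t \<in> {0..b} \<Longrightarrow> (s has_vector_derivative s' t) (at t within {0..b})"
    and s': "continuous_on {0..b} s'"
    and g: "\<And>t. t \<in> {0..b} \<Longrightarrow> g t = B + integral {0..t} G"
  shows "integral {0..x} (\<lambda>t. mat (s t) ** G t)
       = mat (s x) ** g x - mat (s 0) ** B - integral {0..x} (\<lambda>t. mat (s' t) ** g t)"
proof -
  let ?m = "mat :: complex \<Rightarrow> complex^'m^'m"
  have b: "0 \<le> b" using x by auto
  have Gi: "G integrable_on {0..b}" and nGi: "(\<lambda>t. norm (G t)) integrable_on {0..b}"
    using G by (auto simp: absolutely_integrable_on_def)
  have cs: "continuous_on {0..b} s"
    by (rule differentiable_imp_continuous_on) (use s in \<open>auto simp: differentiable_on_def intro!: differentiableI_vector[OF s]\<close>)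
  have cms: "continuous_on {0..b} (\<lambda>t. ?m (s t))" "continuous_on {0..b} (\<lambda>t. ?m (s' t))"
    using cs s' by (auto intro: bounded_linear.continuous_on[OF bounded_linear_mat])
  have cg: "continuous_on {0..b} g"
    by (rule continuous_on_eq[where f = "\<lambda>t. B + integral {0..t} G"])
       (auto intro!: continuous_intros indefinite_integral_continuous_1 Gi simp: g)
  have ag: "g absolutely_integrable_on {0..b}" by (rule absolutely_integrable_continuous_real[OF cg])
  have cs'g: "continuous_on {0..b} (\<lambda>t. ?m (s' t) ** g t)" by (rule matmul.continuous_on[OF cms(2) cg])
  have isG: "(\<lambda>t. ?m (s t) ** G t) integrable_on {0..b}"
    using integrable_matmul(2)[OF G cms(1)] b by auto
  obtain S where S: "\<And>t. t \<in> {0..b} \<Longrightarrow> norm (?m (s' t)) \<le> S" and S0: "0 \<le> S"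
  proof -
    have "bounded ((\<lambda>t. ?m (s' t)) ` {0..b})"
      by (intro compact_imp_bounded compact_continuous_image cms) auto
    then obtain S where "\<And>t. t \<in> {0..b} \<Longrightarrow> norm (?m (s' t)) \<le> S" unfolding bounded_iff by blast
    then show thesis using that[of "max S 0"] by fastforce
  qed
  define m where "m y = integral {0..y} (\<lambda>t. norm (G t))" for y
  define \<Psi> where "\<Psi> y = ?m (s y) ** g y - integral {0..y} (\<lambda>t. ?m (s' t) ** g t)
      - integral {0..y} (\<lambda>t. ?m (s t) ** G t)" for y
  have step: "norm (\<Psi> z - \<Psi> y) \<le> 2 * S * (z - y) * (m z - m y)" if "0 \<le> y" "y \<le> z" "z \<le> b" for y z
  proof -
    have int: "f integrable_on {y..z}" if "f integrable_on {0..b}" for f :: "real \<Rightarrow> 'q::banach"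
      using that \<open>0 \<le> y\<close> \<open>z \<le> b\<close> by (auto intro: integrable_on_subinterval)
    have comb: "integral {0..z} f - integral {0..y} f = integral {y..z} f" if "f integrable_on {0..b}" for f :: "real \<Rightarrow> 'q::banach"
    proof -
      have "f integrable_on {0..z}" using that \<open>z \<le> b\<close> by (auto intro: integrable_on_subinterval)
      from Henstock_Kurzweil_Integration.integral_combine[OF \<open>0 \<le> y\<close> \<open>y \<le> z\<close> this] show ?thesis by (simp add: algebra_simps)
    qed
    have gd: "g z - g t = integral {t..z} G" if "t \<in> {y..z}" for t
    proof -
      have "G integrable_on {0..z}" using Gi \<open>z \<le> b\<close> by (auto intro: integrable_on_subinterval)
      from Henstock_Kurzweil_Integration.integral_combine[OF _ _ this, of t] show ?thesis
        using that \<open>0 \<le> y\<close> \<open>z \<le> b\<close> by (auto simp: g algebra_simps)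
    qed
    have gle: "norm (g z - g t) \<le> m z - m y" if t: "t \<in> {y..z}" for t
    proof -
      have "norm (integral {t..z} G) \<le> integral {t..z} (\<lambda>t. norm (G t))"
        using t int[OF Gi] int[OF nGi]
        by (intro integral_norm_bound_integral) (auto intro: integrable_on_subinterval)
      also have "\<dots> \<le> integral {y..z} (\<lambda>t. norm (G t))"
        using t int[OF nGi] by (intro integral_subset_le) (auto intro: integrable_on_subinterval)
      also have "\<dots> = m z - m y" unfolding m_def by (rule comb[OF nGi, symmetric])
      finally show ?thesis by (simp add: gd[OF t])
    qed
    have cms': "continuous_on {y..z} (\<lambda>t. ?m (s' t))" "continuous_on {y..z} g"
      using cms(2) cg that by (auto intro: continuous_on_subset)
    have FT: "((\<lambda>t. ?m (s' t)) has_integral ?m (s t) - ?m (s y)) {y..t}" if "t \<in> {y..z}" for t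
      using that \<open>0 \<le> y\<close> \<open>z \<le> b\<close>
      by (intro fundamental_theorem_of_calculus bounded_linear.has_vector_derivative[OF bounded_linear_mat]
            has_vector_derivative_within_subset[OF s]) auto
    \<comment> \<open>Both integrals are small: \<open>g z - g t\<close> and \<open>s y - s t\<close> are bounded by the increments of \<open>m\<close> and of the argument.\<close>
    have i1: "integral {y..z} (\<lambda>t. ?m (s' t) ** (g z - g t))
        = (?m (s z) - ?m (s y)) ** g z - integral {y..z} (\<lambda>t. ?m (s' t) ** g t)"
    proof -
      have "integral {y..z} (\<lambda>t. ?m (s' t) ** g z) = integral {y..z} (\<lambda>t. ?m (s' t)) ** g z"
        by (intro integral_bounded_linear[OF matmul.bounded_linear_left] integrable_continuous_real cms')
      then show ?thesis
        using integral_unique[OF FT[of z]] that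
        by (simp add: matmul.diff_right integral_diff integrable_continuous_real matmul.continuous_on cms' continuous_on_const)
    qed
    have i2: "integral {y..z} (\<lambda>t. (?m (s y) - ?m (s t)) ** G t)
        = ?m (s y) ** (g z - g y) - integral {y..z} (\<lambda>t. ?m (s t) ** G t)"
      using integrable_linear[OF int[OF Gi] matmul.bounded_linear_right[of "?m (s y)"]] that
      by (simp add: matmul.diff_left integral_diff int isG integral_mat_mult gd[of y] Gi o_def)
    have "\<Psi> z - \<Psi> y = ?m (s z) ** g z - ?m (s y) ** g y
        - integral {y..z} (\<lambda>t. ?m (s' t) ** g t) - integral {y..z} (\<lambda>t. ?m (s t) ** G t)"
      unfolding \<Psi>_def using comb[OF integrable_continuous_real[OF cs'g]] comb[OF isG]
      by (simp add: algebra_simps)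
    also have "\<dots> = integral {y..z} (\<lambda>t. ?m (s' t) ** (g z - g t)) + integral {y..z} (\<lambda>t. (?m (s y) - ?m (s t)) ** G t)"
      unfolding i1 i2 by (simp add: matmul.diff_right matmul.diff_left)
    finally have eq: "\<Psi> z - \<Psi> y = \<dots>" .
    have "norm (integral {y..z} (\<lambda>t. ?m (s' t) ** (g z - g t))) \<le> integral {y..z} (\<lambda>t. S * (m z - m y))"
    proof (rule integral_norm_bound_integral)
      show "(\<lambda>t. ?m (s' t) ** (g z - g t)) integrable_on {y..z}"
        by (intro integrable_continuous_real matmul.continuous_on continuous_on_diff continuous_on_const cms')
      show "norm (?m (s' t) ** (g z - g t)) \<le> S * (m z - m y)" if "t \<in> {y..z}" for t
        using that \<open>0 \<le> y\<close> \<open>z \<le> b\<close> S0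
        by (intro order_trans[OF norm_matrix_mult_le] mult_mono S gle) auto
    qed auto
    then have 1: "norm (integral {y..z} (\<lambda>t. ?m (s' t) ** (g z - g t))) \<le> S * (z - y) * (m z - m y)"
      using that by (simp add: mult_ac)
    have "norm (integral {y..z} (\<lambda>t. (?m (s y) - ?m (s t)) ** G t)) \<le> integral {y..z} (\<lambda>t. S * (z - y) * norm (G t))"
    proof (rule integral_norm_bound_integral)
      show "(\<lambda>t. (?m (s y) - ?m (s t)) ** G t) integrable_on {y..z}"
        using integrable_linear[OF int[OF Gi] matmul.bounded_linear_right[of "?m (s y)"]]
        by (simp add: matmul.diff_left int isG integrable_diff o_def)
      show "norm ((?m (s y) - ?m (s t)) ** G t) \<le> S * (z - y) * norm (G t)" if t: "t \<in> {y..z}" for t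
      proof -
        have "norm (?m (s t) - ?m (s y)) \<le> S * (t - y)"
          using has_integral_bound_real[OF S0 finite.emptyI FT[OF t]] t \<open>0 \<le> y\<close> \<open>z \<le> b\<close> S by auto
        also have "\<dots> \<le> S * (z - y)" using t S0 by (intro mult_left_mono) auto
        finally show ?thesis
          by (intro order_trans[OF norm_matrix_mult_le] mult_right_mono) (auto simp: norm_minus_commute)
      qed
    qed (use int[OF nGi] in \<open>auto intro!: integrable_on_mult_right\<close>)
    also have "\<dots> = S * (z - y) * (m z - m y)" using comb[OF nGi] by (simp add: m_def)
    finally show ?thesis using 1 unfolding eq by (intro order_trans[OF norm_triangle_ineq]) simp
  qed
  have cm: "continuous_on {0..b} m" unfolding m_def by (rule indefinite_integral_continuous_1[OF nGi])
  have "(\<Psi> has_vector_derivative 0) (at y within {0..b})" if y: "y \<in> {0..b}" for y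
    unfolding has_vector_derivative_def has_derivative_within
  proof (intro conjI)
    show "bounded_linear (\<lambda>t :: real. t *\<^sub>R (0 :: complex^'m^'m))" by simp
    show "((\<lambda>z. (1 / norm (z - y)) *\<^sub>R (\<Psi> z - (\<Psi> y + (z - y) *\<^sub>R 0))) \<longlongrightarrow> 0) (at y within {0..b})"
    proof (rule Lim_null_comparison)
      show "\<forall>\<^sub>F z in at y within {0..b}. norm ((1 / norm (z - y)) *\<^sub>R (\<Psi> z - (\<Psi> y + (z - y) *\<^sub>R 0)))
          \<le> 2 * S * \<bar>m z - m y\<bar>"
        unfolding eventually_at_filter
      proof (intro always_eventually allI impI)
        fix z assume z: "z \<noteq> y" "z \<in> {0..b}"
        have "norm (\<Psi> z - \<Psi> y) \<le> 2 * S * \<bar>z - y\<bar> * \<bar>m z - m y\<bar>"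
        proof (cases "y \<le> z")
          case True
          then have "norm (\<Psi> z - \<Psi> y) \<le> 2 * S * (z - y) * (m z - m y)" using step[of y z] y z by auto
          also have "\<dots> \<le> 2 * S * (z - y) * \<bar>m z - m y\<bar>" using True S0 by (intro mult_left_mono) auto
          finally show ?thesis using True by simp
        next
          case False
          then have "norm (\<Psi> y - \<Psi> z) \<le> 2 * S * (y - z) * (m y - m z)" using step[of z y] y z by auto
          also have "\<dots> \<le> 2 * S * (y - z) * \<bar>m z - m y\<bar>" using False S0 by (intro mult_left_mono) auto
          finally show ?thesis using False by (simp add: norm_minus_commute)
        qed
        then show "norm ((1 / norm (z - y)) *\<^sub>R (\<Psi> z - (\<Psi> y + (z - y) *\<^sub>R 0))) \<le> 2 * S * \<bar>m z - m y\<bar>"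
          using z by (simp add: divide_le_eq mult_ac)
      qed
      have "(m \<longlongrightarrow> m y) (at y within {0..b})" using cm y by (auto simp: continuous_on_def)
      then show "((\<lambda>z. 2 * S * \<bar>m z - m y\<bar>) \<longlongrightarrow> 0) (at y within {0..b})"
        by (auto intro!: tendsto_eq_intros)
    qed
  qed
  then obtain c where c: "\<And>y. y \<in> {0..b} \<Longrightarrow> \<Psi> y = c"
    using has_vector_derivative_zero_constant[of "{0..b}" \<Psi>] by auto
  have "\<Psi> x = \<Psi> 0" using c x b by auto
  also have "\<Psi> 0 = ?m (s 0) ** B" using g[of 0] b by (simp add: \<Psi>_def)
  finally show ?thesis by (simp add: \<Psi>_def algebra_simps)
qed


context
  fixes Q :: "real \<Rightarrow> complex^'m^'m"
  assumes L2: "L2_potential Q"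
begin

text \<open>Two integrations by parts move the second derivative from \<open>Y\<close> to a solution \<open>s\<close> of
  \<open>s'' = - \<rho>\<^sup>2 s\<close>; the terms with \<open>\<rho>\<^sup>2\<close> cancel and only the potential remains under the integral.\<close>

lemma green_identity:
  assumes Y: "ivp Q (\<rho>\<^sup>2) A B Y" and x: "x \<in> {0..pi}"
    and s: "\<And>t. (s has_vector_derivative s' t) (at t within {0..pi})"
    and s': "\<And>t. (s' has_vector_derivative - (\<rho>\<^sup>2) * s t) (at t within {0..pi})"
  shows "integral {0..x} (\<lambda>t. mat (s t) ** (Q t ** Y t))
    = mat (s x) ** deriv_Icc Y x - mat (s 0) ** B - mat (s' x) ** Y x + mat (s' 0) ** A"
proof -
  note Q = potential_integrable[OF L2] and P = shifted_potential_integrable[OF L2]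
  have cont: "continuous_on {0..pi} Y" by (rule ivp_imp_volterra(1)[OF L2 Y])
  have cs: "continuous_on {0..pi} s" "continuous_on {0..pi} s'"
    using s s' by (auto intro!: differentiable_imp_continuous_on simp: differentiable_on_def intro: differentiableI_vector[OF s] differentiableI_vector[OF s'])
  have cms: "continuous_on {0..pi} (\<lambda>t. mat (s t) :: complex^'m^'m)"
    by (rule bounded_linear.continuous_on[OF bounded_linear_mat cs(1)])
  let ?G = "\<lambda>t. (Q t - mat (\<rho>\<^sup>2)) ** Y t"
  have G: "?G absolutely_integrable_on {0..pi}" by (rule absolutely_integrable_matmul(1)[OF P cont])
  have g: "deriv_Icc Y t = B + integral {0..t} ?G" if "t \<in> {0..pi}" for t
    by (rule ivp_imp_volterra(3)[OF L2 Y that])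
  have cg: "continuous_on {0..pi} (deriv_Icc Y)"
    by (rule continuous_on_eq[where f = "\<lambda>t. B + integral {0..t} ?G"])
       (use G in \<open>auto intro!: continuous_intros indefinite_integral_continuous_1 simp: g absolutely_integrable_on_def\<close>)
  have Yg: "Y t = A + integral {0..t} (deriv_Icc Y)" if "t \<in> {0..pi}" for t
  proof -
    have "(deriv_Icc Y has_integral Y t - Y 0) {0..t}"
      using that by (intro fundamental_theorem_of_calculus has_vector_derivative_within_subset[OF ivp_imp_volterra(2)[OF L2 Y]]) auto
    then show ?thesis using Y by (simp add: integral_unique ivp_def)
  qed
  have 1: "integral {0..x} (\<lambda>t. mat (s t) ** ?G t)
      = mat (s x) ** deriv_Icc Y x - mat (s 0) ** B - integral {0..x} (\<lambda>t. mat (s' t) ** deriv_Icc Y t)"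
    by (rule integral_by_parts[OF G x s cs(2) g])
  have 2: "integral {0..x} (\<lambda>t. mat (s' t) ** deriv_Icc Y t)
      = mat (s' x) ** Y x - mat (s' 0) ** A - integral {0..x} (\<lambda>t. mat (- (\<rho>\<^sup>2) * s t) ** Y t)"
    by (rule integral_by_parts[OF absolutely_integrable_continuous_real[OF cg] x s' _ Yg])
       (intro continuous_intros cs)
  have QY: "(\<lambda>t. Q t ** Y t) absolutely_integrable_on {0..pi}" by (rule absolutely_integrable_matmul(1)[OF Q cont])
  have i: "(\<lambda>t. mat (s t) ** (Q t ** Y t)) integrable_on {0..x}" "(\<lambda>t. mat (s t) ** Y t) integrable_on {0..x}"
    using integrable_matmul(2)[OF QY cms x] integrable_matmul(2)[OF absolutely_integrable_continuous_real[OF cont] cms x]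
    by auto
  have i': "(\<lambda>t. mat c ** (mat (s t) ** Y t)) integrable_on {0..x}" for c
    using integrable_linear[OF i(2) matmul.bounded_linear_right[of "mat c"]] by (simp add: o_def)
  have "integral {0..x} (\<lambda>t. mat (s t) ** ?G t)
      = integral {0..x} (\<lambda>t. mat (s t) ** (Q t ** Y t) - mat (\<rho>\<^sup>2) ** (mat (s t) ** Y t))"
    by (simp add: matmul.diff_left matmul.diff_right mat_mult_assoc mult.commute)
  also have "\<dots> = integral {0..x} (\<lambda>t. mat (s t) ** (Q t ** Y t)) - mat (\<rho>\<^sup>2) ** integral {0..x} (\<lambda>t. mat (s t) ** Y t)"
    using i i' by (simp add: integral_diff integral_mat_mult)
  finally have 3: "integral {0..x} (\<lambda>t. mat (s t) ** ?G t) = \<dots>" .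
  have "integral {0..x} (\<lambda>t. mat (- (\<rho>\<^sup>2) * s t) ** Y t) = integral {0..x} (\<lambda>t. mat (- (\<rho>\<^sup>2)) ** (mat (s t) ** Y t))"
    by (simp add: mat_mult_assoc)
  also have "\<dots> = - (mat (\<rho>\<^sup>2) ** integral {0..x} (\<lambda>t. mat (s t) ** Y t))"
    by (simp only: integral_mat_mult[OF i(2)]) (simp only: mat_arith matmul.minus_left)
  finally have 4: "integral {0..x} (\<lambda>t. mat (- (\<rho>\<^sup>2) * s t) ** Y t) = \<dots>" .
  show ?thesis using 1 2 3 4 by (simp add: algebra_simps)
qed

text \<open>Green's identity with \<open>s t = sin (\<rho> (x - t)) / \<rho>\<close> and with \<open>s t = cos (\<rho> (x - t))\<close>.\<close>

lemma variation_of_constants: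
  assumes Y: "ivp Q (\<rho>\<^sup>2) A B Y" and x: "x \<in> {0..pi}" and \<rho>: "\<rho> \<noteq> 0"
  shows "Y x = mat (cos (\<rho> * of_real x)) ** A + mat (sin (\<rho> * of_real x) / \<rho>) ** B
      + integral {0..x} (\<lambda>t. mat (sin (\<rho> * of_real (x - t)) / \<rho>) ** (Q t ** Y t))"
    and "deriv_Icc Y x = mat (- \<rho> * sin (\<rho> * of_real x)) ** A + mat (cos (\<rho> * of_real x)) ** B
      + integral {0..x} (\<lambda>t. mat (cos (\<rho> * of_real (x - t))) ** (Q t ** Y t))"
proof -
  have inner: "((\<lambda>t. \<rho> * of_real (x - t)) has_vector_derivative - \<rho>) (at t within {0..pi})" for t
    by (auto intro!: derivative_eq_intros simp: has_vector_derivative_def scaleR_conv_of_real fun_eq_iff)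
  have ds: "((\<lambda>t. sin (\<rho> * of_real (x - t))) has_vector_derivative - \<rho> * cos (\<rho> * of_real (x - t))) (at t within {0..pi})" for t
    using field_vector_diff_chain_within[OF inner DERIV_subset[OF DERIV_sin subset_UNIV]] by (simp add: o_def)
  have dc: "((\<lambda>t. cos (\<rho> * of_real (x - t))) has_vector_derivative \<rho> * sin (\<rho> * of_real (x - t))) (at t within {0..pi})" for t
    using field_vector_diff_chain_within[OF inner DERIV_subset[OF DERIV_cos subset_UNIV]] by (simp add: o_def)
  have s1: "((\<lambda>t. sin (\<rho> * of_real (x - t)) / \<rho>) has_vector_derivative - cos (\<rho> * of_real (x - t))) (at t within {0..pi})" for t
    using has_vector_derivative_mult_right[OF ds, of "1 / \<rho>"] \<rho> by simp
  have s2: "((\<lambda>t. - cos (\<rho> * of_real (x - t))) has_vector_derivative - (\<rho>\<^sup>2) * (sin (\<rho> * of_real (x - t)) / \<rho>)) (at t within {0..pi})" for t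
    using has_vector_derivative_minus[OF dc] \<rho> by (simp add: power2_eq_square)
  have s3: "((\<lambda>t. \<rho> * sin (\<rho> * of_real (x - t))) has_vector_derivative - (\<rho>\<^sup>2) * cos (\<rho> * of_real (x - t))) (at t within {0..pi})" for t
    using has_vector_derivative_mult_right[OF ds, of \<rho>] by (simp add: power2_eq_square mult.assoc)
  show "Y x = mat (cos (\<rho> * of_real x)) ** A + mat (sin (\<rho> * of_real x) / \<rho>) ** B
      + integral {0..x} (\<lambda>t. mat (sin (\<rho> * of_real (x - t)) / \<rho>) ** (Q t ** Y t))"
    using green_identity[OF Y x s1 s2] by (simp add: mat_arith matmul.minus_left)
  show "deriv_Icc Y x = mat (- \<rho> * sin (\<rho> * of_real x)) ** A + mat (cos (\<rho> * of_real x)) ** B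
      + integral {0..x} (\<lambda>t. mat (cos (\<rho> * of_real (x - t))) ** (Q t ** Y t))"
    using green_identity[OF Y x dc s3] by (simp add: mat_arith matmul.minus_left)
qed

end

section \<open>Asymptotics of the boundary forms\<close>

lemma cmod_cos_sin_le:
  shows "cmod (cos z) \<le> exp \<bar>Im z\<bar>" "cmod (sin z) \<le> exp \<bar>Im z\<bar>"
proof -
  have 1: "cmod (exp (\<i> * z)) \<le> exp \<bar>Im z\<bar>" "cmod (exp (- \<i> * z)) \<le> exp \<bar>Im z\<bar>" by auto
  have "cmod (exp (\<i> * z) + exp (- \<i> * z)) \<le> 2 * exp \<bar>Im z\<bar>"
    using norm_triangle_mono[OF 1] by simp
  then show "cmod (cos z) \<le> exp \<bar>Im z\<bar>"
    by (simp add: cos_exp_eq norm_divide del: norm_exp_eq_Re)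
  have "cmod (exp (\<i> * z) - exp (- \<i> * z)) \<le> 2 * exp \<bar>Im z\<bar>"
    using norm_triangle_mono[of "exp (\<i> * z)" _ "- exp (- \<i> * z)"] 1 by fastforce
  then show "cmod (sin z) \<le> exp \<bar>Im z\<bar>"
    by (simp add: sin_exp_eq norm_divide norm_mult del: norm_exp_eq_Re)
qed

lemma cmod_cos_sin_strip:
  assumes "\<bar>Im \<rho>\<bar> \<le> 1" "\<bar>y\<bar> \<le> pi"
  shows "cmod (cos (\<rho> * of_real y)) \<le> exp pi" "cmod (sin (\<rho> * of_real y)) \<le> exp pi"
proof -
  have "\<bar>Im (\<rho> * of_real y)\<bar> \<le> pi" using mult_mono[OF assms] by (simp add: abs_mult)
  then show "cmod (cos (\<rho> * of_real y)) \<le> exp pi" "cmod (sin (\<rho> * of_real y)) \<le> exp pi"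
    by (meson cmod_cos_sin_le exp_le_cancel_iff order_trans)+
qed

lemma norm_integral_mat_le:
  fixes P :: "real \<Rightarrow> complex^'m^'m" and f :: "real \<Rightarrow> complex"
  assumes P: "P absolutely_integrable_on {0..b}" and f: "continuous_on {0..b} f" and b: "0 \<le> b"
    and K: "\<And>t. t \<in> {0..b} \<Longrightarrow> cmod (f t) \<le> K"
  shows "(\<lambda>t. mat (f t) ** P t) integrable_on {0..b}"
    and "norm (integral {0..b} (\<lambda>t. mat (f t) ** P t)) \<le> K * integral {0..b} (\<lambda>t. norm (P t))"
proof -
  show i: "(\<lambda>t. mat (f t) ** P t) integrable_on {0..b}"
    using integrable_matmul(2)[OF P bounded_linear.continuous_on[OF bounded_linear_mat f]] b by auto
  have "norm (integral {0..b} (\<lambda>t. mat (f t) ** P t)) \<le> integral {0..b} (\<lambda>t. K * norm (P t))"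
    using P K by (intro integral_norm_bound_integral i)
      (auto simp: norm_mat_mult absolutely_integrable_on_def intro!: integrable_on_mult_right mult_right_mono)
  then show "norm (integral {0..b} (\<lambda>t. mat (f t) ** P t)) \<le> K * integral {0..b} (\<lambda>t. norm (P t))"
    by simp
qed

text \<open>The parts of \<open>cos (\<rho> (\<pi> - t)) cos \<rho>t\<close> and \<open>cos (\<rho> (\<pi> - t)) sin \<rho>t\<close> that oscillate in \<open>t\<close>, up to sign,
  integrated against the potential. They are the only terms of their order that are not explicit, and they are small
  only in the sense of square sums.\<close>

definition cos_transform :: "(real \<Rightarrow> complex^'m^'m) \<Rightarrow> complex \<Rightarrow> complex^'m^'m" where
  "cos_transform Q \<rho> = integral {0..pi} (\<lambda>t. mat (cos (\<rho> * of_real (pi - 2 * t)) / 2) ** Q t)"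

definition sin_transform :: "(real \<Rightarrow> complex^'m^'m) \<Rightarrow> complex \<Rightarrow> complex^'m^'m" where
  "sin_transform Q \<rho> = integral {0..pi} (\<lambda>t. mat (sin (\<rho> * of_real (pi - 2 * t)) / 2) ** Q t)"

context
  fixes Q :: "real \<Rightarrow> complex^'m^'m"
  assumes L2: "L2_potential Q"
begin

text \<open>One step of successive approximation: \<open>c\<close> is the solution for the zero potential with the same
  Cauchy data. The kernel in the variation of constants formula for \<open>Y\<close> carries a factor \<open>1/\<rho>\<close>, so \<open>Y\<close>
  differs from \<open>c\<close> by \<open>O(N/\<rho>)\<close>, and \<open>Y\<close> may be replaced by \<open>c\<close> in the formula for \<open>Y'(\<pi>)\<close>. The bound is
  proportional to \<open>N\<close>, which makes it one order better for the solution \<open>S\<close> than for \<open>\<phi>\<close>.\<close>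

lemma V_form_approx:
  assumes Y: "ivp Q (\<rho>\<^sup>2) A B Y" and im: "\<bar>Im \<rho>\<bar> \<le> 1"
  defines "q \<equiv> integral {0..pi} (\<lambda>t. norm (Q t))"
    and "c \<equiv> (\<lambda>t. mat (cos (\<rho> * of_real t)) ** A + mat (sin (\<rho> * of_real t) / \<rho>) ** B)"
  assumes large: "2 * exp pi * q \<le> cmod \<rho>" and \<rho>: "\<rho> \<noteq> 0"
    and N: "\<And>t. t \<in> {0..pi} \<Longrightarrow> norm (c t) \<le> N"
  shows "norm (V_form H Y - (mat (- \<rho> * sin (\<rho> * pi)) ** A + mat (cos (\<rho> * pi)) ** B
           + integral {0..pi} (\<lambda>t. mat (cos (\<rho> * of_real (pi - t))) ** (Q t ** c t)) + H ** c pi))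
      \<le> 2 * N * exp pi * q * (exp pi * q + norm H) / cmod \<rho>"
proof -
  note Q = potential_integrable[OF L2] and voc = variation_of_constants[OF L2 Y _ \<rho>]
  have cont: "continuous_on {0..pi} Y" by (rule ivp_imp_volterra(1)[OF L2 Y])
  have contc: "continuous_on {0..pi} c"
    unfolding c_def using \<rho>
    by (intro continuous_on_add matmul.continuous_on continuous_on_const
        bounded_linear.continuous_on[OF bounded_linear_mat] continuous_intros) auto
  have q0: "0 \<le> q" unfolding q_def by (rule integral_nonneg) (use Q in \<open>auto simp: absolutely_integrable_on_def\<close>)
  have pi: "pi \<in> {0..pi}" by simp
  have r0: "0 < cmod \<rho>" using \<rho> by simp
  have kernel: "norm (integral {0..x} (\<lambda>t. mat (f t) ** (Q t ** Z t))) \<le> q * (k * M)"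
    if x: "x \<in> {0..pi}" and f: "continuous_on {0..pi} f" and Z: "continuous_on {0..pi} Z"
      and M: "\<And>t. t \<in> {0..pi} \<Longrightarrow> norm (Z t) \<le> M" and k: "\<And>t. t \<in> {0..x} \<Longrightarrow> cmod (f t) \<le> k"
    for f x M k and Z :: "real \<Rightarrow> complex^'m^'m"
  proof -
    have "norm (integral {0..x} (\<lambda>t. Q t ** (mat (f t) ** Z t))) \<le> q * (k * M)"
      unfolding q_def
    proof (rule norm_integral_matmul_le(1)[OF Q _ x])
      show "continuous_on {0..pi} (\<lambda>t. mat (f t) ** Z t)"
        by (intro matmul.continuous_on Z bounded_linear.continuous_on[OF bounded_linear_mat f])
      show "norm (mat (f t) ** Z t) \<le> k * M" if "t \<in> {0..x}" for t
        using that x M[of t] k[of t] unfolding norm_mat_mult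
        by (intro mult_mono) (auto intro: order_trans[OF norm_ge_zero])
    qed
    then show ?thesis by (simp add: mat_left_commute)
  qed
  have cos_sin: "cmod (cos (\<rho> * of_real (x - t))) \<le> exp pi" "cmod (sin (\<rho> * of_real (x - t)) / \<rho>) \<le> exp pi / cmod \<rho>"
    if "x \<in> {0..pi}" "t \<in> {0..x}" for x t
    using cmod_cos_sin_strip[OF im, of "x - t"] that by (auto simp: norm_divide intro!: divide_right_mono)
  have contcs: "continuous_on {0..pi} (\<lambda>t. cos (\<rho> * of_real (x - t)))"
      "continuous_on {0..pi} (\<lambda>t. sin (\<rho> * of_real (x - t)) / \<rho>)" for x
    using \<rho> by (auto intro!: continuous_intros)
  have "\<exists>y\<in>{0..pi}. \<forall>x\<in>{0..pi}. norm (Y x) \<le> norm (Y y)"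
    using cont by (intro continuous_attains_sup) (auto intro!: continuous_intros)
  then obtain y where y: "y \<in> {0..pi}" and max: "\<And>x. x \<in> {0..pi} \<Longrightarrow> norm (Y x) \<le> norm (Y y)" by blast
  have diff: "norm (Y x - c x) \<le> exp pi * q / cmod \<rho> * norm (Y y)" if x: "x \<in> {0..pi}" for x
  proof -
    have "Y x - c x = integral {0..x} (\<lambda>t. mat (sin (\<rho> * of_real (x - t)) / \<rho>) ** (Q t ** Y t))"
      using voc(1)[OF x] by (simp add: c_def)
    with kernel[OF x contcs(2) cont max cos_sin(2)[OF x]] show ?thesis by (simp add: mult_ac)
  qed
  \<comment> \<open>For large \<open>\<rho>\<close> the integral term is absorbed by half of the maximum of \<open>\<bar>Y\<bar>\<close>.\<close>
  have half: "exp pi * q / cmod \<rho> \<le> 1 / 2" using large r0 by (simp add: field_simps)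
  have "norm (Y y) \<le> norm (c y) + norm (Y y - c y)" using norm_triangle_ineq[of "c y" "Y y - c y"] by simp
  also have "\<dots> \<le> N + 1 / 2 * norm (Y y)"
    by (intro add_mono N y order_trans[OF diff[OF y]] mult_right_mono half) auto
  finally have Yy: "norm (Y y) \<le> 2 * N" by simp
  have diff': "norm (Y x - c x) \<le> exp pi * q / cmod \<rho> * (2 * N)" if x: "x \<in> {0..pi}" for x
    using q0 by (intro order_trans[OF diff[OF x]] mult_left_mono Yy) auto
  have i: "(\<lambda>t. mat (cos (\<rho> * of_real (pi - t))) ** (Q t ** Z t)) integrable_on {0..pi}" if "continuous_on {0..pi} Z"
    for Z :: "real \<Rightarrow> complex^'m^'m"
    using integrable_matmul(2)[OF absolutely_integrable_matmul(1)[OF Q that]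
        bounded_linear.continuous_on[OF bounded_linear_mat contcs(1)] pi] .
  have "V_form H Y - (mat (- \<rho> * sin (\<rho> * pi)) ** A + mat (cos (\<rho> * pi)) ** B
           + integral {0..pi} (\<lambda>t. mat (cos (\<rho> * of_real (pi - t))) ** (Q t ** c t)) + H ** c pi)
      = integral {0..pi} (\<lambda>t. mat (cos (\<rho> * of_real (pi - t))) ** (Q t ** (Y t - c t))) + H ** (Y pi - c pi)"
    unfolding V_form_def voc(2)[OF pi]
    using i[OF cont] i[OF contc] by (simp add: matmul.diff_right integral_diff)
  also have "norm \<dots> \<le> q * (exp pi * (exp pi * q / cmod \<rho> * (2 * N))) + norm H * (exp pi * q / cmod \<rho> * (2 * N))"
    using kernel[OF pi contcs(1) continuous_on_diff[OF cont contc] diff' cos_sin(1)[OF pi]] diff'[OF pi]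
    by (intro norm_triangle_le add_mono order_trans[OF norm_matrix_mult_le] mult_left_mono) auto
  also have "\<dots> = 2 * N * exp pi * q * (exp pi * q + norm H) / cmod \<rho>"
    by (simp add: algebra_simps add_divide_distrib)
  finally show ?thesis .
qed

text \<open>Insert the zero-potential solutions into the previous lemma and write the products of
  trigonometric functions as sums. The part that does not depend on \<open>t\<close> produces half the integral of
  \<open>Q\<close>, the other part the transforms.\<close>

lemma V_form_asymptotics:
  obtains C r where "0 < r" "0 \<le> C"
    and "\<And>\<rho> Y. ivp Q (\<rho>\<^sup>2) (mat 1) h Y \<Longrightarrow> \<bar>Im \<rho>\<bar> \<le> 1 \<Longrightarrow> r \<le> cmod \<rho> \<Longrightarrow>
       norm (V_form H Y - (mat (- \<rho> * sin (\<rho> * pi))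
          + mat (cos (\<rho> * pi)) ** (h + H + (1/2) *\<^sub>R integral {0..pi} Q) + cos_transform Q \<rho>)) \<le> C / cmod \<rho>"
    and "\<And>\<rho> Y. ivp Q (\<rho>\<^sup>2) 0 (mat 1) Y \<Longrightarrow> \<bar>Im \<rho>\<bar> \<le> 1 \<Longrightarrow> r \<le> cmod \<rho> \<Longrightarrow>
       norm (V_form H Y - (mat (cos (\<rho> * pi))
          + mat (1 / \<rho>) ** (mat (sin (\<rho> * pi)) ** (H + (1/2) *\<^sub>R integral {0..pi} Q) - sin_transform Q \<rho>)))
        \<le> C / (cmod \<rho>)\<^sup>2"
    and "\<And>\<rho>. \<bar>Im \<rho>\<bar> \<le> 1 \<Longrightarrow> norm (cos_transform Q \<rho>) \<le> C"
    and "\<And>\<rho>. \<bar>Im \<rho>\<bar> \<le> 1 \<Longrightarrow> norm (sin_transform Q \<rho>) \<le> C"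
proof -
  note Q = potential_integrable[OF L2]
  define q where "q = integral {0..pi} (\<lambda>t. norm (Q t))"
  define I where "I = (mat 1 :: complex^'m^'m)"
  define e where "e = exp pi"
  have e0: "0 < e" and e1: "1 \<le> e" by (auto simp: e_def)
  have q0: "0 \<le> q" unfolding q_def by (rule integral_nonneg) (use Q in \<open>auto simp: absolutely_integrable_on_def\<close>)
  have Qi: "Q integrable_on {0..pi}" using Q by (simp add: absolutely_integrable_on_def)
  have tr: "(\<lambda>t. mat (f t) ** (Q t ** M)) integrable_on {0..pi}"
      "norm (integral {0..pi} (\<lambda>t. mat (f t) ** (Q t ** M))) \<le> K * (q * norm M)"
    if f: "continuous_on {0..pi} f" and K: "\<And>t. t \<in> {0..pi} \<Longrightarrow> cmod (f t) \<le> K" for f K and M :: "complex^'m^'m"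
  proof -
    have QM: "(\<lambda>t. Q t ** M) absolutely_integrable_on {0..pi}"
      by (rule absolutely_integrable_matmul(1)[OF Q]) simp
    show "(\<lambda>t. mat (f t) ** (Q t ** M)) integrable_on {0..pi}"
      by (rule norm_integral_mat_le(1)[OF QM f _ K]) auto
    have "integral {0..pi} (\<lambda>t. norm (Q t ** M)) \<le> integral {0..pi} (\<lambda>t. norm (Q t) * norm M)"
      using QM Q by (intro integral_le) (auto simp: absolutely_integrable_on_def norm_matrix_mult_le intro!: integrable_on_mult_left)
    then have "integral {0..pi} (\<lambda>t. norm (Q t ** M)) \<le> q * norm M" by (simp add: q_def)
    moreover have "0 \<le> K" using K[of 0] by (auto intro: order_trans[OF norm_ge_zero])
    ultimately show "norm (integral {0..pi} (\<lambda>t. mat (f t) ** (Q t ** M))) \<le> K * (q * norm M)"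
      by (intro order_trans[OF norm_integral_mat_le(2)[OF QM f _ K]] mult_left_mono) auto
  qed
  have ct: "norm (cos_transform Q \<rho>) \<le> e * q" and st: "norm (sin_transform Q \<rho>) \<le> e * q" if "\<bar>Im \<rho>\<bar> \<le> 1" for \<rho>
  proof -
    have "cmod (cos (\<rho> * of_real (pi - 2 * t)) / 2) \<le> e \<and> cmod (sin (\<rho> * of_real (pi - 2 * t)) / 2) \<le> e"
      if "t \<in> {0..pi}" for t
    proof -
      have "\<bar>pi - 2 * t\<bar> \<le> pi" using that by auto
      moreover have "y / cmod 2 \<le> e" if "y \<le> e" for y using that e0 by simp
      ultimately show ?thesis
        using cmod_cos_sin_strip[OF \<open>\<bar>Im \<rho>\<bar> \<le> 1\<close>, of "pi - 2 * t"] unfolding norm_divide e_def by blast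
    qed
    then show "norm (cos_transform Q \<rho>) \<le> e * q" "norm (sin_transform Q \<rho>) \<le> e * q"
      unfolding cos_transform_def sin_transform_def q_def
      by (auto intro!: norm_integral_mat_le(2)[OF Q] continuous_intros)
  qed
  define C1 where "C1 = 2 * (e * norm I + e * norm h) * e * q * (e * q + norm H) + e * e * (q * norm h) + e * norm H * norm h"
  define C2 where "C2 = 2 * (e * norm I) * e * q * (e * q + norm H)"
  have C0: "0 \<le> C1" "0 \<le> C2" using e0 q0 by (auto simp: C1_def C2_def)
  have contprod: "continuous_on {0..pi} (\<lambda>t. cos (\<rho> * of_real (pi - t)) * (sin (\<rho> * of_real t) / \<rho>))"
      "continuous_on {0..pi} (\<lambda>t. cos (\<rho> * of_real (pi - t)) * cos (\<rho> * of_real t))" if "\<rho> \<noteq> 0" for \<rho> :: complex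
    using that by (auto intro!: continuous_intros)
  have angle: "\<rho> * of_real (pi - t) + \<rho> * of_real t = \<rho> * pi" "\<rho> * of_real (pi - t) - \<rho> * of_real t = \<rho> * of_real (pi - 2 * t)"
    for \<rho> :: complex and t by (simp_all add: algebra_simps)
  have cc: "cos (\<rho> * of_real (pi - t)) * cos (\<rho> * of_real t) = cos (\<rho> * pi) / 2 + cos (\<rho> * of_real (pi - 2 * t)) / 2" for \<rho> :: complex and t
    unfolding angle[symmetric, of \<rho> t] cos_add cos_diff by (simp add: field_simps)
  have sc: "cos (\<rho> * of_real (pi - t)) * (sin (\<rho> * of_real t) / \<rho>)
      = 1 / \<rho> * (sin (\<rho> * pi) / 2 - sin (\<rho> * of_real (pi - 2 * t)) / 2)" for \<rho> :: complex and t
    unfolding angle[symmetric, of \<rho> t] sin_add sin_diff by (simp add: field_simps)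
  have int_mat: "(\<lambda>t. mat (f t) ** Q t) integrable_on {0..pi}" if "continuous_on {0..pi} f" for f :: "real \<Rightarrow> complex"
    using integrable_matmul(2)[OF Q bounded_linear.continuous_on[OF bounded_linear_mat that]] by simp
  have int_half: "(\<lambda>t. mat (cos (\<rho> * of_real (pi - 2 * t)) / 2) ** Q t) integrable_on {0..pi}"
      "(\<lambda>t. mat (sin (\<rho> * of_real (pi - 2 * t)) / 2) ** Q t) integrable_on {0..pi}"
      "(\<lambda>t. mat z ** Q t) integrable_on {0..pi}" for \<rho> z
    by (rule int_mat, (intro continuous_intros; simp))+
  have half: "mat (z / 2) ** integral {0..pi} Q = mat z ** ((1/2) *\<^sub>R integral {0..pi} Q)" for z
    by (simp add: vec_eq_iff mat_mult_nth scaleR_conv_of_real[where 'a = complex])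
  have tri: "norm (X - Z) \<le> norm (X - W) + norm (W - Z)" for X W Z :: "complex^'m^'m"
    using norm_triangle_ineq[of "X - W" "W - Z"] by simp
  have est_phi: "norm (V_form H Y - (mat (- \<rho> * sin (\<rho> * pi))
          + mat (cos (\<rho> * pi)) ** (h + H + (1/2) *\<^sub>R integral {0..pi} Q) + cos_transform Q \<rho>)) \<le> C1 / cmod \<rho>"
    if Y: "ivp Q (\<rho>\<^sup>2) (mat 1) h Y" and im: "\<bar>Im \<rho>\<bar> \<le> 1" and r: "1 \<le> cmod \<rho>" "2 * e * q \<le> cmod \<rho>" for \<rho> Y
  proof -
    have \<rho>: "\<rho> \<noteq> 0" and r0: "0 < cmod \<rho>" using r by auto
    have trig: "cmod (cos (\<rho> * of_real t)) \<le> e" "cmod (sin (\<rho> * of_real t) / \<rho>) \<le> e / cmod \<rho>"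
        "cmod (cos (\<rho> * of_real (pi - t))) \<le> e" if "t \<in> {0..pi}" for t
      using cmod_cos_sin_strip[OF im, of t] cmod_cos_sin_strip[OF im, of "pi - t"] that
      by (auto simp: norm_divide e_def intro!: divide_right_mono)
    let ?c = "\<lambda>t. mat (cos (\<rho> * of_real t)) ** mat 1 + mat (sin (\<rho> * of_real t) / \<rho>) ** h"
    let ?X = "mat (- \<rho> * sin (\<rho> * pi)) ** mat 1 + mat (cos (\<rho> * pi)) ** h
           + integral {0..pi} (\<lambda>t. mat (cos (\<rho> * of_real (pi - t))) ** (Q t ** ?c t)) + H ** ?c pi"
    let ?Z = "mat (- \<rho> * sin (\<rho> * pi)) + mat (cos (\<rho> * pi)) ** (h + H + (1/2) *\<^sub>R integral {0..pi} Q) + cos_transform Q \<rho>"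
    have "norm (?c t) \<le> e * norm I + e * norm h" if "t \<in> {0..pi}" for t
    proof -
      have "cmod (sin (\<rho> * of_real t) / \<rho>) \<le> e"
        using trig(2)[OF that] r(1) e0 by (smt (verit) divide_left_mono div_by_1 mult_pos_pos r0)
      then show ?thesis
        using trig(1)[OF that] by (intro norm_triangle_le add_mono) (auto simp: norm_mat_mult I_def mult_right_mono simp del: matrix_mul_rid)
    qed
    from V_form_approx[OF Y im _ \<rho> this, of H] r(2)
    have 1: "norm (V_form H Y - ?X) \<le> 2 * (e * norm I + e * norm h) * e * q * (e * q + norm H) / cmod \<rho>"
      by (simp add: q_def e_def)
    let ?i = "integral {0..pi} (\<lambda>t. mat (cos (\<rho> * of_real (pi - t)) * (sin (\<rho> * of_real t) / \<rho>)) ** (Q t ** h))"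
    have sinb: "cmod (cos (\<rho> * of_real (pi - t)) * (sin (\<rho> * of_real t) / \<rho>)) \<le> e * (e / cmod \<rho>)" if "t \<in> {0..pi}" for t
      unfolding norm_mult using trig[OF that] e0 by (intro mult_mono) auto
    have 3: "norm (mat (sin (\<rho> * pi) / \<rho>) ** (H ** h)) \<le> e / cmod \<rho> * (norm H * norm h)"
      unfolding norm_mat_mult using e0 by (intro mult_mono norm_matrix_mult_le trig(2)) auto
    have at_c: "M ** ?c t = mat (cos (\<rho> * of_real t)) ** M + mat (sin (\<rho> * of_real t) / \<rho>) ** (M ** h)" for M :: "complex^'m^'m" and t
      by (simp only: matmul.add_right matrix_mul_rid mat_commute[of M] mat_left_commute[of M])
    have "integral {0..pi} (\<lambda>t. mat (cos (\<rho> * of_real (pi - t))) ** (Q t ** ?c t))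
        = integral {0..pi} (\<lambda>t. mat (cos (\<rho> * pi) / 2) ** Q t + mat (cos (\<rho> * of_real (pi - 2 * t)) / 2) ** Q t
            + mat (cos (\<rho> * of_real (pi - t)) * (sin (\<rho> * of_real t) / \<rho>)) ** (Q t ** h))"
    proof (rule integral_cong)
      fix t
      have "mat (cos (\<rho> * of_real (pi - t))) ** (Q t ** ?c t)
          = mat (cos (\<rho> * of_real (pi - t)) * cos (\<rho> * of_real t)) ** Q t
            + mat (cos (\<rho> * of_real (pi - t)) * (sin (\<rho> * of_real t) / \<rho>)) ** (Q t ** h)"
        unfolding at_c[of "Q t"] unfolding matmul.add_right mat_mult_assoc by (rule refl)
      then show "mat (cos (\<rho> * of_real (pi - t))) ** (Q t ** ?c t)
         = mat (cos (\<rho> * pi) / 2) ** Q t + mat (cos (\<rho> * of_real (pi - 2 * t)) / 2) ** Q t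
            + mat (cos (\<rho> * of_real (pi - t)) * (sin (\<rho> * of_real t) / \<rho>)) ** (Q t ** h)"
        unfolding cc mat_arith matmul.add_left .
    qed
    also have "\<dots> = mat (cos (\<rho> * pi) / 2) ** integral {0..pi} Q + cos_transform Q \<rho> + ?i"
      using int_half tr(1)[OF contprod(1)[OF \<rho>] sinb, of h]
      by (simp add: integral_add integrable_add integral_mat_mult[OF Qi] cos_transform_def)
    finally have "?X - ?Z = ?i + mat (sin (\<rho> * pi) / \<rho>) ** (H ** h)"
      unfolding at_c[of H] half by (simp add: matmul.add_right)
    also have "norm \<dots> \<le> e * (e / cmod \<rho>) * (q * norm h) + e / cmod \<rho> * (norm H * norm h)"
      by (intro norm_triangle_le add_mono tr(2)[OF contprod(1)[OF \<rho>] sinb] 3)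
    finally have 2: "norm (?X - ?Z) \<le> \<dots>" .
    have "norm (V_form H Y - ?Z) \<le> norm (V_form H Y - ?X) + norm (?X - ?Z)"
      by (rule tri)
    also have "\<dots> \<le> 2 * (e * norm I + e * norm h) * e * q * (e * q + norm H) / cmod \<rho>
        + (e * (e / cmod \<rho>) * (q * norm h) + e / cmod \<rho> * (norm H * norm h))"
      by (intro add_mono 1 2)
    also have "\<dots> = C1 / cmod \<rho>" using r0 by (simp add: C1_def field_simps)
    finally show ?thesis .
  qed
  have est_S: "norm (V_form H Y - (mat (cos (\<rho> * pi))
          + mat (1 / \<rho>) ** (mat (sin (\<rho> * pi)) ** (H + (1/2) *\<^sub>R integral {0..pi} Q) - sin_transform Q \<rho>)))
        \<le> C2 / (cmod \<rho>)\<^sup>2"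
    if Y: "ivp Q (\<rho>\<^sup>2) 0 (mat 1) Y" and im: "\<bar>Im \<rho>\<bar> \<le> 1" and r: "1 \<le> cmod \<rho>" "2 * e * q \<le> cmod \<rho>" for \<rho> Y
  proof -
    have \<rho>: "\<rho> \<noteq> 0" and r0: "0 < cmod \<rho>" using r by auto
    have trig: "cmod (sin (\<rho> * of_real t) / \<rho>) \<le> e / cmod \<rho>" if "t \<in> {0..pi}" for t
      using cmod_cos_sin_strip[OF im, of t] that
      by (auto simp: norm_divide e_def intro!: divide_right_mono)
    let ?c = "\<lambda>t. mat (cos (\<rho> * of_real t)) ** 0 + mat (sin (\<rho> * of_real t) / \<rho>) ** (mat 1 :: complex^'m^'m)"
    let ?X = "mat (- \<rho> * sin (\<rho> * pi)) ** 0 + mat (cos (\<rho> * pi)) ** mat 1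
           + integral {0..pi} (\<lambda>t. mat (cos (\<rho> * of_real (pi - t))) ** (Q t ** ?c t)) + H ** ?c pi"
    let ?Z = "mat (cos (\<rho> * pi))
          + mat (1 / \<rho>) ** (mat (sin (\<rho> * pi)) ** (H + (1/2) *\<^sub>R integral {0..pi} Q) - sin_transform Q \<rho>)"
    have "norm (?c t) \<le> e / cmod \<rho> * norm I" if "t \<in> {0..pi}" for t
      using trig[OF that] mult_right_mono[OF trig[OF that], of "norm I"] norm_mat_mult[of "sin (\<rho> * of_real t) / \<rho>" I]
      by (simp add: I_def matmul.zero_right)
    from V_form_approx[OF Y im _ \<rho> this, of H] r(2)
    have 1: "norm (V_form H Y - ?X) \<le> 2 * (e / cmod \<rho> * norm I) * e * q * (e * q + norm H) / cmod \<rho>"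
      by (simp add: q_def e_def)
    have at_c: "M ** ?c t = mat (sin (\<rho> * of_real t) / \<rho>) ** M" for M :: "complex^'m^'m" and t
      by (simp only: matmul.zero_right add_0 matrix_mul_rid mat_commute[of M])
    have "integral {0..pi} (\<lambda>t. mat (cos (\<rho> * of_real (pi - t))) ** (Q t ** ?c t))
        = integral {0..pi} (\<lambda>t. mat (1 / \<rho>) ** (mat (sin (\<rho> * pi) / 2) ** Q t - mat (sin (\<rho> * of_real (pi - 2 * t)) / 2) ** Q t))"
    proof (rule integral_cong)
      fix t
      have "mat (cos (\<rho> * of_real (pi - t))) ** (Q t ** ?c t)
          = mat (cos (\<rho> * of_real (pi - t)) * (sin (\<rho> * of_real t) / \<rho>)) ** Q t"
        unfolding at_c[of "Q t"] unfolding mat_mult_assoc by (rule refl)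
      then show "mat (cos (\<rho> * of_real (pi - t))) ** (Q t ** ?c t)
         = mat (1 / \<rho>) ** (mat (sin (\<rho> * pi) / 2) ** Q t - mat (sin (\<rho> * of_real (pi - 2 * t)) / 2) ** Q t)"
        unfolding sc matmul.diff_left[symmetric] mat_arith[symmetric] mat_mult_assoc .
    qed
    also have "\<dots> = mat (1 / \<rho>) ** (mat (sin (\<rho> * pi) / 2) ** integral {0..pi} Q - sin_transform Q \<rho>)"
      using int_half
      by (simp add: integral_diff integrable_diff integral_mat_mult Qi sin_transform_def)
    finally have XZ: "?X = ?Z"
      unfolding at_c[of H] half by (simp add: matmul.zero_right matmul.add_right matmul.diff_right mat_mult_assoc)
    have "norm (V_form H Y - ?Z) \<le> 2 * (e / cmod \<rho> * norm I) * e * q * (e * q + norm H) / cmod \<rho>"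
      using 1 unfolding XZ .
    also have "\<dots> = C2 / (cmod \<rho>)\<^sup>2" using r0 by (simp add: C2_def field_simps power2_eq_square)
    finally show ?thesis .
  qed
  show ?thesis
  proof (rule that[of "max 1 (2 * e * q)" "C1 + C2 + e * q"])
    fix \<rho> Y assume 1: "ivp Q (\<rho>\<^sup>2) (mat 1) h Y" "\<bar>Im \<rho>\<bar> \<le> 1" "max 1 (2 * e * q) \<le> cmod \<rho>"
    have "C1 / cmod \<rho> \<le> (C1 + C2 + e * q) / cmod \<rho>" using C0 e0 q0 by (intro divide_right_mono) auto
    then show "norm (V_form H Y - (mat (- \<rho> * sin (\<rho> * pi))
          + mat (cos (\<rho> * pi)) ** (h + H + (1/2) *\<^sub>R integral {0..pi} Q) + cos_transform Q \<rho>)) \<le> (C1 + C2 + e * q) / cmod \<rho>"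
      using est_phi[OF 1(1,2)] 1(3) by auto
  next
    fix \<rho> Y assume 1: "ivp Q (\<rho>\<^sup>2) 0 (mat 1) Y" "\<bar>Im \<rho>\<bar> \<le> 1" "max 1 (2 * e * q) \<le> cmod \<rho>"
    have "C2 / (cmod \<rho>)\<^sup>2 \<le> (C1 + C2 + e * q) / (cmod \<rho>)\<^sup>2" using C0 e0 q0 by (intro divide_right_mono) auto
    then show "norm (V_form H Y - (mat (cos (\<rho> * pi))
          + mat (1 / \<rho>) ** (mat (sin (\<rho> * pi)) ** (H + (1/2) *\<^sub>R integral {0..pi} Q) - sin_transform Q \<rho>)))
        \<le> (C1 + C2 + e * q) / (cmod \<rho>)\<^sup>2"
      using est_S[OF 1(1,2)] 1(3) by auto
  next
    fix \<rho> :: complex assume "\<bar>Im \<rho>\<bar> \<le> 1"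
    with ct[of \<rho>] st[of \<rho>] C0
    show "norm (cos_transform Q \<rho>) \<le> C1 + C2 + e * q" "norm (sin_transform Q \<rho>) \<le> C1 + C2 + e * q"
      by simp_all
  qed (use C0 e0 q0 in auto)
qed

end

section \<open>The Weyl matrix\<close>

lemma det_holomorphic:
  fixes A :: "complex \<Rightarrow> complex^'n^'n"
  assumes "\<And>i j. (\<lambda>z. A z $ i $ j) holomorphic_on S"
  shows "(\<lambda>z. det (A z)) holomorphic_on S"
  unfolding det_def by (intro holomorphic_intros assms)

text \<open>Cramer's rule, column by column. It exhibits the entries of the solution as quotients of
  polynomials in the entries of the data, hence as quotients of entire functions in the application.\<close>

lemma matrix_equation_cramer:
  fixes A X B :: "complex^'m^'m"
  assumes "A ** X = B" "det A \<noteq> 0"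
  shows "X $ l $ j = det (\<chi> i k. if k = l then B $ i $ j else A $ i $ k) / det A"
proof -
  have "A *v (\<chi> i. X $ i $ j) = (\<chi> i. B $ i $ j)"
    using assms(1) by (auto simp: vec_eq_iff matrix_matrix_mult_def matrix_vector_mult_def)
  then have "(\<chi> i. X $ i $ j) = (\<chi> l. det (\<chi> i k. if k = l then (\<chi> i. B $ i $ j) $ i else A $ i $ k) / det A)"
    unfolding cramer[OF assms(2)] .
  then show ?thesis by (simp add: vec_eq_iff cong: if_cong)
qed

lemma det_nonzero_if_left_cancel:
  fixes A :: "complex^'m^'m"
  assumes "\<And>X. A ** X = 0 \<Longrightarrow> X = 0"
  shows "det A \<noteq> 0"
proof -
  have "v = 0" if "A *v v = 0" for v
  proof -
    have "A ** (\<chi> i j. v $ i) = 0"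
      using that by (simp add: vec_eq_iff matrix_matrix_mult_def matrix_vector_mult_def)
    from assms[OF this] show ?thesis by (simp add: vec_eq_iff)
  qed
  then have "\<exists>B. B ** A = mat 1" by (simp add: matrix_left_invertible_ker)
  then have "invertible A" by (simp add: invertible_left_inverse)
  then show ?thesis by (simp add: invertible_det_nz)
qed

text \<open>The solution with zero value and unit derivative at 0, equal to \<open>sin (\<rho> x) / \<rho>\<close> for the zero
  potential and \<open>z = \<rho>\<^sup>2\<close>.\<close>

definition sine_solution :: "(real \<Rightarrow> complex^'m^'m) \<Rightarrow> complex \<Rightarrow> real \<Rightarrow> complex^'m^'m" where
  "sine_solution Q z = (SOME Y. ivp Q z 0 (mat 1) Y)"

context
  fixes Q :: "real \<Rightarrow> complex^'m^'m" and h H :: "complex^'m^'m"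
  assumes L2: "L2_potential Q"
begin

lemma ivp_phi: "ivp Q z (mat 1) h (phi Q h z)"
proof -
  obtain Y where "ivp Q z (mat 1) h Y" by (rule ivp_exists[OF L2])
  then have "\<exists>Y. ivp Q z (mat 1) h Y" by blast
  then show ?thesis unfolding phi_def ivp_def by (rule someI_ex)
qed

lemma ivp_sine: "ivp Q z 0 (mat 1) (sine_solution Q z)"
proof -
  obtain Y where "ivp Q z 0 (mat 1) Y" by (rule ivp_exists[OF L2])
  then have "\<exists>Y. ivp Q z 0 (mat 1) Y" by blast
  then show ?thesis unfolding sine_solution_def by (rule someI_ex)
qed

lemma V_form_add_matmul:
  assumes "ivp Q z A B Y" "ivp Q z A' B' Z"
  shows "V_form H (\<lambda>x. Y x ** C + Z x) = V_form H Y ** C + V_form H Z"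
  unfolding V_form_def
  by (simp add: ivp_add_matmul(2)[OF L2 assms] matmul.add_left matmul.add_right matrix_mul_assoc)

text \<open>By uniqueness for the initial value problem, every solution with \<open>U = I\<close> is \<open>\<phi> M + S\<close> with \<open>M\<close>
  its value at 0. Solving \<open>V(\<phi>) M + V(S) = 0\<close> shows that a Weyl solution exists, so that the choice in its
  definition has the required properties.\<close>

lemma weyl_matrix_equation:
  assumes "char_fun Q h H z \<noteq> 0"
  shows "V_form H (phi Q h z) ** weyl_matrix Q h H z = - V_form H (sine_solution Q z)"
proof -
  let ?V = "V_form H (phi Q h z)" and ?S = "V_form H (sine_solution Q z)"
  let ?comb = "\<lambda>C x. phi Q h z x ** C + sine_solution Q z x"
  have comb: "ivp Q z C (h ** C + mat 1) (?comb C)" for C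
    using ivp_add_matmul(1)[OF L2 ivp_phi ivp_sine, of z C] by simp
  have Vcomb: "V_form H (?comb C) = ?V ** C + ?S" for C
    by (rule V_form_add_matmul[OF ivp_phi ivp_sine])
  obtain V' where inv: "?V ** V' = mat 1"
    using assms unfolding char_fun_def invertible_det_nz[symmetric] invertible_def by blast
  define C where "C = - (V' ** ?S)"
  have "sl_solution Q z (?comb C) \<and> U_form h (?comb C) = mat 1 \<and> V_form H (?comb C) = 0"
  proof (intro conjI)
    show "sl_solution Q z (?comb C)" using comb[of C] by (simp add: ivp_def)
    show "U_form h (?comb C) = mat 1" using comb[of C] by (simp add: ivp_def U_form_def)
    show "V_form H (?comb C) = 0"
      unfolding Vcomb C_def by (simp add: matmul.minus_right matrix_mul_assoc inv)
  qed
  then have "\<exists>Y. sl_solution Q z Y \<and> U_form h Y = mat 1 \<and> V_form H Y = 0" by blast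
  then have W: "sl_solution Q z (weyl_solution Q h H z) \<and> U_form h (weyl_solution Q h H z) = mat 1
      \<and> V_form H (weyl_solution Q h H z) = 0"
    unfolding weyl_solution_def by (rule someI_ex)
  define M where "M = weyl_matrix Q h H z"
  have "ivp Q z M (h ** M + mat 1) (weyl_solution Q h H z)"
    using W unfolding ivp_def M_def weyl_matrix_def U_form_def by (auto simp: algebra_simps)
  from ivp_unique[OF L2 this comb[of M], of pi]
  have "V_form H (weyl_solution Q h H z) = V_form H (?comb M)" by (simp add: V_form_def)
  with W have "?V ** M + ?S = 0" by (simp add: Vcomb)
  then show ?thesis by (simp add: M_def add_eq_0_iff2)
qed

lemma char_fun_holomorphic: "char_fun Q h H holomorphic_on S"
  unfolding char_fun_def[abs_def]
  by (intro det_holomorphic V_form_holomorphic[OF L2 ivp_phi])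

lemma weyl_matrix_quotient:
  obtains g where "g holomorphic_on UNIV"
    and "\<And>z. char_fun Q h H z \<noteq> 0 \<Longrightarrow> weyl_matrix Q h H z $ l $ j = g z / char_fun Q h H z"
proof
  let ?g = "\<lambda>z. det (\<chi> i k. if k = l then - V_form H (sine_solution Q z) $ i $ j else V_form H (phi Q h z) $ i $ k)"
  show "?g holomorphic_on UNIV"
  proof (rule det_holomorphic)
    fix i k
    have "(\<lambda>z. - V_form H (sine_solution Q z) $ i $ j) holomorphic_on UNIV"
      "(\<lambda>z. V_form H (phi Q h z) $ i $ k) holomorphic_on UNIV"
      by (intro holomorphic_on_minus V_form_holomorphic[OF L2 ivp_phi] V_form_holomorphic[OF L2 ivp_sine])+
    then show "(\<lambda>z. (\<chi> i k. if k = l then - V_form H (sine_solution Q z) $ i $ j else V_form H (phi Q h z) $ i $ k) $ i $ k)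
        holomorphic_on UNIV"
      by (cases "k = l") simp_all
  qed
  show "weyl_matrix Q h H z $ l $ j = ?g z / char_fun Q h H z" if "char_fun Q h H z \<noteq> 0" for z
    using matrix_equation_cramer[OF weyl_matrix_equation[OF that]] that
    by (simp add: char_fun_def cong: if_cong)
qed

text \<open>Put \<open>s = sin \<rho>\<pi>\<close>, \<open>c = cos \<rho>\<pi>\<close> and \<open>E = V(\<phi>) + \<rho> s\<close>, which is bounded. The equation for \<open>M\<close> reads
  \<open>\<rho> s M = V(S) + E M\<close>. Read as an estimate it gives first \<open>M = O(1/\<rho>)\<close>, then, with the leading term of
  \<open>V(S)\<close>, \<open>M = c / (\<rho> s) + O(1/\<rho>\<^sup>2)\<close>; substituting this into the right-hand side gives the claim. The same
  estimate shows that \<open>V(\<phi>)\<close> has trivial kernel.\<close>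

lemma weyl_matrix_asymptotics:
  defines "\<omega> \<equiv> h + H + (1/2) *\<^sub>R integral {0..pi} Q" and "\<omega>\<^sub>1 \<equiv> H + (1/2) *\<^sub>R integral {0..pi} Q"
  assumes s0: "0 < s0"
  obtains C r where "0 < r"
    and "\<And>\<rho>. \<bar>Im \<rho>\<bar> \<le> 1 \<Longrightarrow> r \<le> cmod \<rho> \<Longrightarrow> s0 \<le> cmod (sin (\<rho> * pi)) \<Longrightarrow> char_fun Q h H (\<rho>\<^sup>2) \<noteq> 0"
    and "\<And>\<rho>. \<bar>Im \<rho>\<bar> \<le> 1 \<Longrightarrow> r \<le> cmod \<rho> \<Longrightarrow> s0 \<le> cmod (sin (\<rho> * pi)) \<Longrightarrow>
       norm (mat (2 * \<rho>) ** weyl_matrix Q h H (\<rho>\<^sup>2) - mat (2 * cot (\<rho> * pi))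
          - mat (2 / \<rho>) ** (\<omega>\<^sub>1 + mat ((cot (\<rho> * pi))\<^sup>2) ** \<omega>))
       \<le> C / cmod \<rho> * (norm (cos_transform Q \<rho>) + norm (sin_transform Q \<rho>) + 1 / cmod \<rho>)"
proof (rule V_form_asymptotics[OF L2, of h H, folded \<omega>_def \<omega>\<^sub>1_def])
  fix C r :: real
  assume r: "0 < r" and C: "0 \<le> C"
    and Vphi: "\<And>\<rho> Y. ivp Q (\<rho>\<^sup>2) (mat 1) h Y \<Longrightarrow> \<bar>Im \<rho>\<bar> \<le> 1 \<Longrightarrow> r \<le> cmod \<rho> \<Longrightarrow>
       norm (V_form H Y - (mat (- \<rho> * sin (\<rho> * pi)) + mat (cos (\<rho> * pi)) ** \<omega> + cos_transform Q \<rho>)) \<le> C / cmod \<rho>"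
    and Vsin: "\<And>\<rho> Y. ivp Q (\<rho>\<^sup>2) 0 (mat 1) Y \<Longrightarrow> \<bar>Im \<rho>\<bar> \<le> 1 \<Longrightarrow> r \<le> cmod \<rho> \<Longrightarrow>
       norm (V_form H Y - (mat (cos (\<rho> * pi)) + mat (1 / \<rho>) ** (mat (sin (\<rho> * pi)) ** \<omega>\<^sub>1 - sin_transform Q \<rho>)))
        \<le> C / (cmod \<rho>)\<^sup>2"
    and ct: "\<And>\<rho>. \<bar>Im \<rho>\<bar> \<le> 1 \<Longrightarrow> norm (cos_transform Q \<rho>) \<le> C"
    and st: "\<And>\<rho>. \<bar>Im \<rho>\<bar> \<le> 1 \<Longrightarrow> norm (sin_transform Q \<rho>) \<le> C"
  define e where "e = exp pi"
  define K where "K = e * norm \<omega> + 2 * C"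
  define K1 where "K1 = e * norm \<omega>\<^sub>1 + 2 * C"
  define K2 where "K2 = e * norm (mat 1 :: complex^'m^'m) + K1"
  define K3 where "K3 = 2 * K2 / s0"
  define K4 where "K4 = (K1 + K * K3) / s0"
  define C' where "C' = 2 / s0 * (1 + C + e / s0 + e * C / s0 + K * K4)"
  define r' where "r' = max (max r 1) (2 * (K + 1) / s0)"
  have e0: "0 \<le> e" by (simp add: e_def)
  have K0: "0 \<le> K" "0 \<le> K1" "0 \<le> K2" using C e0 by (auto simp: K_def K1_def K2_def)
  then have K3_0: "0 \<le> K3" and K4_0: "0 \<le> K4" using s0 by (auto simp: K3_def K4_def)
  have main: "char_fun Q h H (\<rho>\<^sup>2) \<noteq> 0 \<and>
       norm (mat (2 * \<rho>) ** weyl_matrix Q h H (\<rho>\<^sup>2) - mat (2 * cot (\<rho> * pi))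
          - mat (2 / \<rho>) ** (\<omega>\<^sub>1 + mat ((cot (\<rho> * pi))\<^sup>2) ** \<omega>))
       \<le> C' / cmod \<rho> * (norm (cos_transform Q \<rho>) + norm (sin_transform Q \<rho>) + 1 / cmod \<rho>)"
    if im: "\<bar>Im \<rho>\<bar> \<le> 1" and "r' \<le> cmod \<rho>" and sl: "s0 \<le> cmod (sin (\<rho> * pi))" for \<rho>
  proof -
    have rr: "r \<le> cmod \<rho>" "1 \<le> cmod \<rho>" "2 * (K + 1) / s0 \<le> cmod \<rho>" and \<rho>: "\<rho> \<noteq> 0"
      using that(2) by (auto simp: r'_def)
    have r0: "0 < cmod \<rho>" using \<rho> by simp
    define s where "s = sin (\<rho> * pi)"
    define c where "c = cos (\<rho> * pi)"
    define a where "a = cos_transform Q \<rho>"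
    define b where "b = sin_transform Q \<rho>"
    define V where "V = V_form H (phi Q h (\<rho>\<^sup>2))"
    define W where "W = V_form H (sine_solution Q (\<rho>\<^sup>2))"
    define E where "E = V - mat (- \<rho> * s)"
    define E1 where "E1 = V - (mat (- \<rho> * s) + mat c ** \<omega> + a)"
    define E2 where "E2 = W - (mat c + mat (1 / \<rho>) ** (mat s ** \<omega>\<^sub>1 - b))"
    have sl: "s0 \<le> cmod s" using sl by (simp add: s_def)
    have s: "s \<noteq> 0" "0 < cmod s" using sl s0 by auto
    have trig: "cmod s \<le> e" "cmod c \<le> e"
      using cmod_cos_sin_strip[OF im, of pi] by (auto simp: s_def c_def e_def)
    have E1: "norm E1 \<le> C / cmod \<rho>"
      using Vphi[OF ivp_phi im rr(1)] by (simp add: E1_def V_def s_def c_def a_def)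
    have E2: "norm E2 \<le> C / (cmod \<rho>)\<^sup>2"
      using Vsin[OF ivp_sine im rr(1)] by (simp add: E2_def W_def s_def c_def b_def)
    have div1: "x / cmod \<rho> \<le> x" if "0 \<le> x" for x
      using that rr(2) by (simp add: divide_le_eq mult_left_mono[of 1 "cmod \<rho>" x, simplified])
    have div2: "x / (cmod \<rho>)\<^sup>2 \<le> x / cmod \<rho>" if "0 \<le> x" for x
      using div1[of "x / cmod \<rho>"] that by (simp add: power2_eq_square)
    have aC: "norm a \<le> C" and bC: "norm b \<le> C" using ct[OF im] st[OF im] by (auto simp: a_def b_def)
    have normE: "norm E \<le> K"
    proof -
      have "E = mat c ** \<omega> + a + E1" by (simp add: E_def E1_def)
      also have "norm \<dots> \<le> e * norm \<omega> + C + C"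
        using aC E1 div1[OF C] trig(2) by (intro norm_triangle_le add_mono) (auto simp: norm_mat_mult mult_right_mono)
      finally show ?thesis by (simp add: K_def)
    qed
    \<comment> \<open>For large \<open>\<rho>\<close> the scalar \<open>\<rho> s\<close> dominates the bounded matrix \<open>E\<close>.\<close>
    have big: "2 * K * norm X \<le> cmod \<rho> * cmod s * norm X" for X :: "complex^'m^'m"
    proof (rule mult_right_mono)
      have "2 * K \<le> cmod \<rho> * s0" using rr(3) s0 by (simp add: divide_le_eq)
      also have "\<dots> \<le> cmod \<rho> * cmod s" using sl by (intro mult_left_mono) auto
      finally show "2 * K \<le> cmod \<rho> * cmod s" .
    qed simp
    have eqV: "mat (\<rho> * s) ** X = E ** X - V ** X" for X :: "complex^'m^'m"
      by (simp add: E_def matmul.diff_left matmul.add_left mat_arith matmul.minus_left)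
    have "det V \<noteq> 0"
    proof (rule det_nonzero_if_left_cancel)
      fix X :: "complex^'m^'m" assume "V ** X = 0"
      then have "cmod \<rho> * cmod s * norm X = norm (E ** X)"
        using arg_cong[OF eqV[of X], of norm] by (simp add: norm_mat_mult norm_mult)
      also have "\<dots> \<le> K * norm X" by (intro order_trans[OF norm_matrix_mult_le] mult_right_mono normE) auto
      finally have "2 * (cmod \<rho> * cmod s * norm X) \<le> cmod \<rho> * cmod s * norm X" using big[of X] by simp
      then have "cmod \<rho> * cmod s * norm X \<le> 0" by simp
      then show "X = 0" using r0 s by (simp add: mult_le_0_iff)
    qed
    then have nz: "char_fun Q h H (\<rho>\<^sup>2) \<noteq> 0" by (simp add: char_fun_def V_def)
    define M where "M = weyl_matrix Q h H (\<rho>\<^sup>2)"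
    have VM: "V ** M = - W" using weyl_matrix_equation[OF nz] by (simp add: V_def M_def W_def)
    have eqM: "mat (\<rho> * s) ** M = W + E ** M" unfolding eqV VM by simp
    have normW: "norm (W - mat c) \<le> K1 / cmod \<rho>"
    proof -
      have "W - mat c = mat (1 / \<rho>) ** (mat s ** \<omega>\<^sub>1 - b) + E2" by (simp add: E2_def)
      also have "norm \<dots> \<le> 1 / cmod \<rho> * (e * norm \<omega>\<^sub>1 + C) + C / cmod \<rho>"
      proof (intro norm_triangle_le add_mono)
        have "norm (mat s ** \<omega>\<^sub>1 - b) \<le> e * norm \<omega>\<^sub>1 + C"
          using trig(1) bC by (intro order_trans[OF norm_triangle_ineq4] add_mono) (auto simp: norm_mat_mult mult_right_mono)
        then show "norm (mat (1 / \<rho>) ** (mat s ** \<omega>\<^sub>1 - b)) \<le> 1 / cmod \<rho> * (e * norm \<omega>\<^sub>1 + C)"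
          unfolding norm_mat_mult norm_divide by (intro mult_mono) auto
        show "norm E2 \<le> C / cmod \<rho>" using E2 div2[OF C] by simp
      qed
      also have "\<dots> = K1 / cmod \<rho>" using r0 by (simp add: K1_def field_simps)
      finally show ?thesis .
    qed
    have matc: "norm (mat c :: complex^'m^'m) \<le> e * norm (mat 1 :: complex^'m^'m)"
      using norm_mat_mult[of c "mat 1 :: complex^'m^'m"] trig(2) by (simp add: mult_right_mono)
    have normM: "norm M \<le> K3 / cmod \<rho>"
    proof -
      have "norm W \<le> K2"
        using norm_triangle_ineq[of "mat c" "W - mat c"] matc normW div1[OF K0(2)] by (simp add: K2_def)
      moreover have "norm (E ** M) \<le> K * norm M"
        by (intro order_trans[OF norm_matrix_mult_le] mult_right_mono normE) auto
      ultimately have "cmod \<rho> * cmod s * norm M \<le> K2 + K * norm M"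
        using arg_cong[OF eqM, of norm] norm_triangle_ineq[of W "E ** M"] by (simp add: norm_mat_mult norm_mult)
      with big[of M] have "cmod \<rho> * cmod s * norm M \<le> 2 * K2" by simp
      moreover have "cmod \<rho> * s0 * norm M \<le> cmod \<rho> * cmod s * norm M"
        using sl by (intro mult_right_mono mult_left_mono) auto
      ultimately have "cmod \<rho> * s0 * norm M \<le> 2 * K2" by simp
      then show ?thesis using r0 s0 by (simp add: K3_def field_simps)
    qed
    define M1 where "M1 = M - mat (c / (\<rho> * s))"
    have normM1: "norm M1 \<le> K4 / (cmod \<rho>)\<^sup>2"
    proof -
      have "mat (\<rho> * s) ** M1 = (W - mat c) + E ** M"
        using eqM \<rho> s by (simp add: M1_def matmul.diff_right mat_mult_mat)
      then have "cmod \<rho> * cmod s * norm M1 = norm ((W - mat c) + E ** M)"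
        by (metis norm_mat_mult norm_mult)
      also have "\<dots> \<le> K1 / cmod \<rho> + K * (K3 / cmod \<rho>)"
        using K0 by (intro norm_triangle_le add_mono normW order_trans[OF norm_matrix_mult_le] mult_mono normE normM) auto
      finally have "cmod \<rho> * cmod s * norm M1 \<le> K1 / cmod \<rho> + K * (K3 / cmod \<rho>)" .
      moreover have "cmod \<rho> * s0 * norm M1 \<le> cmod \<rho> * cmod s * norm M1"
        using sl by (intro mult_right_mono mult_left_mono) auto
      ultimately have "cmod \<rho> * s0 * norm M1 \<le> (K1 + K * K3) / cmod \<rho>" by (simp add: add_divide_distrib)
      then show ?thesis using r0 s0 by (simp add: K4_def field_simps power2_eq_square)
    qed
    have id: "mat (2 * \<rho>) ** M - mat (2 * cot (\<rho> * pi)) - mat (2 / \<rho>) ** (\<omega>\<^sub>1 + mat ((cot (\<rho> * pi))\<^sup>2) ** \<omega>)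
        = mat (2 / s) ** (- (mat (1 / \<rho>) ** b) + E2 + mat (c / (\<rho> * s)) ** (a + E1) + E ** M1)"
    proof -
      have cot: "cot (\<rho> * pi) = c / s" by (simp add: cot_def c_def s_def)
      have "mat (2 * \<rho>) ** M = mat (2 / s) ** (mat (\<rho> * s) ** M)" using s by (simp add: mat_mult_assoc)
      also have "\<dots> = mat (2 / s) ** (W + (mat (c / (\<rho> * s)) ** E + E ** M1))"
        unfolding eqM by (simp add: M1_def matmul.diff_right mat_commute)
      finally have 1: "mat (2 * \<rho>) ** M = \<dots>" .
      have 2: "W = mat c + mat (1 / \<rho>) ** (mat s ** \<omega>\<^sub>1 - b) + E2" "E = mat c ** \<omega> + a + E1"
        by (simp_all add: E2_def E_def E1_def)
      have 3: "mat (2 / s) ** (mat c + mat (1 / \<rho>) ** (mat s ** \<omega>\<^sub>1 - b) + E2 + (mat (c / (\<rho> * s)) ** (mat c ** \<omega> + a + E1) + X))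
          - mat (2 * (c / s)) - mat (2 / \<rho>) ** (\<omega>\<^sub>1 + mat ((c / s)\<^sup>2) ** \<omega>)
        = mat (2 / s) ** (- (mat (1 / \<rho>) ** b) + E2 + mat (c / (\<rho> * s)) ** (a + E1) + X)" for X :: "complex^'m^'m"
        using \<rho> s by (simp add: matmul.add_right matmul.diff_right matmul.minus_right mat_mult_assoc mat_mult_mat power2_eq_square mult_ac)
      show ?thesis unfolding 1 cot 2(1) using 3[of "E ** M1"] unfolding 2(2) .
    qed
    have "norm (mat (2 / s) ** (- (mat (1 / \<rho>) ** b) + E2 + mat (c / (\<rho> * s)) ** (a + E1) + E ** M1))
      \<le> 2 / s0 * (1 / cmod \<rho> * norm b + C / (cmod \<rho>)\<^sup>2 + e / (cmod \<rho> * s0) * (norm a + C / cmod \<rho>) + K * (K4 / (cmod \<rho>)\<^sup>2))"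
      unfolding norm_mat_mult
    proof (rule mult_mono)
      show "cmod (2 / s) \<le> 2 / s0" unfolding norm_divide using sl s0 by (intro frac_le) auto
      have cs: "cmod (c / (\<rho> * s)) \<le> e / (cmod \<rho> * s0)"
        unfolding norm_divide norm_mult using trig sl s0 r0 by (intro frac_le mult_left_mono) auto
      show "norm (- (mat (1 / \<rho>) ** b) + E2 + mat (c / (\<rho> * s)) ** (a + E1) + E ** M1)
        \<le> 1 / cmod \<rho> * norm b + C / (cmod \<rho>)\<^sup>2 + e / (cmod \<rho> * s0) * (norm a + C / cmod \<rho>) + K * (K4 / (cmod \<rho>)\<^sup>2)"
      proof (intro norm_triangle_le add_mono)
        show "norm (- (mat (1 / \<rho>) ** b)) \<le> 1 / cmod \<rho> * norm b"
          by (simp add: norm_mat_mult norm_divide)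
        show "norm (mat (c / (\<rho> * s)) ** (a + E1)) \<le> e / (cmod \<rho> * s0) * (norm a + C / cmod \<rho>)"
          unfolding norm_mat_mult using cs E1 e0 s0
          by (intro mult_mono norm_triangle_le add_mono) auto
        show "norm (E ** M1) \<le> K * (K4 / (cmod \<rho>)\<^sup>2)"
          using K0 by (intro order_trans[OF norm_matrix_mult_le] mult_mono normE normM1) auto
      qed (rule E2)
    qed (use s0 in auto)
    also have "\<dots> \<le> C' / cmod \<rho> * (norm a + norm b + 1 / cmod \<rho>)"
    proof -
      have "1 / cmod \<rho> * norm b + C / (cmod \<rho>)\<^sup>2 + e / (cmod \<rho> * s0) * (norm a + C / cmod \<rho>) + K * (K4 / (cmod \<rho>)\<^sup>2)
         = (norm b + e / s0 * norm a + (C + e * C / s0 + K * K4) * (1 / cmod \<rho>)) / cmod \<rho>"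
        using r0 s0 by (simp add: field_simps power2_eq_square)
      also have "\<dots> \<le> (1 + C + e / s0 + e * C / s0 + K * K4) * (norm a + norm b + 1 / cmod \<rho>) / cmod \<rho>"
      proof (rule divide_right_mono)
        define T where "T = 1 + C + e / s0 + e * C / s0 + K * K4"
        have T: "1 \<le> T" "e / s0 \<le> T" "C + e * C / s0 + K * K4 \<le> T"
          using C e0 s0 K0 K4_0 by (auto simp: T_def)
        have "norm b + e / s0 * norm a + (C + e * C / s0 + K * K4) * (1 / cmod \<rho>)
           \<le> T * norm b + T * norm a + T * (1 / cmod \<rho>)"
          using mult_right_mono[OF T(1), of "norm b"] mult_right_mono[OF T(2), of "norm a"]
            mult_right_mono[OF T(3), of "1 / cmod \<rho>"] by simp
        then show "norm b + e / s0 * norm a + (C + e * C / s0 + K * K4) * (1 / cmod \<rho>)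
            \<le> (1 + C + e / s0 + e * C / s0 + K * K4) * (norm a + norm b + 1 / cmod \<rho>)"
          unfolding T_def[symmetric] by (simp add: algebra_simps)
      qed simp
      finally have "2 / s0 * (1 / cmod \<rho> * norm b + C / (cmod \<rho>)\<^sup>2 + e / (cmod \<rho> * s0) * (norm a + C / cmod \<rho>) + K * (K4 / (cmod \<rho>)\<^sup>2))
         \<le> 2 / s0 * ((1 + C + e / s0 + e * C / s0 + K * K4) * (norm a + norm b + 1 / cmod \<rho>) / cmod \<rho>)"
        using s0 by (intro mult_left_mono) auto
      moreover have "x * (y * z / w) = x * y / w * z" for x y z w :: real by simp
      ultimately show ?thesis unfolding C'_def by metis
    qed
    finally show ?thesis using nz id unfolding M_def a_def b_def by simp
  qed
  have "0 < r'" by (auto simp: r'_def)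
  then show ?thesis using main that by blast
qed

end

section \<open>Bessel's inequality for the transforms of the potential\<close>

text \<open>The exponentials \<open>exp (- 2 i k t)\<close> up to a sign; the shift to \<open>\<pi> - 2 t\<close> matches the kernels of the
  transforms.\<close>

definition harmonic :: "int \<Rightarrow> real \<Rightarrow> complex" where
  "harmonic k t = exp (\<i> * of_int k * of_real (pi - 2 * t))"

lemma continuous_harmonic: "continuous_on S (harmonic k)"
  unfolding harmonic_def by (intro continuous_intros)

lemma harmonic_mult_cnj: "cnj (harmonic k t) * harmonic l t = harmonic (l - k) t"
  by (simp add: harmonic_def exp_cnj exp_add[symmetric] algebra_simps)

lemma harmonic_has_integral: "(harmonic k has_integral (if k = 0 then of_real pi else 0)) {0..pi}"
proof (cases "k = 0")
  case True
  then show ?thesis using has_integral_const_real[of "1 :: complex" 0 pi]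
    by (simp add: harmonic_def[abs_def] scaleR_conv_of_real)
next
  case False
  let ?F = "\<lambda>t. harmonic k t / (- 2 * \<i> * of_int k)"
  have "(harmonic k has_integral ?F pi - ?F 0) {0..pi}"
  proof (rule fundamental_theorem_of_calculus)
    fix t assume "t \<in> {0..pi}"
    have "((\<lambda>t. \<i> * of_int k * of_real (pi - 2 * t)) has_vector_derivative - 2 * \<i> * of_int k) (at t within {0..pi})"
      by (auto intro!: derivative_eq_intros simp: has_vector_derivative_def scaleR_conv_of_real fun_eq_iff)
    from field_vector_diff_chain_within[OF this DERIV_subset[OF DERIV_exp subset_UNIV]]
    have "(harmonic k has_vector_derivative - 2 * \<i> * of_int k * harmonic k t) (at t within {0..pi})"
      by (simp add: harmonic_def[abs_def] o_def)
    from has_vector_derivative_mult_right[OF this, of "1 / (- 2 * \<i> * of_int k)"]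
    show "(?F has_vector_derivative harmonic k t) (at t within {0..pi})"
      using False by simp
  qed simp
  moreover have "harmonic k pi = harmonic k 0"
  proof -
    have "harmonic k 0 = harmonic k pi * exp (2 * of_int k * of_real pi * \<i>)"
      unfolding harmonic_def by (subst exp_add[symmetric]) (simp add: algebra_simps)
    moreover have "exp (2 * of_int k * of_real pi * \<i>) = 1" using exp_integer_2pi[of "of_int k"] by (simp add: mult_ac)
    ultimately show ?thesis by simp
  qed
  ultimately show ?thesis using False by simp
qed

text \<open>The integral of \<open>\<bar>g - p\<bar>\<^sup>2\<close> is nonnegative, where \<open>p\<close> is the orthogonal projection of \<open>g\<close> to the span
  of the conjugated harmonics with indices in \<open>S\<close>.\<close>

lemma bessel_inequality:
  fixes g :: "real \<Rightarrow> complex"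
  assumes g: "\<And>k. (\<lambda>t. harmonic k t * g t) integrable_on {0..pi}"
    and g2: "(\<lambda>t. (cmod (g t))\<^sup>2) integrable_on {0..pi}" and S: "finite S"
  shows "(\<Sum>k\<in>S. (cmod (integral {0..pi} (\<lambda>t. harmonic k t * g t)))\<^sup>2)
      \<le> pi * integral {0..pi} (\<lambda>t. (cmod (g t))\<^sup>2)"
proof -
  define c where "c k = integral {0..pi} (\<lambda>t. harmonic k t * g t)" for k
  define G where "G = integral {0..pi} (\<lambda>t. (cmod (g t))\<^sup>2)"
  define \<Sigma> where "\<Sigma> = (\<Sum>k\<in>S. (cmod (c k))\<^sup>2)"
  define p where "p t = 1 / pi * (\<Sum>k\<in>S. c k * cnj (harmonic k t))" for t
  have 1: "((\<lambda>t. complex_of_real ((cmod (g t))\<^sup>2)) has_integral of_real G) {0..pi}"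
    using has_integral_linear[OF integrable_integral[OF g2] bounded_linear_of_real[where 'a = complex]] by (simp add: o_def G_def)
  have c: "((\<lambda>t. harmonic k t * g t) has_integral c k) {0..pi}" for k
    using integrable_integral[OF g[of k]] by (simp add: c_def)
  have norm_c: "(\<Sum>k\<in>S. cnj (c k) * c k) = of_real \<Sigma>"
    unfolding \<Sigma>_def of_real_sum complex_norm_square by (intro sum.cong) (simp_all add: mult.commute)
  have "((\<lambda>t. 1 / pi * (\<Sum>k\<in>S. cnj (c k) * (harmonic k t * g t))) has_integral 1 / pi * (\<Sum>k\<in>S. cnj (c k) * c k)) {0..pi}"
    by (intro has_integral_mult_right has_integral_sum S c)
  then have 2: "((\<lambda>t. g t * cnj (p t)) has_integral of_real (\<Sigma> / pi)) {0..pi}"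
    unfolding norm_c by (simp add: p_def sum_distrib_left mult_ac)
  from has_integral_cnj[THEN iffD2, OF 2]
  have 3: "((\<lambda>t. cnj (g t) * p t) has_integral of_real (\<Sigma> / pi)) {0..pi}"
    by (simp add: o_def)
  have "((\<lambda>t. 1 / pi\<^sup>2 * (\<Sum>k\<in>S. \<Sum>l\<in>S. c k * cnj (c l) * (cnj (harmonic k t) * harmonic l t))) has_integral
       1 / pi\<^sup>2 * (\<Sum>k\<in>S. \<Sum>l\<in>S. c k * cnj (c l) * (if l - k = 0 then of_real pi else 0))) {0..pi}"
    unfolding harmonic_mult_cnj by (intro has_integral_mult_right has_integral_sum S harmonic_has_integral)
  moreover have "1 / pi\<^sup>2 * (\<Sum>k\<in>S. \<Sum>l\<in>S. c k * cnj (c l) * (cnj (harmonic k t) * harmonic l t)) = p t * cnj (p t)" for t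
  proof -
    have "p t * cnj (p t) = 1 / pi\<^sup>2 * ((\<Sum>k\<in>S. c k * cnj (harmonic k t)) * (\<Sum>l\<in>S. cnj (c l) * harmonic l t))"
      by (simp add: p_def power2_eq_square)
    also have "\<dots> = 1 / pi\<^sup>2 * (\<Sum>k\<in>S. \<Sum>l\<in>S. c k * cnj (c l) * (cnj (harmonic k t) * harmonic l t))"
      by (simp only: sum_product mult_ac)
    finally show ?thesis ..
  qed
  moreover have "1 / pi\<^sup>2 * (\<Sum>k\<in>S. \<Sum>l\<in>S. c k * cnj (c l) * (if l - k = 0 then of_real pi else 0)) = complex_of_real (\<Sigma> / pi)"
  proof -
    have "(\<Sum>l\<in>S. c k * cnj (c l) * (if l - k = 0 then of_real pi else 0)) = of_real pi * (cnj (c k) * c k)" if "k \<in> S" for k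
      using S that by (simp add: if_distrib[of "\<lambda>x. _ * x"] cong: if_cong)
    then have "(\<Sum>k\<in>S. \<Sum>l\<in>S. c k * cnj (c l) * (if l - k = 0 then of_real pi else 0)) = of_real pi * of_real \<Sigma>"
      by (simp add: norm_c[symmetric] sum_distrib_left)
    then show ?thesis by (simp add: power2_eq_square)
  qed
  ultimately have 4: "((\<lambda>t. p t * cnj (p t)) has_integral of_real (\<Sigma> / pi)) {0..pi}" by simp
  have "((\<lambda>t. complex_of_real ((cmod (g t))\<^sup>2) - g t * cnj (p t) - cnj (g t) * p t + p t * cnj (p t)) has_integral
     of_real G - of_real (\<Sigma> / pi) - of_real (\<Sigma> / pi) + of_real (\<Sigma> / pi)) {0..pi}"
    by (intro has_integral_add has_integral_diff 1 2 3 4)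
  moreover have "complex_of_real ((cmod (g t))\<^sup>2) - g t * cnj (p t) - cnj (g t) * p t + p t * cnj (p t)
      = of_real ((cmod (g t - p t))\<^sup>2)" for t
    unfolding complex_norm_square by (simp add: algebra_simps)
  ultimately have "((\<lambda>t. complex_of_real ((cmod (g t - p t))\<^sup>2)) has_integral of_real (G - \<Sigma> / pi)) {0..pi}" by simp
  from has_integral_linear[OF this bounded_linear_Re]
  have "((\<lambda>t. (cmod (g t - p t))\<^sup>2) has_integral (G - \<Sigma> / pi)) {0..pi}" by (simp add: o_def)
  then have "0 \<le> G - \<Sigma> / pi" by (rule has_integral_nonneg) simp
  then show ?thesis by (simp add: \<Sigma>_def c_def G_def field_simps)
qed

context
  fixes Q :: "real \<Rightarrow> complex^'m^'m"
  assumes L2: "L2_potential Q"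
begin

text \<open>The entries of both transforms at \<open>n + \<zeta>\<close> are combinations of the Fourier coefficients with indices
  \<open>n\<close> and \<open>- n\<close> of \<open>exp (\<plusminus> i \<zeta> (\<pi> - 2t)) Q(t)\<close>. The exponential is bounded on the interval, uniformly for
  \<open>\<bar>\<zeta>\<bar> \<le> 1\<close>, so Bessel's inequality gives a bound that depends only on the \<open>L\<^sub>2\<close> norm of \<open>Q\<close>.\<close>

lemma transforms_square_sum_bounded:
  shows "\<exists>B. \<forall>\<zeta> N. cmod \<zeta> \<le> 1 \<longrightarrow>
    (\<Sum>n<N. (norm (cos_transform Q (of_nat n + \<zeta>)))\<^sup>2 + (norm (sin_transform Q (of_nat n + \<zeta>)))\<^sup>2) \<le> B"
proof -
  define E where "E = exp (2 * pi)"
  define q where "q j k = integral {0..pi} (\<lambda>t. (cmod (Q t $ j $ k))\<^sup>2)" for j k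
  define F where "F \<sigma> \<zeta> n j k = integral {0..pi} (\<lambda>t. harmonic (\<sigma> * int n) t * (exp (\<i> * of_int \<sigma> * \<zeta> * of_real (pi - 2 * t)) * Q t $ j $ k))"
    for \<sigma> :: int and \<zeta> :: complex and n :: nat and j k
  have ai: "(\<lambda>t. f t * Q t $ j $ k) absolutely_integrable_on {0..pi}" if "continuous_on {0..pi} f" for f :: "real \<Rightarrow> complex" and j k
  proof -
    have bil: "bilinear ((*) :: complex \<Rightarrow> complex \<Rightarrow> complex)"
      by (simp add: bilinear_conv_bounded_bilinear bounded_bilinear_mult)
    have meas: "f \<in> borel_measurable (lebesgue_on {0..pi})"
      using that by (rule continuous_imp_measurable_on_sets_lebesgue) simp
    have bou: "bounded (f ` {0..pi})"
      using that by (intro compact_imp_bounded compact_continuous_image) auto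
    show ?thesis
      by (rule absolutely_integrable_bounded_measurable_product[OF bil meas _ bou L2_potential_nth_absolutely_integrable[OF L2]]) simp
  qed
  have q2: "(\<lambda>t. (cmod (Q t $ j $ k))\<^sup>2) absolutely_integrable_on {0..pi}" for j k
    using L2 by (simp add: L2_potential_def set_integrable_def integrable_restrict_space)
  have bessel: "(\<Sum>n<N. (cmod (F \<sigma> \<zeta> n j k))\<^sup>2) \<le> pi * E * q j k"
    if \<zeta>: "cmod \<zeta> \<le> 1" and \<sigma>: "\<sigma> = 1 \<or> \<sigma> = -1" for \<sigma> \<zeta> N j k
  proof -
    let ?g = "\<lambda>t. exp (\<i> * of_int \<sigma> * \<zeta> * of_real (pi - 2 * t)) * Q t $ j $ k"
    have exp_le: "(cmod (exp (\<i> * of_int \<sigma> * \<zeta> * of_real (pi - 2 * t))))\<^sup>2 \<le> E" if "t \<in> {0..pi}" for t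
    proof -
      have "\<bar>of_int \<sigma> * (Im \<zeta> * (pi - 2 * t))\<bar> \<le> 1 * (1 * pi)"
        unfolding abs_mult using abs_Im_le_cmod[of \<zeta>] \<zeta> \<sigma> that by (intro mult_mono) auto
      moreover have "Re (\<i> * of_int \<sigma> * \<zeta> * of_real (pi - 2 * t)) = - (of_int \<sigma> * (Im \<zeta> * (pi - 2 * t)))"
        by (simp add: algebra_simps)
      ultimately have "2 * Re (\<i> * of_int \<sigma> * \<zeta> * of_real (pi - 2 * t)) \<le> 2 * pi"
        by linarith
      then show ?thesis unfolding E_def norm_exp_eq_Re exp_double[symmetric] exp_le_cancel_iff .
    qed
    have g2: "(\<lambda>t. (cmod (?g t))\<^sup>2) integrable_on {0..pi}"
    proof -
      have "(\<lambda>t. (cmod (exp (\<i> * of_int \<sigma> * \<zeta> * of_real (pi - 2 * t))))\<^sup>2 * (cmod (Q t $ j $ k))\<^sup>2) absolutely_integrable_on {0..pi}"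
      proof (rule absolutely_integrable_bounded_measurable_product_real[OF _ _ _ q2])
        have "continuous_on {0..pi} (\<lambda>t. (cmod (exp (\<i> * of_int \<sigma> * \<zeta> * of_real (pi - 2 * t))))\<^sup>2)"
          by (intro continuous_intros)
        then show "(\<lambda>t. (cmod (exp (\<i> * of_int \<sigma> * \<zeta> * of_real (pi - 2 * t))))\<^sup>2) \<in> borel_measurable (lebesgue_on {0..pi})"
            "bounded ((\<lambda>t. (cmod (exp (\<i> * of_int \<sigma> * \<zeta> * of_real (pi - 2 * t))))\<^sup>2) ` {0..pi})"
          by (auto intro: continuous_imp_measurable_on_sets_lebesgue compact_imp_bounded compact_continuous_image)
      qed simp
      then show ?thesis by (simp add: norm_mult power_mult_distrib absolutely_integrable_on_def)
    qed
    have "inj_on (\<lambda>n. \<sigma> * int n) {..<N}" using \<sigma> by (auto simp: inj_on_def)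
    then have "(\<Sum>n<N. (cmod (F \<sigma> \<zeta> n j k))\<^sup>2)
        = (\<Sum>m\<in>(\<lambda>n. \<sigma> * int n) ` {..<N}. (cmod (integral {0..pi} (\<lambda>t. harmonic m t * ?g t)))\<^sup>2)"
      unfolding F_def by (subst sum.reindex) (auto simp: o_def)
    also have "\<dots> \<le> pi * integral {0..pi} (\<lambda>t. (cmod (?g t))\<^sup>2)"
    proof (rule bessel_inequality[OF _ g2])
      have "continuous_on {0..pi} (\<lambda>t. harmonic m t * exp (\<i> * of_int \<sigma> * \<zeta> * of_real (pi - 2 * t)))" for m
        by (intro continuous_intros continuous_harmonic)
      from ai[OF this] show "(\<lambda>t. harmonic m t * ?g t) integrable_on {0..pi}" for m
        by (simp add: absolutely_integrable_on_def mult.assoc)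
    qed simp
    also have "\<dots> \<le> pi * integral {0..pi} (\<lambda>t. E * (cmod (Q t $ j $ k))\<^sup>2)"
      using g2 q2[of j k] exp_le unfolding absolutely_integrable_on_def
      by (intro mult_left_mono integral_le) (auto simp: norm_mult power_mult_distrib intro!: mult_right_mono integrable_on_mult_right)
    finally show ?thesis by (simp add: q_def)
  qed
  have hexp: "harmonic (1 * int n) t * (exp (\<i> * of_int 1 * \<zeta> * of_real (pi - 2 * t)) * q)
        = exp (\<i> * ((of_nat n + \<zeta>) * of_real (pi - 2 * t))) * q"
      "harmonic (- 1 * int n) t * (exp (\<i> * of_int (- 1) * \<zeta> * of_real (pi - 2 * t)) * q)
        = exp (- (\<i> * ((of_nat n + \<zeta>) * of_real (pi - 2 * t)))) * q" for n t \<zeta> q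
    unfolding harmonic_def mult.assoc[symmetric] exp_add[symmetric] by (simp_all add: algebra_simps)
  have Fint: "(\<lambda>t. harmonic (\<sigma> * int n) t * (exp (\<i> * of_int \<sigma> * \<zeta> * of_real (pi - 2 * t)) * Q t $ j $ k)) integrable_on {0..pi}" for \<sigma> n \<zeta> j k
  proof -
    have "continuous_on {0..pi} (\<lambda>t. harmonic (\<sigma> * int n) t * exp (\<i> * of_int \<sigma> * \<zeta> * of_real (pi - 2 * t)))"
      by (intro continuous_intros continuous_harmonic)
    from ai[OF this] show ?thesis by (simp add: absolutely_integrable_on_def mult.assoc)
  qed
  have int_mat: "(\<lambda>t. mat (f t) ** Q t) integrable_on {0..pi}" if "continuous_on {0..pi} f" for f :: "real \<Rightarrow> complex"
    using integrable_matmul(2)[OF potential_integrable[OF L2] bounded_linear.continuous_on[OF bounded_linear_mat that]] by simp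
  have cosF: "cos_transform Q (of_nat n + \<zeta>) $ j $ k = (F 1 \<zeta> n j k + F (-1) \<zeta> n j k) / 4" for n \<zeta> j k
  proof -
    have "cos_transform Q (of_nat n + \<zeta>) $ j $ k
        = integral {0..pi} (\<lambda>t. cos ((of_nat n + \<zeta>) * of_real (pi - 2 * t)) / 2 * Q t $ j $ k)"
      unfolding cos_transform_def by (subst integral_nth_nth[OF int_mat]) (intro continuous_intros, simp, simp only: mat_mult_nth)
    also have "\<dots> = integral {0..pi} (\<lambda>t. (harmonic (1 * int n) t * (exp (\<i> * of_int 1 * \<zeta> * of_real (pi - 2 * t)) * Q t $ j $ k)
         + harmonic (- 1 * int n) t * (exp (\<i> * of_int (-1) * \<zeta> * of_real (pi - 2 * t)) * Q t $ j $ k)) / 4)"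
      by (intro integral_cong) (simp only: hexp cos_exp_eq, simp add: field_simps)
    also have "\<dots> = (F 1 \<zeta> n j k + F (-1) \<zeta> n j k) / 4"
      unfolding F_def using Fint[of 1] Fint[of "-1"] by (simp only: integral_divide integral_add)
    finally show ?thesis .
  qed
  have sinF: "sin_transform Q (of_nat n + \<zeta>) $ j $ k = (F 1 \<zeta> n j k - F (-1) \<zeta> n j k) / (4 * \<i>)" for n \<zeta> j k
  proof -
    have "sin_transform Q (of_nat n + \<zeta>) $ j $ k
        = integral {0..pi} (\<lambda>t. sin ((of_nat n + \<zeta>) * of_real (pi - 2 * t)) / 2 * Q t $ j $ k)"
      unfolding sin_transform_def by (subst integral_nth_nth[OF int_mat]) (intro continuous_intros, simp, simp only: mat_mult_nth)
    also have "\<dots> = integral {0..pi} (\<lambda>t. (harmonic (1 * int n) t * (exp (\<i> * of_int 1 * \<zeta> * of_real (pi - 2 * t)) * Q t $ j $ k)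
         - harmonic (- 1 * int n) t * (exp (\<i> * of_int (-1) * \<zeta> * of_real (pi - 2 * t)) * Q t $ j $ k)) / (4 * \<i>))"
      by (intro integral_cong) (simp only: hexp sin_exp_eq, simp add: field_simps)
    also have "\<dots> = (F 1 \<zeta> n j k - F (-1) \<zeta> n j k) / (4 * \<i>)"
      unfolding F_def using Fint[of 1] Fint[of "-1"] by (simp only: integral_divide integral_diff)
    finally show ?thesis .
  qed
  have sq: "(cmod ((x + y) / 4))\<^sup>2 + (cmod ((x - y) / (4 * \<i>)))\<^sup>2 \<le> (cmod x)\<^sup>2 + (cmod y)\<^sup>2" for x y
  proof -
    have "(cmod (x + y))\<^sup>2 + (cmod (x - y))\<^sup>2 = 2 * ((cmod x)\<^sup>2 + (cmod y)\<^sup>2)"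
      unfolding cmod_power2 by (simp add: power2_eq_square algebra_simps)
    moreover have "(cmod ((x + y) / 4))\<^sup>2 = (cmod (x + y))\<^sup>2 / 16"
      "(cmod ((x - y) / (4 * \<i>)))\<^sup>2 = (cmod (x - y))\<^sup>2 / 16"
      by (simp_all add: norm_divide norm_mult power_divide)
    moreover have "A + B \<le> c + d" if "a + b = 2 * (c + d)" "A = a / 16" "B = b / 16" "0 \<le> c" "0 \<le> d"
      for a b c d A B :: real using that by simp
    ultimately show ?thesis by (metis zero_le_power2)
  qed
  show ?thesis
  proof (intro exI allI impI)
    fix \<zeta> :: complex and N assume \<zeta>: "cmod \<zeta> \<le> 1"
    have "(\<Sum>n<N. (norm (cos_transform Q (of_nat n + \<zeta>)))\<^sup>2 + (norm (sin_transform Q (of_nat n + \<zeta>)))\<^sup>2)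
       \<le> (\<Sum>n<N. \<Sum>j\<in>UNIV. \<Sum>k\<in>UNIV. (cmod (F 1 \<zeta> n j k))\<^sup>2 + (cmod (F (-1) \<zeta> n j k))\<^sup>2)"
      unfolding norm_matrix_sq sum.distrib[symmetric] cosF sinF by (intro sum_mono sq)
    also have "\<dots> = (\<Sum>j\<in>UNIV. \<Sum>k\<in>UNIV. (\<Sum>n<N. (cmod (F 1 \<zeta> n j k))\<^sup>2) + (\<Sum>n<N. (cmod (F (-1) \<zeta> n j k))\<^sup>2))"
      unfolding sum.distrib[symmetric]
      by (subst sum.swap, intro sum.cong refl, subst sum.swap) simp
    also have "\<dots> \<le> (\<Sum>j\<in>UNIV. \<Sum>k\<in>UNIV. pi * E * q j k + pi * E * q j k)"
      by (intro sum_mono add_mono bessel \<zeta>) auto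
    finally show "(\<Sum>n<N. (norm (cos_transform Q (of_nat n + \<zeta>)))\<^sup>2 + (norm (sin_transform Q (of_nat n + \<zeta>)))\<^sup>2)
       \<le> (\<Sum>j\<in>UNIV. \<Sum>k\<in>UNIV. pi * E * q j k + pi * E * q j k)" .
  qed
qed

end

section \<open>Residues and integrals over circles\<close>

text \<open>This covers regular points as well, where the limit and the residue are zero.\<close>

lemma simple_pole_limit:
  assumes "isolated_singularity_at f z" "not_essential f z" "is_pole f z \<Longrightarrow> zorder f z = -1"
  shows "((\<lambda>w. f w * (w - z)) \<longlongrightarrow> residue f z) (at z)"
proof -
  obtain r where r: "0 < r" "f holomorphic_on ball z r - {z}"
    using assms(1) by (auto simp: isolated_singularity_at_def analytic_on_open open_delete)
  have "\<exists>c. ((\<lambda>w. f w * (w - z)) \<longlongrightarrow> c) (at z)"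
  proof (cases "is_pole f z")
    case True
    from zorder_exist_pole[OF r(2) _ _ True] r(1) assms(3)[OF True]
    obtain g s where s: "0 < s" "g holomorphic_on cball z s"
        "\<And>w. w \<in> cball z s - {z} \<Longrightarrow> f w = g w / (w - z)" by auto
    have "g holomorphic_on ball z s" using s(2) by (rule holomorphic_on_subset) auto
    then have "continuous (at z) g"
      using s(1) by (meson centre_in_ball continuous_on_eq_continuous_at holomorphic_on_imp_continuous_on open_ball)
    then have "(g \<longlongrightarrow> g z) (at z)" by (simp add: isCont_def)
    then have "((\<lambda>w. f w * (w - z)) \<longlongrightarrow> g z) (at z)"
    proof (rule Lim_transform_eventually)
      show "eventually (\<lambda>w. g w = f w * (w - z)) (at z)"
        unfolding eventually_at using s by (intro exI[of _ s]) (auto simp: dist_commute)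
    qed
    then show ?thesis ..
  next
    case False
    then obtain x where "(f \<longlongrightarrow> x) (at z)" using assms(2) by (auto simp: not_essential_def)
    then have "((\<lambda>w. f w * (w - z)) \<longlongrightarrow> x * (z - z)) (at z)" by (intro tendsto_intros)
    then show ?thesis ..
  qed
  then obtain c where c: "((\<lambda>w. f w * (w - z)) \<longlongrightarrow> c) (at z)" ..
  moreover have "residue f z = c"
    by (rule residue_simple'[OF _ _ r(2) c]) (use r in auto)
  ultimately show ?thesis by simp
qed

text \<open>Since \<open>\<rho>\<^sup>2 - p\<^sup>2 = (\<rho> - p) (\<rho> + p)\<close>, the product of \<open>\<rho> - p\<close> with the transformed function is
  \<open>f(\<rho>\<^sup>2) (\<rho>\<^sup>2 - p\<^sup>2)\<close> times the factor \<open>2\<rho> / (\<rho> + p)\<close>, which tends to 1. For at most simple poles the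
  limits of such products are the residues.\<close>

lemma residue_square_substitution:
  assumes "isolated_singularity_at f (p\<^sup>2)" "not_essential f (p\<^sup>2)" "is_pole f (p\<^sup>2) \<Longrightarrow> zorder f (p\<^sup>2) = -1"
    and p: "p \<noteq> 0"
  shows "residue (\<lambda>\<rho>. 2 * \<rho> * f (\<rho>\<^sup>2)) p = residue f (p\<^sup>2)"
proof -
  obtain r where r: "0 < r" "f holomorphic_on ball (p\<^sup>2) r - {p\<^sup>2}"
    using assms(1) by (auto simp: isolated_singularity_at_def analytic_on_open open_delete)
  \<comment> \<open>The point \<open>- p\<close> is removed because it has the same square as \<open>p\<close>.\<close>
  define s where "s = ((\<lambda>\<rho>. \<rho>\<^sup>2) -` ball (p\<^sup>2) r) - {- p}"
  have s: "open s" "p \<in> s"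
    unfolding s_def using r(1) p
    by (auto intro!: open_delete continuous_open_vimage continuous_intros simp: eq_neg_iff_add_eq_0 mult_2[symmetric])
  show ?thesis
  proof (rule residue_simple'[OF s])
    have "(\<lambda>\<rho>. f (\<rho>\<^sup>2)) holomorphic_on (s - {p})"
      by (rule holomorphic_on_compose_gen[OF _ r(2), unfolded o_def])
         (auto intro!: holomorphic_intros simp: s_def power2_eq_iff)
    then show "(\<lambda>\<rho>. 2 * \<rho> * f (\<rho>\<^sup>2)) holomorphic_on (s - {p})"
      by (intro holomorphic_intros)
    have sq: "filterlim (\<lambda>\<rho>. \<rho>\<^sup>2) (at (p\<^sup>2)) (at p)"
      unfolding filterlim_at
    proof
      show "eventually (\<lambda>\<rho>. \<rho>\<^sup>2 \<in> UNIV \<and> \<rho>\<^sup>2 \<noteq> p\<^sup>2) (at p)"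
        using eventually_at_in_open[OF s(1,2)]
        by eventually_elim (auto simp: s_def power2_eq_iff)
    qed (auto intro!: tendsto_intros)
    have "((\<lambda>\<rho>. f (\<rho>\<^sup>2) * (\<rho>\<^sup>2 - p\<^sup>2) * (2 * \<rho> / (\<rho> + p))) \<longlongrightarrow> residue f (p\<^sup>2) * (2 * p / (p + p))) (at p)"
      using filterlim_compose[OF simple_pole_limit[OF assms(1-3)] sq] p
      by (intro tendsto_mult tendsto_divide tendsto_add tendsto_const tendsto_ident_at) auto
    then have "((\<lambda>\<rho>. f (\<rho>\<^sup>2) * (\<rho>\<^sup>2 - p\<^sup>2) * (2 * \<rho> / (\<rho> + p))) \<longlongrightarrow> residue f (p\<^sup>2)) (at p)"
      using p by (simp add: mult_2[symmetric])
    then show "((\<lambda>\<rho>. 2 * \<rho> * f (\<rho>\<^sup>2) * (\<rho> - p)) \<longlongrightarrow> residue f (p\<^sup>2)) (at p)"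
    proof (rule Lim_transform_eventually)
      show "eventually (\<lambda>\<rho>. f (\<rho>\<^sup>2) * (\<rho>\<^sup>2 - p\<^sup>2) * (2 * \<rho> / (\<rho> + p)) = 2 * \<rho> * f (\<rho>\<^sup>2) * (\<rho> - p)) (at p)"
        using eventually_at_in_open[OF s(1,2)]
      proof eventually_elim
        case (elim \<rho>)
        then have "\<rho> + p \<noteq> 0" by (auto simp: s_def add_eq_0_iff2)
        moreover have "\<rho>\<^sup>2 - p\<^sup>2 = (\<rho> - p) * (\<rho> + p)" by (simp add: power2_eq_square algebra_simps)
        ultimately show ?case by simp
      qed
    qed
  qed
qed

text \<open>The integral of \<open>(\<bar>f\<bar> - c)\<^sup>2\<close> is nonnegative, where \<open>c\<close> is the mean of \<open>\<bar>f\<bar>\<close>.\<close>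

lemma norm_integral_sq_le:
  fixes f :: "real \<Rightarrow> complex"
  assumes f: "continuous_on {0..1} f"
  shows "(cmod (integral {0..1} f))\<^sup>2 \<le> integral {0..1} (\<lambda>x. (cmod (f x))\<^sup>2)"
proof -
  define c where "c = integral {0..1} (\<lambda>x. cmod (f x))"
  have i: "(\<lambda>x. cmod (f x)) integrable_on {0..1}" "(\<lambda>x. (cmod (f x))\<^sup>2) integrable_on {0..1}"
    using f by (auto intro!: integrable_continuous_real continuous_intros)
  have "cmod (integral {0..1} f) \<le> c"
    unfolding c_def by (rule integral_norm_bound_integral) (use f i in \<open>auto intro: integrable_continuous_real\<close>)
  then have "(cmod (integral {0..1} f))\<^sup>2 \<le> c\<^sup>2" by (intro power_mono) auto
  also have "c\<^sup>2 \<le> integral {0..1} (\<lambda>x. (cmod (f x))\<^sup>2)"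
  proof -
    have "((\<lambda>x. (cmod (f x))\<^sup>2 - 2 * c * cmod (f x) + c\<^sup>2) has_integral
        integral {0..1} (\<lambda>x. (cmod (f x))\<^sup>2) - 2 * c * c + c\<^sup>2) {0..1}"
      using i has_integral_const_real[of "c\<^sup>2" 0 1] unfolding c_def
      by (intro has_integral_add has_integral_diff has_integral_mult_right integrable_integral) auto
    then have "0 \<le> integral {0..1} (\<lambda>x. (cmod (f x))\<^sup>2) - 2 * c * c + c\<^sup>2"
    proof (rule has_integral_nonneg)
      show "0 \<le> (cmod (f x))\<^sup>2 - 2 * c * cmod (f x) + c\<^sup>2" for x
        using zero_le_power2[of "cmod (f x) - c"] by (simp add: power2_eq_square algebra_simps)
    qed
    then show ?thesis by (simp add: power2_eq_square)
  qed
  finally show ?thesis .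
qed

text \<open>The square of a contour integral is at most the square of the length times the mean of the square of
  the integrand, and the sum over \<open>n\<close> may be taken under the mean. Thus a bound for the sum of squares
  at each \<open>\<zeta>\<close>, which is what Bessel's inequality provides, carries over to the integrals.\<close>

lemma contour_integrals_square_sum_le:
  fixes D :: "nat \<Rightarrow> complex \<Rightarrow> complex" and z :: "nat \<Rightarrow> complex"
  assumes r: "0 \<le> r" and cont: "\<And>n. continuous_on (sphere (z n) r) (D n)"
    and bound: "\<And>\<zeta>. \<zeta> \<in> sphere 0 r \<Longrightarrow> (\<Sum>n<N. (cmod (D n (z n + \<zeta>)))\<^sup>2) \<le> B"
  shows "(\<Sum>n<N. (cmod (contour_integral (circlepath (z n) r) (D n)))\<^sup>2) \<le> (2 * pi * r)\<^sup>2 * B"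
proof -
  let ?e = "\<lambda>x. of_real r * exp (2 * of_real pi * \<i> * of_real x) :: complex"
  have e: "?e x \<in> sphere 0 r" for x using r by (simp add: norm_mult)
  have circ: "circlepath (z n) r x = z n + ?e x" for n x by (simp add: circlepath)
  let ?f = "\<lambda>n x. D n (z n + ?e x) * (2 * pi * \<i> * r * exp (2 * of_real pi * \<i> * x))"
  have contD: "continuous_on {0..1} (\<lambda>x. D n (z n + ?e x))" for n
    by (rule continuous_on_compose2[OF cont]) (use e in \<open>auto intro!: continuous_intros simp: dist_norm norm_minus_commute\<close>)
  have contf: "continuous_on {0..1} (?f n)" for n
    by (intro continuous_intros contD)
  have contf2: "continuous_on {0..1} (\<lambda>x. (cmod (?f n x))\<^sup>2)" for n
    by (intro continuous_on_power continuous_on_norm contf)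
  have normf: "(cmod (?f n x))\<^sup>2 = (2 * pi * r)\<^sup>2 * (cmod (D n (z n + ?e x)))\<^sup>2" for n x
    using r by (simp add: norm_mult power_mult_distrib)
  have "(\<Sum>n<N. (cmod (contour_integral (circlepath (z n) r) (D n)))\<^sup>2) = (\<Sum>n<N. (cmod (integral {0..1} (?f n)))\<^sup>2)"
    unfolding contour_integral_integral circ vector_derivative_circlepath by simp
  also have "\<dots> \<le> (\<Sum>n<N. integral {0..1} (\<lambda>x. (cmod (?f n x))\<^sup>2))"
    by (intro sum_mono norm_integral_sq_le contf)
  also have "\<dots> = integral {0..1} (\<lambda>x. \<Sum>n<N. (cmod (?f n x))\<^sup>2)"
    by (intro integral_sum[symmetric] integrable_continuous_real contf2) simp
  also have "\<dots> \<le> integral {0..1} (\<lambda>x :: real. (2 * pi * r)\<^sup>2 * B)"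
  proof (rule integral_le)
    show "(\<lambda>x. \<Sum>n<N. (cmod (?f n x))\<^sup>2) integrable_on {0..1}"
      by (intro integrable_sum integrable_continuous_real contf2) simp
    show "(\<Sum>n<N. (cmod (?f n x))\<^sup>2) \<le> (2 * pi * r)\<^sup>2 * B" for x
      unfolding normf sum_distrib_left[symmetric] by (intro mult_left_mono bound e) auto
  qed auto
  finally show ?thesis by simp
qed

lemma sin_pi_eq_0_ball:
  fixes \<rho> :: complex
  assumes "\<rho> \<in> ball (of_nat n) (1/2)" "sin (\<rho> * pi) = 0"
  shows "\<rho> = of_nat n"
proof -
  obtain k :: int where "\<rho> * pi = of_real (of_int k * pi)"
    using assms(2) unfolding Complex_Transcendental.sin_eq_0 by blast
  then have k: "\<rho> = of_int k" by simp
  then have "cmod (of_int (k - int n)) < 1/2"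
    using assms(1) by (simp add: dist_norm norm_minus_commute)
  then have "k = int n" unfolding norm_of_int by linarith
  then show ?thesis using k by simp
qed

lemma cmod_sin_shift:
  fixes \<zeta> :: complex
  shows "cmod (sin ((of_nat n + \<zeta>) * pi)) = cmod (sin (\<zeta> * pi))"
proof (induction n)
  case (Suc n)
  have "sin ((of_nat (Suc n) + \<zeta>) * pi) = - sin ((of_nat n + \<zeta>) * pi)"
    by (simp add: distrib_right add.commute add.left_commute sin_add cos_add)
  then show ?case using Suc by simp
qed simp

text \<open>The first integral is the residue \<open>1/\<pi>\<close> at \<open>n\<close>. In the second, \<open>cot\<^sup>2 \<rho>\<pi>\<close> is the derivative of
  \<open>- cot \<rho>\<pi> / \<pi> - \<rho>\<close>.\<close>

lemma cot_contour_integrals: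
  fixes n :: nat
  defines "\<gamma> \<equiv> circlepath (of_nat n) (1/4)"
  shows "((\<lambda>\<rho>. cot (\<rho> * pi)) has_contour_integral 2 * \<i>) \<gamma>"
    and "((\<lambda>\<rho>. (cot (\<rho> * pi))\<^sup>2) has_contour_integral 0) \<gamma>"
proof -
  have path: "path_image \<gamma> \<subseteq> ball (of_nat n) (1/2) - {of_nat n}" "valid_path \<gamma>" "pathfinish \<gamma> = pathstart \<gamma>"
    by (auto simp: \<gamma>_def path_image_circlepath)
  have nz: "sin (\<rho> * pi) \<noteq> 0" if "\<rho> \<in> ball (of_nat n) (1/2) - {of_nat n}" for \<rho> :: complex
    using sin_pi_eq_0_ball that by blast
  have holo: "(\<lambda>\<rho>. cot (\<rho> * pi)) holomorphic_on ball (of_nat n) (1/2) - {of_nat n}"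
    unfolding cot_def using nz by (intro holomorphic_intros) auto
  have w1: "winding_number \<gamma> (of_nat n) = 1"
    unfolding \<gamma>_def by (rule winding_number_circlepath_centre) simp
  have "residue (\<lambda>\<rho>. cot (\<rho> * pi)) (of_nat n)
      = cos (of_nat n * of_real pi) / (of_real pi * cos (of_nat n * of_real pi))"
    unfolding cot_def
  proof (rule residue_simple_pole_deriv[where s = UNIV])
    have "(cos (of_nat n * of_real pi :: complex))\<^sup>2 = 1"
      using sin_cos_squared_add[of "of_nat n * of_real pi :: complex"] by simp
    then show "cos (of_nat n * of_real pi :: complex) \<noteq> 0" "of_real pi * cos (of_nat n * of_real pi :: complex) \<noteq> 0"
      by auto
    show "((\<lambda>\<rho>. sin (\<rho> * of_real pi)) has_field_derivative of_real pi * cos (of_nat n * of_real pi)) (at (of_nat n :: complex))"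
      by (auto intro!: derivative_eq_intros)
  qed (auto intro!: holomorphic_intros)
  moreover have "cos (of_nat n * of_real pi :: complex) \<noteq> 0"
    using sin_cos_squared_add[of "of_nat n * of_real pi :: complex"] by auto
  ultimately have res: "residue (\<lambda>\<rho>. cot (\<rho> * pi)) (of_nat n) = 1 / pi" by simp
  have "contour_integral \<gamma> (\<lambda>\<rho>. cot (\<rho> * pi)) = 2 * pi * \<i> * (\<Sum>p\<in>{of_nat n}. winding_number \<gamma> p * residue (\<lambda>\<rho>. cot (\<rho> * pi)) p)"
  proof (rule Residue_theorem[OF _ _ _ holo])
    show "\<forall>z. z \<notin> ball (of_nat n) (1 / 2) \<longrightarrow> winding_number \<gamma> z = 0"
      unfolding \<gamma>_def
      by (auto intro!: winding_number_zero_outside[of _ "cball (of_nat n) (1/4)"] simp: path_image_circlepath)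
  qed (use path in auto)
  then have "contour_integral \<gamma> (\<lambda>\<rho>. cot (\<rho> * pi)) = 2 * \<i>" by (simp add: res w1)
  moreover have "(\<lambda>\<rho>. cot (\<rho> * pi)) contour_integrable_on \<gamma>"
    by (rule contour_integrable_holomorphic_simple[OF holo _ path(2,1)]) auto
  ultimately show "((\<lambda>\<rho>. cot (\<rho> * pi)) has_contour_integral 2 * \<i>) \<gamma>"
    using has_contour_integral_integral[of "\<lambda>\<rho>. cot (\<rho> * pi)" \<gamma>] by simp
  have "((\<lambda>\<rho>. - cot (\<rho> * pi) / pi - \<rho>) has_field_derivative (cot (\<rho> * pi))\<^sup>2) (at \<rho> within path_image \<gamma>)"
    if "\<rho> \<in> path_image \<gamma>" for \<rho> :: complex
  proof -
    have s: "sin (\<rho> * pi) \<noteq> 0" by (rule nz[OF subsetD[OF path(1) that]])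
    have lin: "((\<lambda>\<rho>. \<rho> * of_real pi) has_field_derivative of_real pi) (at \<rho> within path_image \<gamma>)"
      using DERIV_cmult_right[OF DERIV_ident, of "of_real pi" \<rho> "path_image \<gamma>"] by simp
    have d: "((\<lambda>\<rho>. cot (\<rho> * pi)) has_field_derivative - inverse ((sin (\<rho> * pi))\<^sup>2) * pi) (at \<rho> within path_image \<gamma>)"
      by (rule DERIV_chain2[OF DERIV_cot[OF s] lin])
    have "(cos (\<rho> * pi))\<^sup>2 = 1 - (sin (\<rho> * pi))\<^sup>2" by (rule cos_squared_eq)
    then have "- (- inverse ((sin (\<rho> * pi))\<^sup>2) * pi) / pi - 1 = (cot (\<rho> * pi))\<^sup>2"
      using s unfolding cot_def power_divide by (simp add: field_simps)
    then show ?thesis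
      by (rule DERIV_cong[OF DERIV_diff[OF DERIV_cdivide[OF DERIV_minus[OF d]] DERIV_ident]])
  qed
  from contour_integral_primitive[OF this path(2) subset_refl]
  show "((\<lambda>\<rho>. (cot (\<rho> * pi))\<^sup>2) has_contour_integral 0) \<gamma>" by (simp add: path(3))
qed

section \<open>Eigenvalues and the Weyl matrix on the circles\<close>

lemma sin_lower_bound_on_circles:
  obtains s0 where "0 < s0"
    and "\<And>n (\<zeta> :: complex). \<zeta> \<in> sphere 0 (1/4) \<Longrightarrow> s0 \<le> cmod (sin ((of_nat n + \<zeta>) * pi))"
proof -
  have "\<exists>x\<in>sphere (0 :: complex) (1/4). \<forall>y\<in>sphere (0 :: complex) (1/4). cmod (sin (x * pi)) \<le> cmod (sin (y * pi))"
    by (rule continuous_attains_inf) (auto intro!: continuous_intros)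
  then obtain x :: complex where x: "x \<in> sphere 0 (1/4)"
    and min: "\<And>y. y \<in> sphere (0 :: complex) (1/4) \<Longrightarrow> cmod (sin (x * pi)) \<le> cmod (sin (y * pi))" by blast
  have "sin (x * pi) \<noteq> 0" using sin_pi_eq_0_ball[of x 0] x by auto
  then show ?thesis using min that[of "cmod (sin (x * pi))"] by (simp add: cmod_sin_shift)
qed

lemma l2_seq_imp_tendsto_0:
  fixes s :: "nat \<Rightarrow> complex"
  assumes "l2_seq s" shows "s \<longlonglongrightarrow> 0"
proof -
  have "(\<lambda>n. (cmod (s n))\<^sup>2) \<longlonglongrightarrow> 0"
    by (rule summable_LIMSEQ_zero[OF assms[unfolded l2_seq_def]])
  then have "(\<lambda>n. sqrt ((cmod (s n))\<^sup>2)) \<longlonglongrightarrow> sqrt 0" by (rule tendsto_real_sqrt)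
  then show ?thesis by (simp add: tendsto_norm_zero_iff)
qed

text \<open>For large \<open>n\<close> the roots with first index \<open>n\<close> lie within \<open>1/8\<close> of \<open>n\<close>. The finitely many roots to
  which this does not apply are bounded, hence far from large \<open>n\<close>.\<close>

lemma eigenvalue_roots_separated:
  fixes lam :: "nat \<Rightarrow> 'm::finite \<Rightarrow> complex"
  assumes "eigenvalue_indexing Q h H w lam"
  obtains N where "1 \<le> N"
    and "\<And>n q. N \<le> n \<Longrightarrow> cmod (csqrt (lam n q) - of_nat n) < 1/8"
    and "\<And>n n' q. N \<le> n \<Longrightarrow> cmod (csqrt (lam n' q) - of_nat n) < 1/2 \<Longrightarrow> n' = n"
proof -
  have "(\<lambda>n. csqrt (lam n q) - of_nat n) \<longlonglongrightarrow> 0" for q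
  proof -
    obtain \<kappa> where \<kappa>: "l2_seq \<kappa>"
      "\<And>n. n \<ge> 1 \<Longrightarrow> csqrt (lam n q) = of_nat n + w $ q / (of_real pi * of_nat n) + \<kappa> n / of_nat n"
      using assms unfolding eigenvalue_indexing_def by blast
    have inv: "(\<lambda>n. 1 / of_nat n :: complex) \<longlonglongrightarrow> 0" by (rule lim_1_over_n)
    have "(\<lambda>n. w $ q / pi * (1 / of_nat n) + \<kappa> n * (1 / of_nat n)) \<longlonglongrightarrow> w $ q / pi * 0 + 0 * 0"
      by (intro tendsto_intros inv l2_seq_imp_tendsto_0 \<kappa>)
    then have "(\<lambda>n. w $ q / pi * (1 / of_nat n) + \<kappa> n * (1 / of_nat n)) \<longlonglongrightarrow> 0" by simp
    then show ?thesis
    proof (rule Lim_transform_eventually)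
      show "eventually (\<lambda>n. w $ q / pi * (1 / of_nat n) + \<kappa> n * (1 / of_nat n) = csqrt (lam n q) - of_nat n) sequentially"
        using eventually_ge_at_top[of 1] by eventually_elim (simp add: \<kappa>(2))
    qed
  qed
  then have "\<forall>q\<in>UNIV. eventually (\<lambda>n. dist (csqrt (lam n q) - of_nat n) 0 < 1/8) sequentially"
    by (intro ballI tendstoD) auto
  then have "eventually (\<lambda>n. \<forall>q\<in>UNIV. dist (csqrt (lam n q) - of_nat n) 0 < 1/8) sequentially"
    by (intro eventually_ball_finite) auto
  then obtain N1 where N1: "\<And>n q. N1 \<le> n \<Longrightarrow> cmod (csqrt (lam n q) - of_nat n) < 1/8"
    by (auto simp: eventually_sequentially)
  \<comment> \<open>A crude common bound for the finitely many roots with \<open>n < N1\<close>.\<close>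
  define b where "b = (\<Sum>n<N1. \<Sum>q\<in>UNIV. cmod (csqrt (lam n q)))"
  define N where "N = N1 + nat \<lceil>b\<rceil> + 1"
  have b: "cmod (csqrt (lam n q)) \<le> b" if "n < N1" for n q
  proof -
    have "cmod (csqrt (lam n q)) \<le> (\<Sum>q\<in>UNIV. cmod (csqrt (lam n q)))" by (rule member_le_sum) auto
    also have "\<dots> \<le> b" unfolding b_def using that by (intro member_le_sum[of n "{..<N1}" "\<lambda>n. \<Sum>q\<in>UNIV. cmod (csqrt (lam n q))"]) (auto intro: sum_nonneg)
    finally show ?thesis .
  qed
  show ?thesis
  proof (rule that[of N])
    show "1 \<le> N" by (simp add: N_def)
    show "cmod (csqrt (lam n q) - of_nat n) < 1/8" if "N \<le> n" for n q
      using N1[of n q] that by (simp add: N_def)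
    fix n n' q assume n: "N \<le> n" and close: "cmod (csqrt (lam n' q) - of_nat n) < 1/2"
    show "n' = n"
    proof (cases "N1 \<le> n'")
      case True
      have "cmod (of_nat n' - of_nat n) \<le> cmod (csqrt (lam n' q) - of_nat n) + cmod (csqrt (lam n' q) - of_nat n')"
        using norm_triangle_ineq4[of "csqrt (lam n' q) - of_nat n" "csqrt (lam n' q) - of_nat n'"] by simp
      then have "cmod (of_int (int n' - int n)) < 1" using close N1[OF True, of q] by simp
      then show ?thesis unfolding norm_of_int by linarith
    next
      case False
      have "real n = cmod (of_nat n)" by simp
      also have "\<dots> \<le> cmod (csqrt (lam n' q)) + cmod (csqrt (lam n' q) - of_nat n)"
        using norm_triangle_ineq4[of "csqrt (lam n' q)" "csqrt (lam n' q) - of_nat n"] by simp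
      also have "\<dots> < b + 1" using b[of n' q] close False by simp
      also have "\<dots> \<le> real N" unfolding N_def by linarith
      finally show ?thesis using n by simp
    qed
  qed
qed

context
  fixes Q :: "real \<Rightarrow> complex^'m^'m" and h H :: "complex^'m^'m"
  assumes L2: "L2_potential Q"
begin

text \<open>The general asymptotics on the circles of radius \<open>1/4\<close> about \<open>n\<close>, where \<open>\<bar>sin \<rho>\<pi>\<bar>\<close> has a lower bound
  that is independent of \<open>n\<close>. The coefficient \<open>2/\<rho>\<close> is replaced by \<open>2/n\<close>, at a cost of order \<open>1/n\<^sup>2\<close>.\<close>

lemma weyl_matrix_on_circles:
  defines "\<omega> \<equiv> h + H + (1/2) *\<^sub>R integral {0..pi} Q" and "\<omega>\<^sub>1 \<equiv> H + (1/2) *\<^sub>R integral {0..pi} Q"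
  obtains C N where "0 \<le> C" "1 \<le> N"
    and "\<And>n (\<zeta> :: complex). N \<le> n \<Longrightarrow> \<zeta> \<in> sphere 0 (1/4) \<Longrightarrow> char_fun Q h H ((of_nat n + \<zeta>)\<^sup>2) \<noteq> 0"
    and "\<And>n (\<zeta> :: complex). N \<le> n \<Longrightarrow> \<zeta> \<in> sphere 0 (1/4) \<Longrightarrow>
       norm (mat (2 * (of_nat n + \<zeta>)) ** weyl_matrix Q h H ((of_nat n + \<zeta>)\<^sup>2)
          - mat (2 * cot ((of_nat n + \<zeta>) * pi))
          - mat (2 / of_nat n) ** (\<omega>\<^sub>1 + mat ((cot ((of_nat n + \<zeta>) * pi))\<^sup>2) ** \<omega>))
       \<le> C / n * (norm (cos_transform Q (of_nat n + \<zeta>)) + norm (sin_transform Q (of_nat n + \<zeta>)) + 1 / n)"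
proof (rule sin_lower_bound_on_circles)
  fix s0 :: real
  assume s0: "0 < s0" "\<And>n (\<zeta> :: complex). \<zeta> \<in> sphere 0 (1/4) \<Longrightarrow> s0 \<le> cmod (sin ((of_nat n + \<zeta>) * pi))"
  show ?thesis
  proof (rule weyl_matrix_asymptotics[OF L2 s0(1), of h H, folded \<omega>_def \<omega>\<^sub>1_def])
    fix C r :: real
    assume r: "0 < r"
      and nz: "\<And>\<rho>. \<bar>Im \<rho>\<bar> \<le> 1 \<Longrightarrow> r \<le> cmod \<rho> \<Longrightarrow> s0 \<le> cmod (sin (\<rho> * pi)) \<Longrightarrow> char_fun Q h H (\<rho>\<^sup>2) \<noteq> 0"
      and asym: "\<And>\<rho>. \<bar>Im \<rho>\<bar> \<le> 1 \<Longrightarrow> r \<le> cmod \<rho> \<Longrightarrow> s0 \<le> cmod (sin (\<rho> * pi)) \<Longrightarrow>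
       norm (mat (2 * \<rho>) ** weyl_matrix Q h H (\<rho>\<^sup>2) - mat (2 * cot (\<rho> * pi))
          - mat (2 / \<rho>) ** (\<omega>\<^sub>1 + mat ((cot (\<rho> * pi))\<^sup>2) ** \<omega>))
       \<le> C / cmod \<rho> * (norm (cos_transform Q \<rho>) + norm (sin_transform Q \<rho>) + 1 / cmod \<rho>)"
    define N where "N = nat \<lceil>2 * r\<rceil> + 1"
    define T where "T = norm \<omega>\<^sub>1 + (exp pi / s0)\<^sup>2 * norm \<omega>"
    have T0: "0 \<le> T" by (simp add: T_def)
    define C' where "C' = 4 * \<bar>C\<bar> + T"
    have rho: "\<bar>Im (of_nat n + \<zeta>)\<bar> \<le> 1" "r \<le> cmod (of_nat n + \<zeta>)" "n / 2 \<le> cmod (of_nat n + \<zeta>)" "1 \<le> n"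
      if "N \<le> n" "\<zeta> \<in> sphere 0 (1/4)" for n \<zeta>
    proof -
      have z: "cmod \<zeta> = 1/4" using that(2) by simp
      show "\<bar>Im (of_nat n + \<zeta>)\<bar> \<le> 1" using abs_Im_le_cmod[of \<zeta>] z by simp
      show n: "1 \<le> n" using that(1) by (simp add: N_def)
      have "real n \<le> cmod (of_nat n + \<zeta>) + 1/4" using norm_triangle_ineq4[of "of_nat n + \<zeta>" \<zeta>] z by simp
      then show half: "n / 2 \<le> cmod (of_nat n + \<zeta>)" using n by simp
      have "2 * r \<le> n" using that(1) unfolding N_def by linarith
      then show "r \<le> cmod (of_nat n + \<zeta>)" using half by simp
    qed
    show ?thesis
    proof (rule that[of C' N])
      show "0 \<le> C'" using T0 by (simp add: C'_def)
      show "1 \<le> N" by (simp add: N_def)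
      fix n :: nat and \<zeta> :: complex assume n: "N \<le> n" and \<zeta>: "\<zeta> \<in> sphere 0 (1/4)"
      note rho = rho[OF n \<zeta>] and sl = s0(2)[OF \<zeta>, of n]
      show "char_fun Q h H ((of_nat n + \<zeta>)\<^sup>2) \<noteq> 0" by (rule nz[OF rho(1,2) sl])
      define \<rho> where "\<rho> = of_nat n + \<zeta>"
      define a where "a = norm (cos_transform Q \<rho>)"
      define b where "b = norm (sin_transform Q \<rho>)"
      have ab: "0 \<le> a" "0 \<le> b" by (auto simp: a_def b_def)
      have n0: "0 < real n" and r0: "0 < cmod \<rho>" using rho by (auto simp: \<rho>_def)
      let ?T = "\<omega>\<^sub>1 + mat ((cot (\<rho> * pi))\<^sup>2) ** \<omega>"
      let ?M = "mat (2 * \<rho>) ** weyl_matrix Q h H (\<rho>\<^sup>2) - mat (2 * cot (\<rho> * pi))"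
      have "cmod (cot (\<rho> * pi)) \<le> exp pi / s0"
        unfolding cot_def norm_divide using cmod_cos_sin_strip(1)[OF rho(1), of pi] sl s0(1)
        by (intro frac_le) (auto simp: \<rho>_def)
      then have "norm ?T \<le> T"
        unfolding T_def by (intro norm_triangle_le add_mono order_refl) (auto simp: norm_mat_mult norm_power intro!: mult_right_mono power_mono)
      moreover have "cmod (2 / \<rho> - 2 / of_nat n) \<le> 1 / n\<^sup>2"
      proof -
        have \<rho>0: "\<rho> \<noteq> 0" using r0 by auto
        have "2 / \<rho> - 2 / of_nat n = - (2 * \<zeta>) / (\<rho> * of_nat n)"
          using \<rho>0 n0 by (simp add: \<rho>_def field_simps)
        then have "cmod (2 / \<rho> - 2 / of_nat n) = 2 * cmod \<zeta> / (cmod \<rho> * n)" by (simp add: norm_divide norm_mult)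
        also have "cmod \<zeta> = 1/4" using \<zeta> by simp
        also have "2 * (1/4) / (cmod \<rho> * n) = (1/2) / (cmod \<rho> * n)" by simp
        also have "(1/2) / (cmod \<rho> * n) \<le> (1/2) / (n / 2 * n)"
          using rho(3) n0 r0 by (intro divide_left_mono mult_right_mono mult_pos_pos) (auto simp: \<rho>_def)
        finally show ?thesis by (simp add: power2_eq_square)
      qed
      ultimately have "norm (mat (2 / \<rho> - 2 / of_nat n) ** ?T) \<le> 1 / n\<^sup>2 * T"
        unfolding norm_mat_mult by (intro mult_mono) auto
      moreover have "norm (?M - mat (2 / \<rho>) ** ?T) \<le> \<bar>C\<bar> * (2 / n) * (a + b + 2 / n)"
      proof -
        have "norm (?M - mat (2 / \<rho>) ** ?T) \<le> C / cmod \<rho> * (a + b + 1 / cmod \<rho>)"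
          using asym[OF rho(1,2) sl] by (simp only: \<rho>_def a_def b_def)
        also have "\<dots> \<le> \<bar>C\<bar> * (2 / n) * (a + b + 2 / n)"
        proof -
          have inv: "1 / cmod \<rho> \<le> 2 / n" using rho(3) n0 r0 by (simp add: \<rho>_def field_simps)
          have "C / cmod \<rho> \<le> \<bar>C\<bar> * (1 / cmod \<rho>)" using r0 by (simp add: divide_right_mono)
          also have "\<dots> \<le> \<bar>C\<bar> * (2 / n)" by (intro mult_left_mono inv) auto
          finally show ?thesis using ab inv n0 by (intro mult_mono) (auto intro: add_nonneg_nonneg)
        qed
        finally show ?thesis .
      qed
      moreover have "?M - mat (2 / of_nat n) ** ?T = (?M - mat (2 / \<rho>) ** ?T) + mat (2 / \<rho> - 2 / of_nat n) ** ?T"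
        by (simp add: mat_arith matmul.diff_left)
      ultimately have "norm (?M - mat (2 / of_nat n) ** ?T) \<le> \<bar>C\<bar> * (2 / n) * (a + b + 2 / n) + 1 / n\<^sup>2 * T"
        by (metis norm_triangle_mono)
      also have "\<dots> \<le> C' / n * (a + b + 1 / n)"
      proof -
        have "\<bar>C\<bar> * (2 / n) * (a + b + 2 / n) \<le> \<bar>C\<bar> * (2 / n) * (2 * (a + b + 1 / n))"
          using ab n0 by (intro mult_left_mono) auto
        moreover have "1 / n\<^sup>2 * T \<le> T / n * (a + b + 1 / n)"
          using mult_left_mono[of "1 / n" "a + b + 1 / n" "T / n"] ab T0 n0 by (simp add: power2_eq_square)
        ultimately have "\<bar>C\<bar> * (2 / n) * (a + b + 2 / n) + 1 / n\<^sup>2 * T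
           \<le> \<bar>C\<bar> * (2 / n) * (2 * (a + b + 1 / n)) + T / n * (a + b + 1 / n)" by (rule add_mono)
        also have "\<dots> = C' / n * (a + b + 1 / n)" by (simp add: C'_def algebra_simps add_divide_distrib)
        finally show ?thesis .
      qed
      finally show "norm (mat (2 * (of_nat n + \<zeta>)) ** weyl_matrix Q h H ((of_nat n + \<zeta>)\<^sup>2)
          - mat (2 * cot ((of_nat n + \<zeta>) * pi))
          - mat (2 / of_nat n) ** (\<omega>\<^sub>1 + mat ((cot ((of_nat n + \<zeta>) * pi))\<^sup>2) ** \<omega>))
       \<le> C' / n * (norm (cos_transform Q (of_nat n + \<zeta>)) + norm (sin_transform Q (of_nat n + \<zeta>)) + 1 / n)"
        unfolding a_def b_def \<rho>_def .
    qed
  qed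
qed

lemma char_fun_nonzero_somewhere: obtains z where "char_fun Q h H z \<noteq> 0"
proof (rule weyl_matrix_on_circles)
  fix N assume "\<And>n (\<zeta> :: complex). N \<le> n \<Longrightarrow> \<zeta> \<in> sphere 0 (1/4) \<Longrightarrow> char_fun Q h H ((of_nat n + \<zeta>)\<^sup>2) \<noteq> 0"
  from this[of N "1/4"] show thesis by (intro that) auto
qed

lemma eventually_char_fun_nonzero: "eventually (\<lambda>u. char_fun Q h H u \<noteq> 0) (at z)"
proof (cases "char_fun Q h H z = 0")
  case True
  obtain \<beta> where "char_fun Q h H \<beta> \<noteq> 0" by (rule char_fun_nonzero_somewhere)
  with True obtain r where "0 < r" "\<And>u. u \<in> ball z r - {z} \<Longrightarrow> char_fun Q h H u \<noteq> 0"
    using isolated_zeros[OF char_fun_holomorphic[OF L2] open_UNIV connected_UNIV, of z h H \<beta>] by auto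
  then show ?thesis unfolding eventually_at by (intro exI[of _ r]) (auto simp: dist_commute)
next
  case False
  have "continuous (at z) (char_fun Q h H)"
    using holomorphic_on_imp_continuous_on[OF char_fun_holomorphic[OF L2, where S = UNIV]]
    by (auto simp: continuous_on_eq_continuous_at)
  then show ?thesis using False by (auto simp: isCont_def intro: tendsto_imp_eventually_ne)
qed

text \<open>At a zero the characteristic function has positive order, because it does not vanish identically;
  so the zero is listed at least once.\<close>

lemma char_fun_zero_in_range:
  assumes "eigenvalue_indexing Q h H w lam" "char_fun Q h H z = 0"
  obtains n q where "lam n q = z"
proof -
  have "zorder (char_fun Q h H) z > 0"
    using zorder_pos_iff[OF char_fun_holomorphic[OF L2] open_UNIV, of z h H] assms(2)
      eventually_frequently[OF _ eventually_char_fun_nonzero[of z]] by auto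
  moreover have "int (card {(n, q). lam n q = z}) = zorder (char_fun Q h H) z"
    using assms unfolding eigenvalue_indexing_def by blast
  ultimately have "card {(n, q). lam n q = z} \<noteq> 0" by simp
  then have "{(n, q). lam n q = z} \<noteq> {}" by (metis card.empty)
  then show ?thesis using that by auto
qed

lemma weyl_matrix_holomorphic:
  "(\<lambda>z. weyl_matrix Q h H z $ j $ k) holomorphic_on {z. char_fun Q h H z \<noteq> 0}"
proof (rule weyl_matrix_quotient[OF L2, of h H j k])
  fix g assume g: "g holomorphic_on UNIV"
    "\<And>z. char_fun Q h H z \<noteq> 0 \<Longrightarrow> weyl_matrix Q h H z $ j $ k = g z / char_fun Q h H z"
  have "(\<lambda>z. g z / char_fun Q h H z) holomorphic_on {z. char_fun Q h H z \<noteq> 0}"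
    using g(1) by (intro holomorphic_intros char_fun_holomorphic[OF L2]) (auto intro: holomorphic_on_subset)
  then show ?thesis by (rule holomorphic_transform) (simp add: g(2))
qed

lemma weyl_matrix_singularity:
  "isolated_singularity_at (\<lambda>z. weyl_matrix Q h H z $ j $ k) z"
  "not_essential (\<lambda>z. weyl_matrix Q h H z $ j $ k) z"
proof (rule_tac [!] weyl_matrix_quotient[OF L2, of h H j k])
  fix g assume g: "g holomorphic_on UNIV"
    "\<And>z. char_fun Q h H z \<noteq> 0 \<Longrightarrow> weyl_matrix Q h H z $ j $ k = g z / char_fun Q h H z"
  have ev: "eventually (\<lambda>u. weyl_matrix Q h H u $ j $ k = g u / char_fun Q h H u) (at z)"
    using eventually_char_fun_nonzero[of z] by eventually_elim (rule g(2))
  have iso: "isolated_singularity_at g z" "isolated_singularity_at (char_fun Q h H) z"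
    using g(1) char_fun_holomorphic[OF L2, of h H UNIV]
    by (auto intro!: isolated_singularity_at_analytic exI[of _ UNIV] simp: analytic_at)
  have ne: "not_essential g z" "not_essential (char_fun Q h H) z"
    using g(1) char_fun_holomorphic[OF L2, of h H UNIV]
    by (auto intro!: not_essential_analytic exI[of _ UNIV] simp: analytic_at)
  show "isolated_singularity_at (\<lambda>z. weyl_matrix Q h H z $ j $ k) z"
    using isolated_singularity_at_divide[OF iso ne(2)] isolated_singularity_at_cong[OF ev refl] by simp
  show "not_essential (\<lambda>z. weyl_matrix Q h H z $ j $ k) z"
    using not_essential_divide[OF ne iso] not_essential_cong[OF ev refl] by simp
qed

end

section \<open>Residue sums\<close>

lemma alpha_sum_nth:
  "alpha_sum Q h H lam R n $ j $ k
    = (\<Sum>q | (n, q) \<in> R. residue (\<lambda>u. weyl_matrix Q h H u $ j $ k) (lam n q))"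
proof -
  have "alpha_sum Q h H lam R n $ j $ k
      = (\<Sum>q\<in>UNIV. if (n, q) \<in> R then residue (\<lambda>u. weyl_matrix Q h H u $ j $ k) (lam n q) else 0)"
    unfolding alpha_sum_def sum_component
    by (intro sum.cong) (auto simp: alpha_def matrix_residue_def)
  then show ?thesis by (simp add: sum.inter_filter[symmetric])
qed

text \<open>By the separation of the roots, the singularities of \<open>2 \<rho> M(\<rho>\<^sup>2)\<close> in the disc of radius \<open>1/2\<close> about \<open>n\<close>
  are among the roots with first index \<open>n\<close>, and these lie inside the circle. The residue theorem therefore
  gives the sum of the residues of \<open>M\<close> over the distinct values \<open>lam n q\<close>. A representative of such a
  value also has first index \<open>n\<close>, so this is the sum that defines \<open>alpha_sum\<close>.\<close>

lemma has_contour_integral_alpha_sum: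
  fixes lam :: "nat \<Rightarrow> 'm::finite \<Rightarrow> complex"
  assumes A: "class_A12 Q h H w lam" and R: "representatives lam R"
  shows "\<exists>N. \<forall>n\<ge>N. \<forall>j k.
     ((\<lambda>\<rho>. 2 * \<rho> * weyl_matrix Q h H (\<rho>\<^sup>2) $ j $ k) has_contour_integral
        2 * pi * \<i> * alpha_sum Q h H lam R n $ j $ k) (circlepath (of_nat n) (1/4))"
proof -
  have L2: "L2_potential Q" and ind: "eigenvalue_indexing Q h H w lam" and simple: "all_poles_simple (weyl_matrix Q h H)"
    using A by (auto simp: class_A12_def class_A_def)
  from eigenvalue_roots_separated[OF ind] obtain N where N: "1 \<le> N"
    and near: "\<And>n q. N \<le> n \<Longrightarrow> cmod (csqrt (lam n q) - of_nat n) < 1/8"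
    and sep: "\<And>n n' q. N \<le> n \<Longrightarrow> cmod (csqrt (lam n' q) - of_nat n) < 1/2 \<Longrightarrow> n' = n"
    by metis
  show ?thesis
  proof (intro exI[of _ N] allI impI)
    fix n j k assume n: "N \<le> n"
    let ?M = "\<lambda>z. weyl_matrix Q h H z $ j $ k" and ?c = "complex_of_nat n"
    let ?g = "\<lambda>\<rho>. 2 * \<rho> * ?M (\<rho>\<^sup>2)" and ?\<gamma> = "circlepath ?c (1/4)"
    define pts where "pts = csqrt ` range (lam n)"
    have Re_pos: "0 < Re \<rho>" if "\<rho> \<in> ball ?c (1/2)" for \<rho>
    proof -
      have "\<bar>Re (?c - \<rho>)\<bar> < 1/2" using that abs_Re_le_cmod[of "?c - \<rho>"] by (simp add: dist_norm)
      then show ?thesis using n N by (simp add: abs_if split: if_splits)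
    qed
    have zero: "\<rho> \<in> pts" if \<rho>: "\<rho> \<in> ball ?c (1/2)" and z: "char_fun Q h H (\<rho>\<^sup>2) = 0" for \<rho>
    proof -
      obtain n' q where lam: "lam n' q = \<rho>\<^sup>2" by (rule char_fun_zero_in_range[OF L2 ind z])
      then have "csqrt (lam n' q) = \<rho>" using Re_pos[OF \<rho>] by (simp add: csqrt_square)
      moreover from this have "n' = n" using sep[OF n, of n' q] \<rho> by (simp add: dist_norm norm_minus_commute)
      ultimately show ?thesis by (auto simp: pts_def)
    qed
    have pts: "cmod (p - ?c) < 1/8" "p \<noteq> 0" if "p \<in> pts" for p
    proof -
      show *: "cmod (p - ?c) < 1/8" using that near[OF n] by (auto simp: pts_def)
      then have "p \<in> ball ?c (1/2)" by (simp add: dist_norm norm_minus_commute)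
      from Re_pos[OF this] show "p \<noteq> 0" by auto
    qed
    have holo: "?g holomorphic_on ball ?c (1/2) - pts"
    proof -
      have "(\<lambda>\<rho>. ?M (\<rho>\<^sup>2)) holomorphic_on ball ?c (1/2) - pts"
        by (rule holomorphic_on_compose_gen[OF _ weyl_matrix_holomorphic[OF L2], unfolded o_def])
           (use zero in \<open>auto intro!: holomorphic_intros\<close>)
      then show ?thesis by (intro holomorphic_intros)
    qed
    have image: "path_image ?\<gamma> \<subseteq> ball ?c (1/2) - pts"
    proof
      fix \<rho> assume "\<rho> \<in> path_image ?\<gamma>"
      then have \<rho>: "cmod (\<rho> - ?c) = 1/4" by (simp add: path_image_circlepath dist_norm norm_minus_commute)
      then show "\<rho> \<in> ball ?c (1/2) - pts" using pts(1)[of \<rho>] by (auto simp: dist_norm norm_minus_commute)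
    qed
    have res: "residue ?g p = residue ?M (p\<^sup>2)" if "p \<in> pts" for p
      using simple pts(2)[OF that]
      by (intro residue_square_substitution weyl_matrix_singularity[OF L2]) (auto simp: all_poles_simple_def)
    have "contour_integral ?\<gamma> ?g = 2 * pi * \<i> * (\<Sum>p\<in>pts. winding_number ?\<gamma> p * residue ?g p)"
    proof (rule Residue_theorem[OF _ _ _ holo _ _ image])
      show "\<forall>z. z \<notin> ball ?c (1 / 2) \<longrightarrow> winding_number ?\<gamma> z = 0"
        by (auto intro!: winding_number_zero_outside[of _ "cball ?c (1/4)"] simp: path_image_circlepath)
    qed (auto simp: pts_def)
    also have "(\<Sum>p\<in>pts. winding_number ?\<gamma> p * residue ?g p) = (\<Sum>p\<in>pts. residue ?M (p\<^sup>2))"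
    proof (rule sum.cong[OF refl])
      fix p assume p: "p \<in> pts"
      have "winding_number ?\<gamma> p = 1" using pts(1)[OF p] by (intro winding_number_circlepath) auto
      then show "winding_number ?\<gamma> p * residue ?g p = residue ?M (p\<^sup>2)" by (simp add: res[OF p])
    qed
    also have "\<dots> = (\<Sum>z\<in>range (lam n). residue ?M z)"
      unfolding pts_def by (subst sum.reindex) (auto simp: inj_on_def o_def dest: arg_cong[where f = "\<lambda>z. z\<^sup>2"])
    also have "range (lam n) = lam n ` {q. (n, q) \<in> R}"
    proof (intro equalityI subsetI)
      fix z assume "z \<in> range (lam n)"
      then obtain q where q: "z = lam n q" by auto
      then have "z \<in> (\<lambda>(n, q). lam n q) ` R"
        using R unfolding representatives_def bij_betw_def by (auto simp: image_iff)
      then obtain n' q' where q': "(n', q') \<in> R" "lam n' q' = z" by auto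
      then have "n' = n" using sep[OF n, of n' q'] near[OF n, of q] q by simp
      then show "z \<in> lam n ` {q. (n, q) \<in> R}" using q' by auto
    qed auto
    also have "(\<Sum>z\<in>lam n ` {q. (n, q) \<in> R}. residue ?M z) = (\<Sum>q | (n, q) \<in> R. residue ?M (lam n q))"
    proof (rule sum.reindex[unfolded o_def])
      show "inj_on (lam n) {q. (n, q) \<in> R}"
        using R unfolding representatives_def bij_betw_def inj_on_def by auto
    qed
    finally have "contour_integral ?\<gamma> ?g = 2 * pi * \<i> * alpha_sum Q h H lam R n $ j $ k"
      by (simp only: alpha_sum_nth)
    moreover have "?g contour_integrable_on ?\<gamma>"
      by (rule contour_integrable_holomorphic_simple[OF holo _ _ image]) (auto simp: pts_def intro!: open_Diff finite_imp_closed)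
    ultimately show "(?g has_contour_integral 2 * pi * \<i> * alpha_sum Q h H lam R n $ j $ k) ?\<gamma>"
      using has_contour_integral_integral[of ?g ?\<gamma>] by simp
  qed
qed

lemma row_sum_norm_le: "row_sum_norm A \<le> real CARD('m) * norm A" for A :: "complex^'m^'m"
  unfolding row_sum_norm_def
proof (rule Max.boundedI)
  fix s assume "s \<in> range (\<lambda>j. \<Sum>k\<in>UNIV. cmod (A $ j $ k))"
  then obtain j where "s = (\<Sum>k\<in>UNIV. cmod (A $ j $ k))" by auto
  also have "\<dots> \<le> real CARD('m) * norm A"
    by (rule sum_bounded_above) (rule order_trans[OF Finite_Cartesian_Product.norm_nth_le Finite_Cartesian_Product.norm_nth_le])
  finally show "s \<le> real CARD('m) * norm A" .
qed auto

lemma row_sum_norm_nonneg: "0 \<le> row_sum_norm A"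
proof -
  have "0 \<le> (\<Sum>k\<in>UNIV. cmod (A $ j $ k))" for j by (intro sum_nonneg) auto
  also have "(\<Sum>k\<in>UNIV. cmod (A $ j $ k)) \<le> row_sum_norm A" for j
    unfolding row_sum_norm_def by (intro Max_ge) auto
  finally show ?thesis .
qed

lemma l2_seq_row_sum_norm:
  fixes K :: "nat \<Rightarrow> complex^'m^'m"
  assumes "\<And>j k. summable (\<lambda>n. (cmod (K n $ j $ k))\<^sup>2)"
  shows "l2_seq (\<lambda>n. row_sum_norm (K n))"
  unfolding l2_seq_def
proof (rule summable_comparison_test')
  show "summable (\<lambda>n. (real CARD('m))\<^sup>2 * (norm (K n))\<^sup>2)"
    unfolding norm_matrix_sq by (intro summable_mult summable_sum assms)
  show "norm ((norm (row_sum_norm (K n)))\<^sup>2) \<le> (real CARD('m))\<^sup>2 * (norm (K n))\<^sup>2" for n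
    using power_mono[OF row_sum_norm_le row_sum_norm_nonneg, of "K n" 2] by (simp add: power_mult_distrib)
qed

theorem lemma3:
  fixes Q :: "real \<Rightarrow> complex^'m^'m"
    and h H :: "complex^'m^'m"
    and w :: "complex^'m"
    and lam :: "nat \<Rightarrow> 'm \<Rightarrow> complex"
    and R :: "(nat \<times> 'm) set"
  assumes "class_A12 Q h H w lam"
    and "representatives lam R"
  shows "\<exists>K :: nat \<Rightarrow> complex^'m^'m.
           (\<forall>n\<ge>1. alpha_sum Q h H lam R n = (2 / pi) *\<^sub>R mat 1 + (1 / real n) *\<^sub>R K n) \<and>
           l2_seq (\<lambda>n. row_sum_norm (K n))"
proof -
  have L2: "L2_potential Q" using assms(1) by (simp add: class_A12_def class_A_def)
  define \<omega> where "\<omega> = h + H + (1/2) *\<^sub>R integral {0..pi} Q"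
  define \<omega>\<^sub>1 where "\<omega>\<^sub>1 = H + (1/2) *\<^sub>R integral {0..pi} Q"
  define K where "K n = real n *\<^sub>R (alpha_sum Q h H lam R n - (2 / pi) *\<^sub>R mat 1)" for n
  obtain N1 where residues: "\<And>n j k. N1 \<le> n \<Longrightarrow>
     ((\<lambda>\<rho>. 2 * \<rho> * weyl_matrix Q h H (\<rho>\<^sup>2) $ j $ k) has_contour_integral
        2 * pi * \<i> * alpha_sum Q h H lam R n $ j $ k) (circlepath (of_nat n) (1/4))"
    using has_contour_integral_alpha_sum[OF assms] by blast
  obtain B where B: "\<And>\<zeta> N. cmod \<zeta> \<le> 1 \<Longrightarrow>
    (\<Sum>n<N. (norm (cos_transform Q (of_nat n + \<zeta>)))\<^sup>2 + (norm (sin_transform Q (of_nat n + \<zeta>)))\<^sup>2) \<le> B"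
    using transforms_square_sum_bounded[OF L2] by blast
  have "summable (\<lambda>n. (cmod (K n $ j $ k))\<^sup>2)" for j k
  proof (rule weyl_matrix_on_circles[OF L2, of h H, folded \<omega>_def \<omega>\<^sub>1_def])
    fix C N2
    assume C: "0 \<le> C" and N2: "1 \<le> N2"
      and nz: "\<And>n (\<zeta> :: complex). N2 \<le> n \<Longrightarrow> \<zeta> \<in> sphere 0 (1/4) \<Longrightarrow> char_fun Q h H ((of_nat n + \<zeta>)\<^sup>2) \<noteq> 0"
      and est: "\<And>n (\<zeta> :: complex). N2 \<le> n \<Longrightarrow> \<zeta> \<in> sphere 0 (1/4) \<Longrightarrow>
       norm (mat (2 * (of_nat n + \<zeta>)) ** weyl_matrix Q h H ((of_nat n + \<zeta>)\<^sup>2)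
          - mat (2 * cot ((of_nat n + \<zeta>) * pi))
          - mat (2 / of_nat n) ** (\<omega>\<^sub>1 + mat ((cot ((of_nat n + \<zeta>) * pi))\<^sup>2) ** \<omega>))
       \<le> C / n * (norm (cos_transform Q (of_nat n + \<zeta>)) + norm (sin_transform Q (of_nat n + \<zeta>)) + 1 / n)"
    define N where "N = max N1 N2"
    define D where "D n \<rho> = of_nat n * (2 * \<rho> * weyl_matrix Q h H (\<rho>\<^sup>2) $ j $ k - 2 * cot (\<rho> * pi) * mat 1 $ j $ k
        - 2 / of_nat n * (\<omega>\<^sub>1 $ j $ k + (cot (\<rho> * pi))\<^sup>2 * \<omega> $ j $ k))" for n and \<rho> :: complex
    let ?\<gamma> = "\<lambda>n. circlepath (of_nat n) (1/4)"
    \<comment> \<open>\<open>D n\<close> is \<open>n\<close> times the error of the asymptotic formula; the explicit terms integrate to \<open>2\<pi>i (2/\<pi>) I\<close>.\<close>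
    have D_int: "contour_integral (?\<gamma> n) (D n) = 2 * pi * \<i> * K n $ j $ k" if n: "N \<le> n" for n
    proof -
      have const: "((\<lambda>\<rho>. \<omega>\<^sub>1 $ j $ k) has_contour_integral 0) (?\<gamma> n)"
        using contour_integral_primitive[of UNIV "\<lambda>\<rho>. \<omega>\<^sub>1 $ j $ k * \<rho>" "\<lambda>\<rho>. \<omega>\<^sub>1 $ j $ k" "?\<gamma> n"]
        by (auto intro!: derivative_eq_intros)
      have "(D n has_contour_integral of_nat n * (2 * pi * \<i> * alpha_sum Q h H lam R n $ j $ k - 2 * (2 * \<i>) * mat 1 $ j $ k
          - 2 / of_nat n * (0 + 0 * \<omega> $ j $ k))) (?\<gamma> n)"
        unfolding D_def using n
        by (intro has_contour_integral_lmul has_contour_integral_diff has_contour_integral_add has_contour_integral_rmul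
             residues cot_contour_integrals const) (auto simp: N_def)
      moreover have "of_nat n * (2 * pi * \<i> * alpha_sum Q h H lam R n $ j $ k - 2 * (2 * \<i>) * mat 1 $ j $ k
          - 2 / of_nat n * (0 + 0 * \<omega> $ j $ k)) = 2 * pi * \<i> * K n $ j $ k"
        by (simp add: K_def scaleR_conv_of_real[where 'a = complex] field_simps)
      ultimately show ?thesis by (metis contour_integral_unique)
    qed
    have D_cont: "continuous_on (sphere (of_nat n) (1/4)) (D n)" if n: "N \<le> n" for n
    proof -
      have on_sphere: "\<rho> - of_nat n \<in> sphere (0 :: complex) (1/4)" "of_nat n + (\<rho> - of_nat n) = \<rho>"
        if "\<rho> \<in> sphere (of_nat n) (1/4)" for \<rho> using that by (auto simp: dist_norm norm_minus_commute)
      have "continuous_on (sphere (of_nat n) (1/4)) (\<lambda>\<rho>. weyl_matrix Q h H (\<rho>\<^sup>2) $ j $ k)"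
      proof (rule continuous_on_compose2[OF holomorphic_on_imp_continuous_on[OF weyl_matrix_holomorphic[OF L2, of h H j k]]])
        show "(\<lambda>\<rho>. \<rho>\<^sup>2) ` sphere (of_nat n) (1/4) \<subseteq> {z. char_fun Q h H z \<noteq> 0}"
        proof (intro image_subsetI CollectI)
          fix \<rho> :: complex assume \<rho>: "\<rho> \<in> sphere (of_nat n) (1/4)"
          have "N2 \<le> n" using n by (simp add: N_def)
          from nz[OF this on_sphere(1)[OF \<rho>]] show "char_fun Q h H (\<rho>\<^sup>2) \<noteq> 0"
            by (simp only: on_sphere(2)[OF \<rho>] not_False_eq_True)
        qed
      qed (intro continuous_intros)
      moreover have "sin (\<rho> * pi) \<noteq> 0" if \<rho>: "\<rho> \<in> sphere (of_nat n) (1/4)" for \<rho> :: complex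
      proof
        assume "sin (\<rho> * pi) = 0"
        moreover have "\<rho> \<in> ball (of_nat n) (1/2)" using \<rho> by simp
        ultimately have "\<rho> = of_nat n" by (intro sin_pi_eq_0_ball)
        with \<rho> show False by simp
      qed
      then have "continuous_on (sphere (of_nat n) (1/4)) (\<lambda>\<rho> :: complex. cot (\<rho> * pi))"
        unfolding cot_def by (intro continuous_on_divide continuous_intros ballI)
      ultimately show ?thesis
        unfolding D_def by (intro continuous_on_mult continuous_on_diff continuous_on_add continuous_on_power
            continuous_on_const continuous_on_id)
    qed
    have D_bound: "(cmod (D n (of_nat n + \<zeta>)))\<^sup>2
        \<le> 3 * C\<^sup>2 * ((norm (cos_transform Q (of_nat n + \<zeta>)))\<^sup>2 + (norm (sin_transform Q (of_nat n + \<zeta>)))\<^sup>2 + inverse (real n ^ 2))"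
      if n: "N \<le> n" and \<zeta>: "\<zeta> \<in> sphere 0 (1/4)" for n and \<zeta> :: complex
    proof -
      define a where "a = norm (cos_transform Q (of_nat n + \<zeta>))"
      define b where "b = norm (sin_transform Q (of_nat n + \<zeta>))"
      have n0: "0 < real n" "N2 \<le> n" using n N2 by (auto simp: N_def)
      let ?X = "mat (2 * (of_nat n + \<zeta>)) ** weyl_matrix Q h H ((of_nat n + \<zeta>)\<^sup>2)
          - mat (2 * cot ((of_nat n + \<zeta>) * pi))
          - mat (2 / of_nat n) ** (\<omega>\<^sub>1 + mat ((cot ((of_nat n + \<zeta>) * pi))\<^sup>2) ** \<omega>)"
      have "mat (2 * cot ((of_nat n + \<zeta>) * pi)) $ j $ k = 2 * cot ((of_nat n + \<zeta>) * pi) * (mat 1 :: complex^'m^'m) $ j $ k"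
        by (simp add: mat_def)
      then have "D n (of_nat n + \<zeta>) = of_nat n * ?X $ j $ k"
        by (simp add: D_def mat_mult_nth)
      then have "cmod (D n (of_nat n + \<zeta>)) = n * cmod (?X $ j $ k)" by (simp add: norm_mult)
      also have "\<dots> \<le> n * norm ?X"
        by (intro mult_left_mono order_trans[OF Finite_Cartesian_Product.norm_nth_le Finite_Cartesian_Product.norm_nth_le]) auto
      also have "\<dots> \<le> n * (C / n * (a + b + 1 / n))"
        unfolding a_def b_def by (intro mult_left_mono est n0 \<zeta>) auto
      also have "\<dots> = C * (a + b + 1 / n)" using n0 by simp
      finally have "(cmod (D n (of_nat n + \<zeta>)))\<^sup>2 \<le> (C * (a + b + 1 / n))\<^sup>2" by (intro power_mono) auto
      also have "\<dots> = C\<^sup>2 * (a + b + 1 / n)\<^sup>2" by (simp add: power_mult_distrib)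
      also have "\<dots> \<le> C\<^sup>2 * (3 * (a\<^sup>2 + b\<^sup>2 + (1 / n)\<^sup>2))"
      proof (rule mult_left_mono)
        have "(x + y + z)\<^sup>2 \<le> 3 * (x\<^sup>2 + y\<^sup>2 + z\<^sup>2)" for x y z :: real
        proof -
          have "3 * (x\<^sup>2 + y\<^sup>2 + z\<^sup>2) - (x + y + z)\<^sup>2 = (x - y)\<^sup>2 + (y - z)\<^sup>2 + (x - z)\<^sup>2"
            by (simp add: power2_eq_square algebra_simps)
          moreover have "0 \<le> (x - y)\<^sup>2 + (y - z)\<^sup>2 + (x - z)\<^sup>2" by simp
          ultimately show ?thesis by linarith
        qed
        then show "(a + b + 1 / n)\<^sup>2 \<le> 3 * (a\<^sup>2 + b\<^sup>2 + (1 / n)\<^sup>2)" .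
      qed simp
      finally show ?thesis by (simp add: a_def b_def power_divide inverse_eq_divide algebra_simps)
    qed
    have sq: "summable (\<lambda>n. inverse (real n ^ 2))" by (rule inverse_power_summable) simp
    define B' where "B' = 3 * C\<^sup>2 * (B + (\<Sum>n. inverse (real n ^ 2)))"
    \<comment> \<open>The indices are shifted by \<open>N\<close>, as the estimates hold from there on only.\<close>
    have sum_D: "(\<Sum>i<M. (cmod (D (i + N) (of_nat (i + N) + \<zeta>)))\<^sup>2) \<le> B'"
      if \<zeta>: "\<zeta> \<in> sphere 0 (1/4)" for \<zeta> :: complex and M
    proof -
      let ?t = "\<lambda>n. (norm (cos_transform Q (of_nat n + \<zeta>)))\<^sup>2 + (norm (sin_transform Q (of_nat n + \<zeta>)))\<^sup>2"
      have shift: "(\<Sum>i<M. f (i + N)) \<le> (\<Sum>n<M + N. f n)" if "\<And>n. 0 \<le> f n" for f :: "nat \<Rightarrow> real"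
      proof -
        have "(\<Sum>i<M. f (i + N)) = (\<Sum>n\<in>{N..<M + N}. f n)"
          using sum.shift_bounds_nat_ivl[of f 0 N M] by (simp add: lessThan_atLeast0)
        also have "\<dots> \<le> (\<Sum>n<M + N. f n)" using that by (intro sum_mono2) auto
        finally show ?thesis .
      qed
      have "(\<Sum>i<M. (cmod (D (i + N) (of_nat (i + N) + \<zeta>)))\<^sup>2)
          \<le> (\<Sum>i<M. 3 * C\<^sup>2 * (?t (i + N) + inverse (real (i + N) ^ 2)))"
        using \<zeta> by (intro sum_mono D_bound) auto
      also have "\<dots> = 3 * C\<^sup>2 * ((\<Sum>i<M. ?t (i + N)) + (\<Sum>i<M. inverse (real (i + N) ^ 2)))"
        by (simp only: sum_distrib_left[symmetric] sum.distrib)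
      also have "\<dots> \<le> B'"
        unfolding B'_def
      proof (intro mult_left_mono add_mono)
        have "(\<Sum>i<M. ?t (i + N)) \<le> (\<Sum>n<M + N. ?t n)" by (rule shift) simp
        also have "\<dots> \<le> B" using \<zeta> by (intro B) simp
        finally show "(\<Sum>i<M. ?t (i + N)) \<le> B" .
        have "(\<Sum>i<M. inverse (real (i + N) ^ 2)) \<le> (\<Sum>n<M + N. inverse (real n ^ 2))"
          by (rule shift[of "\<lambda>n. inverse (real n ^ 2)"]) simp
        also have "\<dots> \<le> (\<Sum>n. inverse (real n ^ 2))" by (rule sum_le_suminf[OF sq]) auto
        finally show "(\<Sum>i<M. inverse (real (i + N) ^ 2)) \<le> (\<Sum>n. inverse (real n ^ 2))" .
      qed simp
      finally show ?thesis .
    qed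
    have "summable (\<lambda>i. (cmod (K (i + N) $ j $ k))\<^sup>2)"
    proof (rule bounded_imp_summable)
      fix M
      have eq: "(cmod (contour_integral (?\<gamma> (i + N)) (D (i + N))))\<^sup>2 = (2 * pi)\<^sup>2 * (cmod (K (i + N) $ j $ k))\<^sup>2" for i
        unfolding D_int[OF le_add2] by (simp add: norm_mult power_mult_distrib)
      have "(\<Sum>i<Suc M. (cmod (contour_integral (?\<gamma> (i + N)) (D (i + N))))\<^sup>2) \<le> (2 * pi * (1/4))\<^sup>2 * B'"
      proof (rule contour_integrals_square_sum_le[where z = "\<lambda>i. of_nat (i + N)" and D = "\<lambda>i. D (i + N)"])
        show "continuous_on (sphere (of_nat (i + N)) (1/4)) (D (i + N))" for i by (rule D_cont) simp
      qed (simp, rule sum_D)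
      then have "(\<Sum>i<Suc M. (2 * pi)\<^sup>2 * (cmod (K (i + N) $ j $ k))\<^sup>2) \<le> (2 * pi * (1/4))\<^sup>2 * B'"
        unfolding eq .
      then have "(2 * pi)\<^sup>2 * (\<Sum>i<Suc M. (cmod (K (i + N) $ j $ k))\<^sup>2) \<le> (2 * pi)\<^sup>2 * ((1/4)\<^sup>2 * B')"
        by (simp only: sum_distrib_left power_mult_distrib mult.assoc)
      then show "(\<Sum>i\<le>M. (cmod (K (i + N) $ j $ k))\<^sup>2) \<le> (1/4)\<^sup>2 * B'"
        by (subst (asm) mult_le_cancel_left_pos) (simp_all add: lessThan_Suc_atMost)
    qed simp
    then show ?thesis by (subst (asm) summable_iff_shift)
  qed
  then have "l2_seq (\<lambda>n. row_sum_norm (K n))" by (rule l2_seq_row_sum_norm)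
  moreover have "\<forall>n\<ge>1. alpha_sum Q h H lam R n = (2 / pi) *\<^sub>R mat 1 + (1 / real n) *\<^sub>R K n"
    by (simp add: K_def)
  ultimately show ?thesis by blast
qed

end
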